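(* Let $(\mathcal{A},\tau)$ be a unital $C^*$-algebra with a faithful tracial state $\tau$, let $\mathcal{A}_{+}$ be the cone of positive elements of $\mathcal{A}$, and let $\eta(x)=x\log x$ for $x>0$, $\eta(0)=0$. For $A,B\in\mathcal{A}_{+}$ define $$J_{\tau,\eta}(A,B):=\frac12\tau(\eta(A))+\frac12\tau(\eta(B))-\tau\!\left(\eta\!\left(\frac{A+B}{2}\right)\right).$$ Then the square root $\sqrt{J_{\tau,\eta}(A,B)}$ is a metric on $\mathcal{A}_{+}$ (in particular $J_{\tau,\eta}\ge 0$). In particular, its restriction to $\mathcal{S}_\tau:=\{\rho\in\mathcal{A}_{+}:\tau(\rho)=1\}$ is a metric.
   Context: A faithful tracial state on a unital $C^*$-algebra $\mathcal{A}$ is a positive linear functional $\tau:\mathcal{A}\to\mathbb{C}$ with $\tau(\mathbf{1})=1$, $\tau(xy)=\tau(yx)$ for all $x,y\in\mathcal{A}$, and $\tau(x^*x)=0\Rightarrow x=0$. $\eta$ is applied by continuous functional calculus. *)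

theory Defs
  imports "HOL-Analysis.Analysis"
begin

section \<open>Unital C*-algebras\<close>

text \<open>
  \<^class>\<open>real_normed_algebra_1\<close> provides a unital normed real algebra; its axioms \<open>0 \<noteq> 1\<close> and
  \<open>norm 1 = 1\<close> exclude only the zero algebra (in a nonzero C*-algebra \<open>norm 1 = 1\<close> follows from the
  C*-identity), and the zero algebra carries no state.
\<close>

class unital_cstar_algebra = real_normed_algebra_1 + banach +
  fixes scaleC :: "complex \<Rightarrow> 'a \<Rightarrow> 'a"  (infixr "*\<^sub>C" 75)
    and star :: "'a \<Rightarrow> 'a"
  assumes scaleC_of_real: "complex_of_real r *\<^sub>C x = r *\<^sub>R x"
    and scaleC_add_right: "c *\<^sub>C (x + y) = c *\<^sub>C x + c *\<^sub>C y"
    and scaleC_add_left: "(c + d) *\<^sub>C x = c *\<^sub>C x + d *\<^sub>C x"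
    and scaleC_scaleC: "c *\<^sub>C (d *\<^sub>C x) = (c * d) *\<^sub>C x"
    and mult_scaleC_left: "(c *\<^sub>C x) * y = c *\<^sub>C (x * y)"
    and mult_scaleC_right: "x * (c *\<^sub>C y) = c *\<^sub>C (x * y)"
    and norm_scaleC: "norm (c *\<^sub>C x) = cmod c * norm x"
    and star_add: "star (x + y) = star x + star y"
    and star_scaleC: "star (c *\<^sub>C x) = cnj c *\<^sub>C star x"
    and star_mult: "star (x * y) = star y * star x"
    and star_star: "star (star x) = x"
    and cstar_identity: "norm (star x * x) = (norm x)\<^sup>2"

definition spectrum :: "'a::unital_cstar_algebra \<Rightarrow> complex set" where
  "spectrum a = {z. \<not> (\<exists>b. (z *\<^sub>C 1 - a) * b = 1 \<and> b * (z *\<^sub>C 1 - a) = 1)}"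

definition positive_cone :: "'a::unital_cstar_algebra set" where
  "positive_cone = {a. star a = a \<and> spectrum a \<subseteq> \<real>\<^sub>\<ge>\<^sub>0}"

section \<open>Continuous functional calculus\<close>

text \<open>
  \<open>cfc_hom a \<Phi>\<close>: \<open>\<Phi>\<close> represents a unital *-homomorphism from the continuous functions on the spectrum
  of \<open>a\<close> into the algebra that maps the identity function to \<open>a\<close>.  Elements of the domain are
  represented by functions on the whole plane that are continuous on the spectrum; the first
  conjunct makes \<open>\<Phi>\<close> depend on their restriction to the spectrum only.  For normal \<open>a\<close> the
  values of \<open>\<Phi>\<close> on such functions exist and are uniquely determined.
\<close>

definition cfc_hom :: "'a::unital_cstar_algebra \<Rightarrow> ((complex \<Rightarrow> complex) \<Rightarrow> 'a) \<Rightarrow> bool" where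
  "cfc_hom a \<Phi> \<longleftrightarrow>
    (\<forall>f g. continuous_on (spectrum a) f \<longrightarrow> (\<forall>z\<in>spectrum a. f z = g z) \<longrightarrow> \<Phi> f = \<Phi> g) \<and>
    (\<forall>f g. continuous_on (spectrum a) f \<longrightarrow> continuous_on (spectrum a) g \<longrightarrow>
       \<Phi> (\<lambda>z. f z + g z) = \<Phi> f + \<Phi> g \<and> \<Phi> (\<lambda>z. f z * g z) = \<Phi> f * \<Phi> g) \<and>
    (\<forall>c f. continuous_on (spectrum a) f \<longrightarrow>
       \<Phi> (\<lambda>z. c * f z) = c *\<^sub>C \<Phi> f \<and> \<Phi> (\<lambda>z. cnj (f z)) = star (\<Phi> f)) \<and>
    \<Phi> (\<lambda>z. 1) = 1 \<and> \<Phi> (\<lambda>z. z) = a"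

definition cfc :: "(complex \<Rightarrow> complex) \<Rightarrow> 'a::unital_cstar_algebra \<Rightarrow> 'a" where
  "cfc f a = (THE y. \<exists>\<Phi>. cfc_hom a \<Phi> \<and> y = \<Phi> f)"

section \<open>Faithful tracial states and the Jensen divergence of \<open>x log x\<close>\<close>

definition faithful_tracial_state :: "('a::unital_cstar_algebra \<Rightarrow> complex) \<Rightarrow> bool" where
  "faithful_tracial_state \<tau> \<longleftrightarrow>
    (\<forall>x y. \<tau> (x + y) = \<tau> x + \<tau> y) \<and>
    (\<forall>c x. \<tau> (c *\<^sub>C x) = c * \<tau> x) \<and>
    (\<forall>x\<in>positive_cone. \<tau> x \<in> \<real>\<^sub>\<ge>\<^sub>0) \<and>
    \<tau> 1 = 1 \<and>
    (\<forall>x y. \<tau> (x * y) = \<tau> (y * x)) \<and>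
    (\<forall>x. \<tau> (star x * x) = 0 \<longrightarrow> x = 0)"

definition eta :: "real \<Rightarrow> real" where
  "eta x = (if x = 0 then 0 else x * ln x)"

text \<open>The spectrum of a positive element is a subset of the nonnegative reals, on which
  \<open>\<lambda>z. eta (Re z)\<close> is just \<^const>\<open>eta\<close>.\<close>

definition eta_cfc :: "'a::unital_cstar_algebra \<Rightarrow> 'a" where
  "eta_cfc = cfc (\<lambda>z. complex_of_real (eta (Re z)))"

definition jensen_div :: "('a::unital_cstar_algebra \<Rightarrow> complex) \<Rightarrow> 'a \<Rightarrow> 'a \<Rightarrow> complex" where
  "jensen_div \<tau> A B =
     1/2 * \<tau> (eta_cfc A) + 1/2 * \<tau> (eta_cfc B) - \<tau> (eta_cfc ((1/2) *\<^sub>R (A + B)))"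

text \<open>
  The locale \<^locale>\<open>Metric_space\<close> takes a distance function on the whole type and demands
  nonnegativity and symmetry also off the carrier, hence the value \<open>0\<close> outside the positive cone.
\<close>

definition jensen_dist :: "('a::unital_cstar_algebra \<Rightarrow> complex) \<Rightarrow> 'a \<Rightarrow> 'a \<Rightarrow> real" where
  "jensen_dist \<tau> A B =
     (if A \<in> positive_cone \<and> B \<in> positive_cone then sqrt (Re (jensen_div \<tau> A B)) else 0)"

definition density_set :: "('a::unital_cstar_algebra \<Rightarrow> complex) \<Rightarrow> 'a set" where
  "density_set \<tau> = {\<rho> \<in> positive_cone. \<tau> \<rho> = 1}"

end

theory Submission
  imports
    Defs
    "HOL-Computational_Algebra.Fundamental_Theorem_Algebra"
    "HOL-Real_Asymp.Real_Asymp"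
begin

text \<open>
  Write \<open>\<Delta>(A, B) = \<tau>(log ((A + B)/2)) - (\<tau>(log A) + \<tau>(log B))/2\<close> for the Jensen divergence of
  \<open>-log\<close> on positive invertible elements. As \<open>1/x\<close> is the integral of \<open>1/(x + t)\<^sup>2\<close> over \<open>t > 0\<close>,
  the divergence of \<open>x log x\<close> is the integral of \<open>\<Delta>(A + t, B + t)\<close>, so by Minkowski's inequality it
  suffices to prove the triangle inequality for \<open>\<surd>\<Delta>\<close>. The functional \<open>\<tau> \<circ> log\<close> is the logarithm of
  a (Fuglede-Kadison) determinant, hence \<open>\<Delta>(S A S, S B S) = \<Delta>(A, B)\<close>, and one may assume that the
  intermediate point is \<open>1\<close>. With the Cayley transforms \<open>X = (A - 1)(A + 1)\<^sup>-\<^sup>1\<close> and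
  \<open>Y = (1 - B)(1 + B)\<^sup>-\<^sup>1\<close> one has \<open>A + B = 2 (1 - X)\<^sup>-\<^sup>1 (1 + X Y) (1 + Y)\<^sup>-\<^sup>1\<close> and therefore
  \<open>\<Delta>(A, B) = \<Delta>(A, 1) + \<Delta>(1, B) + \<tau>(log \<bar>1 + X Y\<bar>)\<close>. Finally
  \<open>\<tau>(log \<bar>1 + X Y\<bar>) \<le> \<tau>(X Y) + \<tau>(X\<^sup>2 Y\<^sup>2)/2\<close>, which by Cauchy-Schwarz and
  \<open>2 \<Delta>(A, 1) = -\<tau>(log (1 - X\<^sup>2)) \<ge> \<tau>(X\<^sup>2) + \<tau>(X\<^sup>4)/2\<close> is at most \<open>2 \<surd>\<Delta>(A, 1) \<surd>\<Delta>(1, B)\<close>.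
\<close>

section \<open>Invertible elements\<close>

text \<open>A general algebra offers no eigenbases for trace inequalities between noncommuting
  elements. Klein's inequality is obtained instead from Bernstein polynomials of \<open>B\<close>:
  they are positive elements with sum \<open>1\<close> that act like spectral projections, and the
  trace of a product of two positive elements is nonnegative. The resulting tangent inequality for
  \<open>T (rcfc f a)\<close> serves twice. For \<open>-ln\<close> it gives the determinant property
  of \<open>logdet\<close>, where the logarithm of a product of noncommuting factors cannot be
  computed; for \<open>eta\<close>, with an added quadratic term, it gives definiteness, which the
  triangle inequality cannot. The integral representation enters only through Riemann sums: affine
  parts cancel in the divergence, and Minkowski's inequality becomes that of finite sums. As
  \<open>cfc\<close> is a definite description, existence and uniqueness of the calculus have to be
  proved; they rest on the equality of norm and spectral radius for self-adjoint elements.\<close>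

definition unit_elt :: "'a::monoid_mult \<Rightarrow> bool" where
  "unit_elt x \<longleftrightarrow> (\<exists>y. x * y = 1 \<and> y * x = 1)"

definition inv_elt :: "'a::monoid_mult \<Rightarrow> 'a" where
  "inv_elt x = (THE y. x * y = 1 \<and> y * x = 1)"

lemma inv_elt_eq:
  fixes x :: "'a::monoid_mult"
  assumes "x * y = 1" "y * x = 1"
  shows "inv_elt x = y"
  unfolding inv_elt_def
proof (rule the_equality)
  fix z assume "x * z = 1 \<and> z * x = 1"
  then show "z = y" using assms by (metis mult.assoc mult_1_left mult_1_right)
qed (use assms in auto)

lemma unit_eltI: "x * y = 1 \<Longrightarrow> y * x = 1 \<Longrightarrow> unit_elt x"
  by (auto simp: unit_elt_def)

lemma
  assumes "unit_elt x"
  shows inv_elt_right: "x * inv_elt x = 1" and inv_elt_left: "inv_elt x * x = 1"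
  using assms inv_elt_eq unfolding unit_elt_def by blast+

lemma
  assumes "unit_elt x"
  shows inv_elt_cancel1: "x * (inv_elt x * z) = z" and inv_elt_cancel2: "inv_elt x * (x * z) = z"
  using inv_elt_right[OF assms] inv_elt_left[OF assms] by (simp_all flip: mult.assoc)

lemma unit_mult:
  fixes x y :: "'a::monoid_mult"
  assumes "unit_elt x" "unit_elt y"
  shows "unit_elt (x * y)"
  by (rule unit_eltI[where y = "inv_elt y * inv_elt x"])
     (use assms in \<open>simp_all add: mult.assoc inv_elt_cancel1 inv_elt_cancel2 inv_elt_left inv_elt_right\<close>)

lemma inv_elt_mult:
  fixes x y :: "'a::monoid_mult"
  assumes "unit_elt x" "unit_elt y"
  shows "inv_elt (x * y) = inv_elt y * inv_elt x"
  by (rule inv_elt_eq)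
     (use assms in \<open>simp_all add: mult.assoc inv_elt_cancel1 inv_elt_cancel2 inv_elt_left inv_elt_right\<close>)

lemma unit_one_minus:
  fixes x :: "'a::{real_normed_algebra_1,banach}"
  assumes "norm x < 1"
  shows "unit_elt (1 - x)"
proof (rule unit_eltI)
  have s: "summable (\<lambda>n. x ^ n)" by (rule complete_algebra_summable_geometric[OF assms])
  have "(\<lambda>n. x ^ n) sums (\<Sum>n. x ^ n)" using s by (rule summable_sums)
  then have 1: "(\<lambda>n. x ^ Suc n) sums ((\<Sum>n. x ^ n) - x ^ 0)"
    by (subst sums_Suc_iff) simp
  have "(\<lambda>n. x * x ^ n) sums (x * (\<Sum>n. x ^ n))" using s by (intro sums_mult summable_sums)
  with 1 have "x * (\<Sum>n. x ^ n) = (\<Sum>n. x ^ n) - 1" by (simp add: sums_unique2)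
  then show "(1 - x) * (\<Sum>n. x ^ n) = 1" by (simp add: algebra_simps)
  have "(\<lambda>n. x ^ n * x) sums ((\<Sum>n. x ^ n) * x)" using s by (intro sums_mult2 summable_sums)
  with 1 have "(\<Sum>n. x ^ n) * x = (\<Sum>n. x ^ n) - 1"
    by (simp add: sums_unique2 power_commutes)
  then show "(\<Sum>n. x ^ n) * (1 - x) = 1" by (simp add: algebra_simps)
qed

text \<open>Factor \<open>u + d\<close> as \<open>u * (1 + inv_elt u * d)\<close> and invert the
  second factor by the Neumann series. For the bound, the inverse \<open>y\<close> satisfies
  \<open>y = inv_elt u - y * d * inv_elt u\<close>, whose last term has at most half the norm of
  \<open>y\<close> and is absorbed.\<close>

lemma unit_perturb:
  fixes u d :: "'a::{real_normed_algebra_1,banach}"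
  assumes u: "unit_elt u" and d: "norm d * norm (inv_elt u) \<le> 1/2"
  shows "unit_elt (u + d)" "norm (inv_elt (u + d)) \<le> 2 * norm (inv_elt u)"
proof -
  have "norm (- (inv_elt u * d)) \<le> norm (inv_elt u) * norm d"
    by (simp add: norm_mult_ineq)
  also have "\<dots> < 1" using d by (simp add: mult.commute)
  finally have "unit_elt (1 - (- (inv_elt u * d)))" by (rule unit_one_minus)
  then have "unit_elt (u * (1 + inv_elt u * d))" using u unit_mult by auto
  then show *: "unit_elt (u + d)" using u
    by (simp add: distrib_left inv_elt_cancel1)
  let ?y = "inv_elt (u + d)"
  have "?y * (u + d) * inv_elt u = inv_elt u" using inv_elt_left[OF *] by simp
  moreover have "?y * (u + d) * inv_elt u = ?y + ?y * d * inv_elt u"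
    using inv_elt_right[OF u] by (simp add: distrib_left distrib_right mult.assoc)
  ultimately have "?y = inv_elt u - ?y * d * inv_elt u"
    by (simp add: eq_diff_eq)
  then have "norm ?y = norm (inv_elt u - ?y * d * inv_elt u)" by (rule arg_cong)
  also have "\<dots> \<le> norm (inv_elt u) + norm (?y * d * inv_elt u)"
    by (rule norm_triangle_ineq4)
  finally have "norm ?y \<le> norm (inv_elt u) + norm (?y * d * inv_elt u)" .
  also have "norm (?y * d * inv_elt u) \<le> norm ?y * (norm d * norm (inv_elt u))"
    unfolding mult.assoc
    by (meson mult_left_mono norm_ge_zero norm_mult_ineq order_trans)
  also have "\<dots> \<le> norm ?y * (1/2)" using d by (intro mult_left_mono) auto
  finally show "norm ?y \<le> 2 * norm (inv_elt u)" by simp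
qed

lemma inv_elt_diff:
  fixes u w :: "'a::ring_1"
  assumes "unit_elt u" "unit_elt w"
  shows "inv_elt u - inv_elt w = inv_elt u * (w - u) * inv_elt w"
  using assms by (simp add: algebra_simps inv_elt_left inv_elt_right mult.assoc inv_elt_cancel1 inv_elt_cancel2)

text \<open>The resolvent identity bounds the difference of inverses by a multiple of
  \<open>norm (f t - f s)\<close>, because the moving inverse is controlled by the factor 2 of
  \<open>unit_perturb\<close>.\<close>

lemma continuous_on_inv_elt:
  fixes f :: "'b::topological_space \<Rightarrow> 'a::{real_normed_algebra_1,banach}"
  assumes f: "continuous_on S f" and u: "\<And>s. s \<in> S \<Longrightarrow> unit_elt (f s)"
  shows "continuous_on S (\<lambda>s. inv_elt (f s))"
  unfolding continuous_on_def
proof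
  fix s assume s: "s \<in> S"
  define v where "v = norm (inv_elt (f s))"
  have lim: "((\<lambda>t. norm (f t - f s)) \<longlongrightarrow> 0) (at s within S)"
    using f s unfolding continuous_on_def by (simp add: LIM_zero_iff tendsto_norm_zero_iff)
  have "((\<lambda>t. norm (f t - f s) * v) \<longlongrightarrow> 0) (at s within S)"
    using tendsto_mult[OF lim tendsto_const[of v]] by simp
  then have ev: "\<forall>\<^sub>F t in at s within S. norm (f t - f s) * v < 1/2"
    by (rule order_tendstoD) simp
  have evS: "\<forall>\<^sub>F t in at s within S. t \<in> S"
    by (simp add: eventually_at_filter)
  have "\<forall>\<^sub>F t in at s within S. norm (inv_elt (f t) - inv_elt (f s)) \<le> 2 * v * norm (f t - f s) * v"
    using ev evS
  proof eventually_elim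
    case (elim t)
    have "norm (inv_elt (f t)) \<le> 2 * v"
      using unit_perturb(2)[OF u[OF s], of "f t - f s"] elim by (simp add: v_def)
    moreover have "norm (inv_elt (f t) - inv_elt (f s)) \<le> norm (inv_elt (f t)) * norm (f t - f s) * v"
    proof -
      have "norm (inv_elt (f t) * (f s - f t) * inv_elt (f s)) \<le> norm (inv_elt (f t) * (f s - f t)) * v"
        unfolding v_def by (rule norm_mult_ineq)
      also have "\<dots> \<le> norm (inv_elt (f t)) * norm (f s - f t) * v"
        by (intro mult_right_mono norm_mult_ineq) (simp add: v_def)
      finally show ?thesis
        by (simp add: inv_elt_diff[OF u[OF elim(2)] u[OF s]] norm_minus_commute)
    qed
    moreover have "norm (inv_elt (f t)) * norm (f t - f s) * v \<le> 2 * v * norm (f t - f s) * v"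
      using calculation(1) by (intro mult_right_mono) (auto simp: v_def)
    ultimately show ?case by linarith
  qed
  moreover have "((\<lambda>t. 2 * v * norm (f t - f s) * v) \<longlongrightarrow> 0) (at s within S)"
    using tendsto_mult[OF tendsto_mult[OF tendsto_const[of "2 * v"] lim] tendsto_const[of v]] by simp
  ultimately have "((\<lambda>t. inv_elt (f t) - inv_elt (f s)) \<longlongrightarrow> 0) (at s within S)"
    by (rule Lim_null_comparison)
  then show "((\<lambda>t. inv_elt (f t)) \<longlongrightarrow> inv_elt (f s)) (at s within S)"
    by (simp add: LIM_zero_iff)
qed

section \<open>Elementary properties of C*-algebras\<close>


lemma scaleC_one [simp]:
  fixes x :: "'a::unital_cstar_algebra"
  shows "1 *\<^sub>C x = x"
  using scaleC_of_real[of 1 x] by simp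

lemma scaleC_zero_left [simp]:
  fixes x :: "'a::unital_cstar_algebra"
  shows "0 *\<^sub>C x = 0"
  using scaleC_of_real[of 0 x] by simp

lemma scaleC_zero_right [simp]: "c *\<^sub>C 0 = (0::'a::unital_cstar_algebra)"
  using scaleC_add_right[of c 0 0] by simp

lemma scaleC_minus_right:
  fixes x :: "'a::unital_cstar_algebra"
  shows "c *\<^sub>C (- x) = - (c *\<^sub>C x)"
  using scaleC_add_right[of c x "-x"] by (simp add: eq_neg_iff_add_eq_0 add.commute)

lemma scaleC_minus_left:
  fixes x :: "'a::unital_cstar_algebra"
  shows "(- c) *\<^sub>C x = - (c *\<^sub>C x)"
  using scaleC_add_left[of c "- c" x] by (simp add: eq_neg_iff_add_eq_0 add.commute)

lemma scaleC_diff_right: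
  fixes x y :: "'a::unital_cstar_algebra"
  shows "c *\<^sub>C (x - y) = c *\<^sub>C x - c *\<^sub>C y"
  using scaleC_add_right[of c x "-y"] by (simp add: scaleC_minus_right)

lemma scaleC_diff_left:
  fixes x :: "'a::unital_cstar_algebra"
  shows "(c - d) *\<^sub>C x = c *\<^sub>C x - d *\<^sub>C x"
  using scaleC_add_left[of c "-d" x] by (simp add: scaleC_minus_left)

lemma star_zero [simp]: "star 0 = (0::'a::unital_cstar_algebra)"
  using star_add[of 0 0] by simp

lemma star_minus:
  fixes x :: "'a::unital_cstar_algebra"
  shows "star (- x) = - star x"
  using star_add[of x "-x"] by (simp add: eq_neg_iff_add_eq_0 add.commute)

lemma star_diff:
  fixes x y :: "'a::unital_cstar_algebra"
  shows "star (x - y) = star x - star y"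
  using star_add[of x "-y"] by (simp add: star_minus)

lemma star_scaleR:
  fixes x :: "'a::unital_cstar_algebra"
  shows "star (r *\<^sub>R x) = r *\<^sub>R star x"
  using star_scaleC[of "complex_of_real r" x] by (simp add: scaleC_of_real)

lemma star_one [simp]: "star 1 = (1::'a::unital_cstar_algebra)"
  by (metis mult_1_left mult_1_right star_mult star_star)

lemma star_power:
  fixes x :: "'a::unital_cstar_algebra"
  shows "star (x ^ n) = star x ^ n"
  by (induction n) (simp_all add: star_mult power_commutes)

lemma norm_star [simp]:
  fixes x :: "'a::unital_cstar_algebra"
  shows "norm (star x) = norm x"
proof -
  have le: "norm y \<le> norm (star y)" for y :: 'a
  proof (cases "y = 0")
    case False
    have "(norm y)\<^sup>2 \<le> norm (star y) * norm y"
      using norm_mult_ineq[of "star y" y] by (simp add: cstar_identity)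
    then show ?thesis using False by (simp add: power2_eq_square)
  qed simp
  show ?thesis using le[of x] le[of "star x"] by (simp add: star_star)
qed

lemma bounded_linear_star: "bounded_linear (star :: 'a \<Rightarrow> 'a::unital_cstar_algebra)"
  by (rule bounded_linear_intro[where K = 1]) (simp_all add: star_add star_scaleR)

lemma unit_scaleC:
  fixes x :: "'a::unital_cstar_algebra"
  assumes "c \<noteq> 0" "unit_elt x"
  shows "unit_elt (c *\<^sub>C x)"
  by (rule unit_eltI[where y = "(1/c) *\<^sub>C inv_elt x"])
     (use assms in \<open>simp_all add: mult_scaleC_left mult_scaleC_right scaleC_scaleC inv_elt_left inv_elt_right\<close>)

lemma unit_scaleC_iff:
  fixes x :: "'a::unital_cstar_algebra"
  assumes "c \<noteq> 0"
  shows "unit_elt (c *\<^sub>C x) \<longleftrightarrow> unit_elt x"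
  using unit_scaleC[of c x] unit_scaleC[of "1/c" "c *\<^sub>C x"] assms by (auto simp: scaleC_scaleC)

section \<open>The spectrum: compactness, and reality for self-adjoint elements\<close>

lemma spectrum_iff: "z \<in> spectrum a \<longleftrightarrow> \<not> unit_elt (z *\<^sub>C 1 - a)"
  by (simp add: spectrum_def unit_elt_def)

lemma norm_le_of_spectrum:
  assumes "z \<in> spectrum a"
  shows "cmod z \<le> norm a"
proof (rule ccontr)
  assume *: "\<not> cmod z \<le> norm a"
  then have z: "z \<noteq> 0" by auto
  have "norm ((1/z) *\<^sub>C a) < 1" using * z by (simp add: norm_scaleC norm_divide field_simps)
  then have "unit_elt (z *\<^sub>C (1 - (1/z) *\<^sub>C a))" by (rule unit_scaleC[OF z unit_one_minus])
  then show False using assms z by (simp add: spectrum_iff scaleC_diff_right scaleC_scaleC)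
qed

lemma closed_spectrum: "closed (spectrum a)"
  unfolding closed_def
proof (subst open_dist, intro ballI)
  fix z assume z: "z \<in> - spectrum a"
  then have u: "unit_elt (z *\<^sub>C 1 - a)" by (simp add: spectrum_iff)
  define v where "v = norm (inv_elt (z *\<^sub>C 1 - a))"
  have v: "v \<ge> 0" by (simp add: v_def)
  show "\<exists>e>0. \<forall>y. dist y z < e \<longrightarrow> y \<in> - spectrum a"
  proof (intro exI[of _ "1 / (2 * (v + 1))"] conjI allI impI)
    fix y assume d: "dist y z < 1 / (2 * (v + 1))"
    have "cmod (y - z) * v \<le> (1 / (2 * (v + 1))) * (v+1)"
      using d v by (intro mult_mono) (auto simp: dist_norm)
    also have "\<dots> = 1/2" using v by (simp add: field_simps)
    finally have "cmod (y - z) * v \<le> 1/2" .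
    then have "norm ((y - z) *\<^sub>C (1::'a)) * v \<le> 1/2" using v by (simp add: norm_scaleC)
    then have "unit_elt (z *\<^sub>C 1 - a + (y - z) *\<^sub>C 1)"
      using unit_perturb(1)[OF u] by (simp add: v_def)
    then show "y \<in> - spectrum a" by (simp add: spectrum_iff scaleC_diff_left)
  qed (use v in auto)
qed

lemma compact_spectrum: "compact (spectrum a)"
proof -
  have "spectrum a \<subseteq> cball 0 (norm a)" using norm_le_of_spectrum by auto
  then show ?thesis
    using closed_spectrum bounded_subset[OF bounded_cball] by (auto simp: compact_eq_bounded_closed)
qed

lemma spectrum_shift: "z \<in> spectrum a \<longleftrightarrow> z + c \<in> spectrum (a + c *\<^sub>C 1)"
  by (simp add: spectrum_iff scaleC_add_left)

text \<open>Arens' trick: adding \<open>i t\<close> moves a spectral point \<open>z\<close> to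
  \<open>z + i t\<close>, while the C*-identity keeps the squared norm of the shifted element below
  \<open>(norm a)^2 + t^2\<close>. The term \<open>2 * Im z * t\<close> on the spectral side is
  unbounded in \<open>t\<close> unless \<open>Im z = 0\<close>.\<close>

lemma spectrum_self_adjoint_real:
  fixes a :: "'a::unital_cstar_algebra"
  assumes a: "star a = a" and z: "z \<in> spectrum a"
  shows "z \<in> \<real>"
proof -
  have key: "(Im z + t)\<^sup>2 \<le> (norm a)\<^sup>2 + t\<^sup>2" for t :: real
  proof -
    let ?b = "a + (\<i> * complex_of_real t) *\<^sub>C 1"
    have sq: "star ?b * ?b = a * a + (t\<^sup>2) *\<^sub>R 1"
      by (simp add: star_add star_scaleC a distrib_left distrib_right mult_scaleC_left scaleC_diff_right
          left_diff_distrib mult_scaleC_right scaleC_scaleC scaleC_minus_left power2_eq_square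
          flip: scaleC_of_real)
        (simp add: mult.assoc mult.left_commute flip: scaleC_minus_left)
    have "norm (star ?b * ?b) \<le> norm (a * a) + norm ((t\<^sup>2) *\<^sub>R (1::'a))"
      unfolding sq by (rule norm_triangle_ineq)
    also have "norm (a * a) = (norm a)\<^sup>2" using cstar_identity[of a] a by simp
    finally have b: "(norm ?b)\<^sup>2 \<le> (norm a)\<^sup>2 + t\<^sup>2" by (simp add: cstar_identity)
    have "cmod (z + \<i> * t) \<le> norm ?b"
      using z norm_le_of_spectrum spectrum_shift by blast
    then have "(cmod (z + \<i> * t))\<^sup>2 \<le> (norm ?b)\<^sup>2" by (simp add: power_mono)
    with b have "(cmod (z + \<i> * t))\<^sup>2 \<le> (norm a)\<^sup>2 + t\<^sup>2" by linarith
    then show ?thesis by (simp add: cmod_power2) (smt (verit) zero_le_power2)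
  qed
  have "Im z = 0"
  proof (rule ccontr)
    assume n: "Im z \<noteq> 0"
    have "2 * Im z * t \<le> (norm a)\<^sup>2" for t
      using key[of t] by (simp add: power2_sum) (smt (verit) zero_le_power2)
    from this[of "((norm a)\<^sup>2 + 1) / (2 * Im z)"] n show False by simp
  qed
  then show ?thesis by (simp add: complex_is_Real_iff)
qed

section \<open>Spectral radius and norm of a self-adjoint element\<close>

lemma sum_roots_of_unity_power:
  fixes n j :: nat
  assumes "0 < j" "j < n"
  shows "(\<Sum>k<n. cis (2 * pi * real k / real n) ^ j) = 0"
proof -
  define q where "q = cis (2 * pi * real j / real n)"
  have "q ^ n = cis (real n * (2 * pi * real j / real n))" unfolding q_def by (rule Complex.DeMoivre)
  also have "real n * (2 * pi * real j / real n) = 2 * pi * real j" using assms by simp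
  finally have q1: "q ^ n = 1" by (metis cis_multiple_2pi Ints_of_nat)
  have "q \<noteq> 1"
  proof
    assume "q = 1"
    then obtain m :: int where "2 * pi * real j / real n = of_int m * (2 * pi)"
      unfolding q_def complex_eq_iff by (auto simp: cos_one_2pi_int mult.assoc)
    then have "real j = of_int m * real n" using assms by (simp add: field_simps)
    then have "int j = m * int n" by (metis of_int_eq_iff of_int_mult of_int_of_nat_eq)
    then show False using assms
      by (metis dvd_triv_right int_dvd_int_iff nat_dvd_not_less)
  qed
  have "(\<Sum>k<n. cis (2 * pi * real k / real n) ^ j) = (\<Sum>k<n. q ^ k)"
    unfolding q_def Complex.DeMoivre by (intro sum.cong refl arg_cong[of _ _ cis]) simp
  also have "\<dots> = (q ^ n - 1) / (q - 1)" using \<open>q \<noteq> 1\<close> by (rule geometric_sum)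
  finally show ?thesis using q1 by simp
qed

text \<open>Discrete form of the Cauchy mean value formula for the resolvent. Each root of unity
  \<open>w\<close> satisfies \<open>1 - x ^ n = 1 - (w x) ^ n\<close>, so every summand times
  \<open>1 - x ^ n\<close> is a geometric sum, and averaging removes all powers except the
  zeroth.\<close>

lemma average_resolvent:
  fixes x :: "'a::unital_cstar_algebra" and n :: nat
  assumes n: "n > 0"
    and u: "\<And>k. k < n \<Longrightarrow> unit_elt (1 - cis (2 * pi * real k / real n) *\<^sub>C x)"
  shows "(1 / real n) *\<^sub>R (\<Sum>k<n. inv_elt (1 - cis (2 * pi * real k / real n) *\<^sub>C x)) * (1 - x ^ n) = 1"
proof -
  define w where "w k = cis (2 * pi * real k / real n)" for k :: nat
  have wn: "w k ^ n = 1" for k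
  proof -
    have "w k ^ n = cis (real n * (2 * pi * real k / real n))" unfolding w_def by (rule Complex.DeMoivre)
    also have "real n * (2 * pi * real k / real n) = 2 * pi * real k" using n by simp
    finally show ?thesis by (metis cis_multiple_2pi Ints_of_nat)
  qed
  have pw: "(w k *\<^sub>C x) ^ j = (w k ^ j) *\<^sub>C (x ^ j)" for j k
    by (induction j) (simp_all add: mult_scaleC_left mult_scaleC_right scaleC_scaleC mult.commute[of "w k"])
  have geo: "(1 - y) * (\<Sum>j<m. y ^ j) = 1 - y ^ m" for y :: 'a and m
    by (induction m) (simp_all add: distrib_left left_diff_distrib)
  have summand: "inv_elt (1 - w k *\<^sub>C x) * (1 - x ^ n) = (\<Sum>j<n. (w k ^ j) *\<^sub>C (x ^ j))" if "k < n" for k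
  proof -
    have "1 - x ^ n = 1 - (w k *\<^sub>C x) ^ n" by (simp add: pw wn)
    also have "\<dots> = (1 - w k *\<^sub>C x) * (\<Sum>j<n. (w k *\<^sub>C x) ^ j)"
      by (simp add: geo)
    finally show ?thesis using u[OF that] by (simp add: w_def[symmetric] inv_elt_cancel2 pw)
  qed
  have sC: "(\<Sum>k\<in>S. f k *\<^sub>C y) = (\<Sum>k\<in>S. f k) *\<^sub>C y" for S :: "nat set" and f and y :: 'a
    by (induction S rule: infinite_finite_induct) (simp_all add: scaleC_add_left)
  have "(\<Sum>k<n. inv_elt (1 - w k *\<^sub>C x)) * (1 - x ^ n) = (\<Sum>k<n. \<Sum>j<n. (w k ^ j) *\<^sub>C (x ^ j))"
    by (simp add: sum_distrib_right summand)
  also have "\<dots> = (\<Sum>j<n. (\<Sum>k<n. w k ^ j) *\<^sub>C (x ^ j))"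
    by (subst sum.swap) (simp add: sC)
  also have "\<dots> = (\<Sum>j<n. if j = 0 then of_nat n *\<^sub>C 1 else 0)"
  proof (rule sum.cong)
    fix j assume "j \<in> {..<n}"
    then show "(\<Sum>k<n. w k ^ j) *\<^sub>C (x ^ j) = (if j = 0 then of_nat n *\<^sub>C 1 else 0)"
      using sum_roots_of_unity_power[of j n] by (cases "j = 0") (simp_all add: w_def)
  qed simp
  also have "\<dots> = of_nat n *\<^sub>C 1" using n by (subst sum.delta) auto
  also have "\<dots> = real n *\<^sub>R 1"
    using scaleC_of_real[of "real n"] by simp
  finally show ?thesis using n by (simp add: w_def)
qed

text \<open>Rickart's elementary replacement for Liouville's theorem in the spectral radius formula:
  by uniform continuity of the resolvent on the closed unit disc, the averages above at radius
  \<open>1\<close> and at a radius \<open>s < 1\<close> are close uniformly in \<open>n\<close>.\<close>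

lemma power_small_of_unit_disc:
  fixes a :: "'a::unital_cstar_algebra"
  assumes na: "norm a \<le> 1" and u: "\<And>w. cmod w \<le> 1 \<Longrightarrow> unit_elt (1 - w *\<^sub>C a)"
  shows "\<exists>N. \<forall>n\<ge>N. norm (a ^ n) < 1"
proof -
  define R where "R w = inv_elt (1 - w *\<^sub>C a)" for w
  have bl: "bounded_linear (\<lambda>w. w *\<^sub>C a)"
  proof (rule bounded_linear_intro[where K = "norm a"])
    show "(r *\<^sub>R x) *\<^sub>C a = r *\<^sub>R (x *\<^sub>C a)" for r and x :: complex
      by (metis scaleC_of_real scaleC_scaleC scaleR_conv_of_real)
  qed (simp_all add: scaleC_add_left norm_scaleC)
  have "continuous_on (cball 0 1) (\<lambda>w. 1 - w *\<^sub>C a)"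
    by (intro continuous_on_diff continuous_on_const bounded_linear.continuous_on[OF bl] continuous_on_id)
  then have "continuous_on (cball 0 1) R"
    unfolding R_def by (rule continuous_on_inv_elt) (simp add: u)
  then have "uniformly_continuous_on (cball 0 1) R"
    by (simp add: compact_uniformly_continuous)
  then have "\<exists>d>0. \<forall>v\<in>cball 0 1. \<forall>w\<in>cball 0 1. dist w v < d \<longrightarrow> dist (R w) (R v) < 1/8"
    unfolding uniformly_continuous_on_def by (elim allE[of _ "1/8"]) simp
  then obtain d where d: "d > 0"
    and dR: "\<And>v w. cmod v \<le> 1 \<Longrightarrow> cmod w \<le> 1 \<Longrightarrow> dist w v < d \<Longrightarrow> dist (R w) (R v) < 1/8"
    by auto
  \<comment> \<open>This radius is below \<open>1\<close>, so that powers of \<open>s\<close> decay,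
    and closer than \<open>d\<close> to \<open>1\<close>, so that the two averages are
    comparable.\<close>
  define s where "s = 1 - min (d/2) (1/2)"
  have s: "0 < s" "s < 1" "1 - s < d" using d by (auto simp: s_def min_def)
  have "\<forall>\<^sub>F n in sequentially. s ^ n < 1/16"
    using LIMSEQ_realpow_zero[of s] s by (intro order_tendstoD) auto
  then obtain N0 where "\<And>n. n \<ge> N0 \<Longrightarrow> s ^ n < 1/16"
    by (auto simp: eventually_sequentially)
  then obtain N where N: "N > 0" "\<And>n. n \<ge> N \<Longrightarrow> s ^ n < 1/16"
    by (metis le_SucI le_refl less_Suc_eq_le Suc_leD zero_less_Suc)
  show ?thesis
  proof (intro exI[of _ N] allI impI)
    fix n assume n: "n \<ge> N"
    then have n0: "n > 0" using N by linarith
    define w where "w k = cis (2 * pi * real k / real n)" for k :: nat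
    define T where "T r = (1 / real n) *\<^sub>R (\<Sum>k<n. R (complex_of_real r * w k))" for r :: real
    have nw: "cmod (w k) = 1" for k by (simp add: w_def)
    have T: "T r * (1 - (r *\<^sub>R a) ^ n) = 1" if "0 \<le> r" "r \<le> 1" for r
    proof -
      have "T r = (1 / real n) *\<^sub>R (\<Sum>k<n. inv_elt (1 - w k *\<^sub>C (r *\<^sub>R a)))"
        by (simp add: T_def R_def scaleC_scaleC mult.commute flip: scaleC_of_real)
      moreover have "unit_elt (1 - w k *\<^sub>C (r *\<^sub>R a))" for k
        using u[of "w k * r"] that nw by (simp add: norm_mult scaleC_scaleC flip: scaleC_of_real)
      ultimately show ?thesis using average_resolvent[OF n0, of "r *\<^sub>R a"] by (simp add: w_def)
    qed
    have "norm (T 1 - T s) = (1 / real n) * norm (\<Sum>k<n. R (w k) - R (complex_of_real s * w k))"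
      unfolding T_def by (simp add: sum_subtractf flip: scaleR_right_diff_distrib)
    also have "\<dots> \<le> (1 / real n) * (real n * (1/8))"
    proof (intro mult_left_mono)
      have "norm (\<Sum>k<n. R (w k) - R (complex_of_real s * w k)) \<le> (\<Sum>k<n. 1/8)"
      proof (rule sum_norm_le)
        fix k
        have "dist (w k) (complex_of_real s * w k) = cmod ((1 - complex_of_real s) * w k)"
          by (simp add: dist_norm left_diff_distrib)
        also have "\<dots> = 1 - s"
          unfolding norm_mult nw using s by (metis abs_of_pos diff_gt_0_iff_gt mult_1_right norm_of_real of_real_1 of_real_diff)
        finally show "norm (R (w k) - R (complex_of_real s * w k)) \<le> 1/8"
          using dR[of "complex_of_real s * w k" "w k"] s nw by (simp add: norm_mult dist_norm)
      qed
      then show "norm (\<Sum>k<n. R (w k) - R (complex_of_real s * w k)) \<le> real n * (1/8)" by simp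
    qed simp
    also have "\<dots> = 1/8" using n0 by simp
    finally have d1: "norm (T 1 - T s) \<le> 1/8" .
    let ?x = "(s *\<^sub>R a) ^ n"
    have nx: "norm ?x \<le> 1/16"
    proof -
      have "norm ?x \<le> norm (s *\<^sub>R a) ^ n" by (rule norm_power_ineq)
      also have "\<dots> \<le> s ^ n" using s na by (intro power_mono) (auto simp: mult_le_one mult_left_le)
      finally show ?thesis using N(2)[OF n] by linarith
    qed
    have "T s = 1 + T s * ?x" using T[of s] s by (simp add: algebra_simps)
    then have e1: "T s - 1 = T s * ?x" by (metis add_diff_cancel_left')
    have "norm (T s * ?x) \<le> norm (T s) * (1/16)"
      using nx by (meson mult_left_mono norm_ge_zero norm_mult_ineq order_trans)
    moreover have "norm (T s) \<le> norm (T s - 1) + 1"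
      using norm_triangle_ineq[of "T s - 1" 1] by simp
    ultimately have d2: "norm (T s - 1) \<le> 1/8" unfolding e1 by linarith
    \<comment> \<open>\<open>T 1\<close> is within 1/8 of \<open>T s\<close>, and \<open>T s\<close>
      within 1/8 of \<open>1\<close>. With total error 1/4 the relation
      \<open>a ^ n = E - E * a ^ n\<close> forces \<open>norm (a ^ n)\<close> down to 1/3.\<close>
    define E where "E = T 1 - 1"
    have nE: "norm E \<le> 1/4"
      using norm_triangle_ineq[of "T 1 - T s" "T s - 1"] d1 d2 by (simp add: E_def)
    have "(1 + E) * (1 - a ^ n) = 1" using T[of 1] by (simp add: E_def)
    then have "a ^ n = E - E * a ^ n" by (simp add: algebra_simps)
    then have "norm (a ^ n) = norm (E - E * a ^ n)" by (rule arg_cong)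
    also have "\<dots> \<le> norm E + norm (E * a ^ n)" by (rule norm_triangle_ineq4)
    finally have "norm (a ^ n) \<le> norm E + norm (E * a ^ n)" .
    also have "norm (E * a ^ n) \<le> 1/4 * norm (a ^ n)"
      using nE by (meson mult_right_mono norm_ge_zero norm_mult_ineq order_trans)
    finally show "norm (a ^ n) < 1" using nE by linarith
  qed
qed

text \<open>The C*-identity turns submultiplicativity into equality along repeated squaring, so
  powers of a self-adjoint element of norm 1 cannot decay.\<close>

lemma norm_self_adjoint_power2:
  fixes a :: "'a::unital_cstar_algebra"
  assumes "star a = a"
  shows "norm (a ^ (2 ^ k)) = norm a ^ (2 ^ k)"
proof (induction k)
  case (Suc k)
  have "norm (a ^ (2 ^ Suc k)) = norm (star (a ^ (2 ^ k)) * a ^ (2 ^ k))"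
    by (simp add: star_power assms flip: power_add mult_2)
  also have "\<dots> = (norm a ^ (2 ^ k))\<^sup>2" by (simp add: cstar_identity Suc)
  finally show ?case by (simp add: mult.commute flip: power_mult)
qed simp

text \<open>If the spectrum sat in a disc of radius \<open>m < norm a\<close>, the normalised
  element \<open>b\<close> would have \<open>1 - w b\<close> invertible on the closed unit disc; its
  powers would eventually have norm below 1, against \<open>norm (b ^ (2 ^ N)) = 1\<close>.\<close>

lemma norm_le_spectral_radius:
  fixes a :: "'a::unital_cstar_algebra"
  assumes a: "star a = a" and m: "0 \<le> m" "\<And>z. z \<in> spectrum a \<Longrightarrow> cmod z \<le> m"
  shows "norm a \<le> m"
proof (rule ccontr)
  assume lt: "\<not> norm a \<le> m"
  then have na: "norm a > 0" using m(1) by linarith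
  define b where "b = (1 / norm a) *\<^sub>R a"
  have b: "star b = b" "norm b = 1" using na by (auto simp: b_def star_scaleR a)
  have "unit_elt (1 - w *\<^sub>C b)" if w: "cmod w \<le> 1" for w
  proof (cases "w = 0")
    case True
    then show ?thesis by (auto intro: unit_eltI[of _ 1])
  next
    case False
    let ?z = "of_real (norm a) / w"
    have "cmod ?z \<ge> norm a" using w False na by (simp add: norm_divide divide_simps)
    then have "?z \<notin> spectrum a" using lt m(2) by fastforce
    then have "unit_elt (?z *\<^sub>C 1 - a)" by (simp add: spectrum_iff)
    then have "unit_elt ((1/?z) *\<^sub>C (?z *\<^sub>C 1 - a))" using na False by (intro unit_scaleC) auto
    then show ?thesis using na False
      by (simp add: scaleC_diff_right scaleC_scaleC b_def divide_simps flip: scaleC_of_real)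
  qed
  with power_small_of_unit_disc[of b] b obtain N where N: "\<And>n. n \<ge> N \<Longrightarrow> norm (b ^ n) < 1" by auto
  have "N \<le> 2 ^ N" by (simp add: less_imp_le)
  from N[OF this] show False using norm_self_adjoint_power2[OF b(1), of N] b(2) by simp
qed

text \<open>An empty spectrum would satisfy the radius bound with \<open>m = 0\<close>, forcing
  \<open>a = 0\<close>; but \<open>0\<close> is not invertible.\<close>

lemma spectrum_nonempty:
  fixes a :: "'a::unital_cstar_algebra"
  assumes a: "star a = a"
  shows "spectrum a \<noteq> {}"
proof
  assume e: "spectrum a = {}"
  then have 0: "a = 0" using norm_le_spectral_radius[OF a, of 0] by simp
  have "0 \<in> spectrum (0::'a)" by (simp add: spectrum_iff unit_elt_def)
  with e 0 show False by simp
qed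

section \<open>Polynomials of an algebra element\<close>

definition ceval :: "complex poly \<Rightarrow> 'a::unital_cstar_algebra \<Rightarrow> 'a" where
  "ceval p a = fold_coeffs (\<lambda>c y. c *\<^sub>C 1 + a * y) p 0"

lemma ceval_0 [simp]: "ceval 0 a = 0"
  by (simp add: ceval_def)

lemma ceval_pCons [simp]: "ceval (pCons c p) a = c *\<^sub>C 1 + a * ceval p a"
  by (cases "p = 0 \<and> c = 0") (auto simp: ceval_def)

lemma ceval_1 [simp]: "ceval 1 a = 1"
  by (simp add: one_pCons)

lemma ceval_add: "ceval (p + q) a = ceval p a + ceval q a"
  by (induction p q rule: poly_induct2) (simp_all add: scaleC_add_left distrib_left)

lemma ceval_smult: "ceval (smult c p) a = c *\<^sub>C ceval p a"
  by (induction p) (simp_all add: scaleC_add_right scaleC_scaleC mult_scaleC_right)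

lemma ceval_minus: "ceval (- p) a = - ceval p a"
  using ceval_smult[of "-1" p a] by (simp add: scaleC_minus_left)

lemma ceval_diff: "ceval (p - q) a = ceval p a - ceval q a"
  using ceval_add[of p "- q" a] by (simp add: ceval_minus)

lemma ceval_mult: "ceval (p * q) a = ceval p a * ceval q a"
  by (induction p) (simp_all add: ceval_add ceval_smult distrib_right mult_scaleC_left mult.assoc)

lemma ceval_commute: "a * ceval p a = ceval p a * a"
  using ceval_mult[of "[:0, 1:]" p a] ceval_mult[of p "[:0, 1:]" a] by (simp add: mult.commute)

lemma star_ceval:
  assumes "star a = a"
  shows "star (ceval p a) = ceval (map_poly cnj p) a"
  by (induction p)
    (simp_all add: map_poly_pCons star_add star_scaleC star_mult assms ceval_commute)

text \<open>Roots are split off one at a time: a linear factor whose root lies outside the spectrum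
  evaluates to an invertible element, so non-invertibility passes to the cofactor.\<close>

lemma unit_ceval_or_root:
  assumes "p \<noteq> 0" "\<not> unit_elt (ceval p a)"
  shows "\<exists>z\<in>spectrum a. poly p z = 0"
  using assms
proof (induction "degree p" arbitrary: p)
  case 0
  then obtain c where "p = [:c:]" "c \<noteq> 0" by (metis degree_eq_zeroE pCons_0_0)
  with 0 show ?case using unit_scaleC[of c "1::'a"] unit_eltI[of 1 "1::'a"] by simp
next
  case (Suc n)
  then have "\<not> constant (poly p)" by (metis constant_degree nat.distinct(1))
  then obtain r where r: "poly p r = 0" using fundamental_theorem_of_algebra by blast
  show ?case
  proof (cases "r \<in> spectrum a")
    case False
    obtain q where q: "p = [:- r, 1:] * q" using r by (auto simp: poly_eq_0_iff_dvd)
    then have q0: "q \<noteq> 0" using Suc.prems by auto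
    have "degree p = degree [:- r, 1:] + degree q"
      unfolding q using q0 by (intro degree_mult_eq) auto
    then have "degree q = n" using Suc.hyps(2) by simp
    have "unit_elt ((- 1) *\<^sub>C (r *\<^sub>C 1 - a))"
      using False by (intro unit_scaleC) (simp_all add: spectrum_iff)
    then have "unit_elt (ceval [:- r, 1:] a)" by (simp add: scaleC_minus_left)
    then have "\<not> unit_elt (ceval q a)"
      using Suc.prems(2) unit_mult unfolding q ceval_mult by blast
    then show ?thesis using Suc.hyps(1)[of q] \<open>degree q = n\<close> q0 by (auto simp: q)
  qed (use r in auto)
qed

text \<open>The preceding dichotomy applied to \<open>z - p\<close>. The constant polynomial
  \<open>p = z\<close> is exceptional and is settled by nonemptiness of the spectrum.\<close>

lemma spectrum_ceval:
  assumes "star a = a" "z \<in> spectrum (ceval p a)"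
  shows "z \<in> poly p ` spectrum a"
proof (cases "[:z:] - p = 0")
  case True
  then have "p = [:z:]" by simp
  then show ?thesis using spectrum_nonempty[OF assms(1)] by auto
next
  case False
  then obtain w where "w \<in> spectrum a" "poly ([:z:] - p) w = 0"
    using unit_ceval_or_root[of "[:z:] - p" a] assms(2) by (auto simp: ceval_diff spectrum_iff)
  then show ?thesis by auto
qed

lemma poly_cnj: "cnj z = z \<Longrightarrow> poly (map_poly cnj p) z = cnj (poly p z)"
  by (induction p) (simp_all add: map_poly_pCons)

lemma cnj_spectrum:
  assumes "star a = a" "z \<in> spectrum a"
  shows "cnj z = z"
  using spectrum_self_adjoint_real[OF assms] by (simp add: Reals_cnj_iff)

text \<open>\<open>ceval p a\<close> need not be self-adjoint, so the spectral radius bound is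
  applied to \<open>star (ceval p a) * ceval p a\<close>. This is again a polynomial of
  \<open>a\<close>, with values \<open>|p|^2\<close> on the real spectrum.\<close>

lemma norm_ceval_le:
  assumes a: "star a = a" and m: "\<And>z. z \<in> spectrum a \<Longrightarrow> cmod (poly p z) \<le> m"
  shows "norm (ceval p a) \<le> m"
proof -
  obtain z0 where "z0 \<in> spectrum a" using spectrum_nonempty[OF a] by auto
  with m have m0: "0 \<le> m" using norm_ge_zero order_trans by blast
  define q where "q = map_poly cnj p * p"
  have q: "ceval q a = star (ceval p a) * ceval p a"
    by (simp add: q_def ceval_mult star_ceval a)
  have "norm (ceval q a) \<le> m\<^sup>2"
  proof (rule norm_le_spectral_radius)
    show "star (ceval q a) = ceval q a" unfolding q by (simp add: star_mult star_star)
    fix z assume "z \<in> spectrum (ceval q a)"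
    then obtain w where w: "w \<in> spectrum a" "z = poly q w" using spectrum_ceval[OF a] by blast
    have "cmod z = (cmod (poly p w))\<^sup>2"
      using cnj_spectrum[OF a w(1)] by (simp add: w(2) q_def poly_cnj norm_mult power2_eq_square)
    also have "\<dots> \<le> m\<^sup>2" using m[OF w(1)] by (simp add: power_mono)
    finally show "cmod z \<le> m\<^sup>2" .
  qed simp
  then have "(norm (ceval p a))\<^sup>2 \<le> m\<^sup>2" by (simp add: q cstar_identity)
  then show ?thesis using m0 by (rule power2_le_imp_le)
qed

section \<open>Existence and uniqueness of the continuous functional calculus\<close>

lemma real_polynomial_function_poly:
  assumes "real_polynomial_function (f :: real \<Rightarrow> real)"
  shows "\<exists>p. \<forall>x. poly p (complex_of_real x) = complex_of_real (f x)"
proof -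
  from assms obtain a n where f: "f = (\<lambda>x. \<Sum>i\<le>n. a i * x ^ i)"
    using real_polynomial_function_iff_sum by blast
  have "poly (\<Sum>i\<le>n. monom (complex_of_real (a i)) i) (complex_of_real x) = complex_of_real (f x)" for x
    by (simp add: f poly_sum poly_monom)
  then show ?thesis by blast
qed

text \<open>On a real set polynomials in \<open>z\<close> alone are dense, without conjugates: real
  and imaginary parts of the Weierstrass approximants are ordinary polynomials, recombined with
  \<open>\<i>\<close>.\<close>

lemma uniform_limit_poly:
  fixes f :: "complex \<Rightarrow> complex"
  assumes K: "compact K" "K \<subseteq> \<real>" and f: "continuous_on K f"
  obtains P where "uniform_limit K (\<lambda>n. poly (P n)) f sequentially"
proof -
  define L where "L = Re ` K"
  have KL: "K = of_real ` L" using K(2) unfolding L_def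
    by (force simp: image_image complex_is_Real_iff complex_eq_iff)
  have "compact L" unfolding L_def using K by (intro compact_continuous_image continuous_intros) auto
  moreover have "continuous_on L (\<lambda>x. f (of_real x))"
    by (rule continuous_on_compose2[OF f]) (auto simp: KL intro!: continuous_intros)
  ultimately obtain g where g: "uniform_limit L g (\<lambda>x. f (of_real x)) sequentially"
    and pg: "\<And>n. polynomial_function (g n)"
    using Stone_Weierstrass_uniform_limit by blast
  have "\<exists>p. \<forall>x. poly p (complex_of_real x) = g n x" for n
  proof -
    have "real_polynomial_function (Re \<circ> g n)" "real_polynomial_function (Im \<circ> g n)"
      using pg[of n] bounded_linear_Re bounded_linear_Im unfolding polynomial_function_def by auto
    then obtain p q where "\<And>x. poly p (complex_of_real x) = complex_of_real (Re (g n x))"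
      "\<And>x. poly q (complex_of_real x) = complex_of_real (Im (g n x))"
      using real_polynomial_function_poly by (metis comp_apply)
    then have "poly (p + smult \<i> q) (complex_of_real x) = g n x" for x
      by (simp add: complex_eq_iff)
    then show ?thesis by blast
  qed
  then obtain P where P: "\<And>n x. poly (P n) (complex_of_real x) = g n x" by metis
  have "uniform_limit K (\<lambda>n. poly (P n)) f sequentially"
    using g unfolding uniform_limit_iff KL by (simp add: P)
  then show ?thesis by (rule that)
qed

text \<open>The graph of the calculus, kept as a relation because the approximating sequence is not
  canonical; existence and uniqueness of the value are separate lemmas.\<close>

definition poly_limit :: "'a::unital_cstar_algebra \<Rightarrow> (complex \<Rightarrow> complex) \<Rightarrow> 'a \<Rightarrow> bool" where
  "poly_limit a f y \<longleftrightarrow> (\<exists>P. uniform_limit (spectrum a) (\<lambda>n. poly (P n)) f sequentially \<and>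
     (\<lambda>n. ceval (P n) a) \<longlonglongrightarrow> y)"

lemma poly_limit_unique:
  assumes a: "star a = a" and y: "poly_limit a f y" and z: "poly_limit a f z"
  shows "y = z"
proof -
  from y obtain P where P: "uniform_limit (spectrum a) (\<lambda>n. poly (P n)) f sequentially"
    "(\<lambda>n. ceval (P n) a) \<longlonglongrightarrow> y" unfolding poly_limit_def by blast
  from z obtain Q where Q: "uniform_limit (spectrum a) (\<lambda>n. poly (Q n)) f sequentially"
    "(\<lambda>n. ceval (Q n) a) \<longlonglongrightarrow> z" unfolding poly_limit_def by blast
  have "(\<lambda>n. ceval (P n - Q n) a) \<longlonglongrightarrow> 0"
  proof (rule tendstoI)
    fix e :: real assume "e > 0"
    then have "e/3 > 0" by simp
    have "\<forall>\<^sub>F n in sequentially. \<forall>z\<in>spectrum a. dist (poly (P n) z) (f z) < e/3"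
      "\<forall>\<^sub>F n in sequentially. \<forall>z\<in>spectrum a. dist (poly (Q n) z) (f z) < e/3"
      using P(1) Q(1) \<open>e/3 > 0\<close> unfolding uniform_limit_iff by blast+
    then show "\<forall>\<^sub>F n in sequentially. dist (ceval (P n - Q n) a) 0 < e"
    proof eventually_elim
      case (elim n)
      have "cmod (poly (P n - Q n) z) \<le> 2 * e/3" if "z \<in> spectrum a" for z
      proof -
        have "cmod (poly (P n - Q n) z) = dist (poly (P n) z) (poly (Q n) z)" by (simp add: dist_norm)
        also have "\<dots> \<le> dist (poly (P n) z) (f z) + dist (poly (Q n) z) (f z)"
          by (rule dist_triangle2)
        finally show ?thesis using elim that by fastforce
      qed
      then have "norm (ceval (P n - Q n) a) \<le> 2 * e/3" by (rule norm_ceval_le[OF a])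
      with \<open>e > 0\<close> show ?case by simp
    qed
  qed
  moreover have "(\<lambda>n. ceval (P n - Q n) a) \<longlonglongrightarrow> y - z"
    unfolding ceval_diff by (intro tendsto_diff P Q)
  ultimately have "y - z = 0" using LIMSEQ_unique by blast
  then show ?thesis by simp
qed

lemma poly_limit_exists:
  assumes a: "star a = a" and f: "continuous_on (spectrum a) f"
  shows "\<exists>y. poly_limit a f y"
proof -
  have "spectrum a \<subseteq> \<real>" using spectrum_self_adjoint_real[OF a] by blast
  with f obtain P where P: "uniform_limit (spectrum a) (\<lambda>n. poly (P n)) f sequentially"
    using uniform_limit_poly[OF compact_spectrum] by blast
  have "Cauchy (\<lambda>n. ceval (P n) a)"
  proof (rule CauchyI)
    fix e :: real assume "e > 0"
    then have "e/3 > 0" by simp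
    then obtain N where N: "\<And>n z. n \<ge> N \<Longrightarrow> z \<in> spectrum a \<Longrightarrow> dist (poly (P n) z) (f z) < e/3"
      using P unfolding uniform_limit_sequentially_iff by metis
    show "\<exists>M. \<forall>m\<ge>M. \<forall>n\<ge>M. norm (ceval (P m) a - ceval (P n) a) < e"
    proof (intro exI[of _ N] allI impI)
      fix m n assume mn: "m \<ge> N" "n \<ge> N"
      have "cmod (poly (P m - P n) z) \<le> 2 * e/3" if "z \<in> spectrum a" for z
      proof -
        have "cmod (poly (P m - P n) z) = dist (poly (P m) z) (poly (P n) z)" by (simp add: dist_norm)
        also have "\<dots> \<le> dist (poly (P m) z) (f z) + dist (poly (P n) z) (f z)"
          by (rule dist_triangle2)
        finally show ?thesis using N[OF mn(1) that] N[OF mn(2) that] by simp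
      qed
      then have "norm (ceval (P m - P n) a) \<le> 2 * e/3" by (rule norm_ceval_le[OF a])
      with \<open>e > 0\<close> show "norm (ceval (P m) a - ceval (P n) a) < e" by (simp add: ceval_diff)
    qed
  qed
  then obtain y where "(\<lambda>n. ceval (P n) a) \<longlonglongrightarrow> y" by (auto simp: Cauchy_convergent_iff convergent_def)
  with P show ?thesis unfolding poly_limit_def by blast
qed

lemma poly_limit_cong:
  assumes "poly_limit a f y" "\<And>z. z \<in> spectrum a \<Longrightarrow> f z = g z"
  shows "poly_limit a g y"
proof -
  from assms(1) obtain P where P: "uniform_limit (spectrum a) (\<lambda>n. poly (P n)) f sequentially"
    "(\<lambda>n. ceval (P n) a) \<longlonglongrightarrow> y" unfolding poly_limit_def by blast
  from P(1) have "uniform_limit (spectrum a) (\<lambda>n. poly (P n)) g sequentially"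
    unfolding uniform_limit_iff by (simp add: assms(2))
  with P(2) show ?thesis unfolding poly_limit_def by blast
qed

lemma poly_limit_ceval: "poly_limit a (poly p) (ceval p a)"
  unfolding poly_limit_def by (rule exI[of _ "\<lambda>_. p"]) (auto simp: uniform_limit_iff)

lemma poly_limit_add:
  assumes "poly_limit a f y" "poly_limit a g z"
  shows "poly_limit a (\<lambda>x. f x + g x) (y + z)"
proof -
  from assms obtain P Q where P: "uniform_limit (spectrum a) (\<lambda>n. poly (P n)) f sequentially"
    "(\<lambda>n. ceval (P n) a) \<longlonglongrightarrow> y" and Q: "uniform_limit (spectrum a) (\<lambda>n. poly (Q n)) g sequentially"
    "(\<lambda>n. ceval (Q n) a) \<longlonglongrightarrow> z" unfolding poly_limit_def by blast
  show ?thesis unfolding poly_limit_def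
    by (rule exI[of _ "\<lambda>n. P n + Q n"])
       (use uniform_limit_add[OF P(1) Q(1)] tendsto_add[OF P(2) Q(2)] in \<open>simp add: ceval_add poly_add[abs_def]\<close>)
qed

lemma poly_limit_mult:
  assumes "poly_limit a f y" "poly_limit a g z" "continuous_on (spectrum a) f" "continuous_on (spectrum a) g"
  shows "poly_limit a (\<lambda>x. f x * g x) (y * z)"
proof -
  from assms obtain P Q where P: "uniform_limit (spectrum a) (\<lambda>n. poly (P n)) f sequentially"
    "(\<lambda>n. ceval (P n) a) \<longlonglongrightarrow> y" and Q: "uniform_limit (spectrum a) (\<lambda>n. poly (Q n)) g sequentially"
    "(\<lambda>n. ceval (Q n) a) \<longlonglongrightarrow> z" unfolding poly_limit_def by blast
  have "bounded (f ` spectrum a)" "bounded (g ` spectrum a)"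
    using assms(3,4) compact_spectrum by (auto intro!: compact_imp_bounded compact_continuous_image)
  from uniform_lim_mult[OF P(1) Q(1) this] tendsto_mult[OF P(2) Q(2)]
  show ?thesis unfolding poly_limit_def
    by (intro exI[of _ "\<lambda>n. P n * Q n"]) (simp add: ceval_mult poly_mult[abs_def])
qed

lemma poly_limit_star:
  assumes a: "star a = a" and "poly_limit a f y"
  shows "poly_limit a (\<lambda>x. cnj (f x)) (star y)"
proof -
  from assms obtain P where P: "uniform_limit (spectrum a) (\<lambda>n. poly (P n)) f sequentially"
    "(\<lambda>n. ceval (P n) a) \<longlonglongrightarrow> y" unfolding poly_limit_def by blast
  have "uniform_limit (spectrum a) (\<lambda>n z. cnj (poly (P n) z)) (\<lambda>z. cnj (f z)) sequentially"
    using P(1) unfolding uniform_limit_iff by (simp add: dist_norm flip: complex_cnj_diff)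
  then have "uniform_limit (spectrum a) (\<lambda>n. poly (map_poly cnj (P n))) (\<lambda>z. cnj (f z)) sequentially"
    by (rule uniform_limit_cong'[THEN iffD1, rotated 2]) (simp_all add: poly_cnj cnj_spectrum[OF a])
  moreover have "(\<lambda>n. ceval (map_poly cnj (P n)) a) \<longlonglongrightarrow> star y"
    using bounded_linear.tendsto[OF bounded_linear_star P(2)] by (simp add: star_ceval[OF a])
  ultimately show ?thesis unfolding poly_limit_def by (intro exI conjI)
qed

lemma cfc_hom_exists:
  assumes a: "star a = a"
  shows "\<exists>\<Phi>. cfc_hom a \<Phi>"
proof
  define \<Phi> where "\<Phi> f = (THE y. poly_limit a f y)" for f
  have \<Phi>_eq: "\<Phi> f = y" if "poly_limit a f y" for f y
    unfolding \<Phi>_def using that poly_limit_unique[OF a] by blast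
  have \<Phi>: "poly_limit a f (\<Phi> f)" if "continuous_on (spectrum a) f" for f
    using poly_limit_exists[OF a that] \<Phi>_eq by metis
  show "cfc_hom a \<Phi>"
    unfolding cfc_hom_def
  proof (intro conjI allI impI)
    fix f g :: "complex \<Rightarrow> complex"
    assume f: "continuous_on (spectrum a) f" and "\<forall>z\<in>spectrum a. f z = g z"
    then show "\<Phi> f = \<Phi> g" using poly_limit_cong[OF \<Phi>[OF f], of g] \<Phi>_eq by metis
  next
    fix f g :: "complex \<Rightarrow> complex"
    assume f: "continuous_on (spectrum a) f" and g: "continuous_on (spectrum a) g"
    show "\<Phi> (\<lambda>z. f z + g z) = \<Phi> f + \<Phi> g" "\<Phi> (\<lambda>z. f z * g z) = \<Phi> f * \<Phi> g"
      using \<Phi>[OF f] \<Phi>[OF g] f g by (auto intro!: \<Phi>_eq poly_limit_add poly_limit_mult)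
  next
    fix c and f :: "complex \<Rightarrow> complex" assume f: "continuous_on (spectrum a) f"
    have c: "poly_limit a (\<lambda>_. c) (c *\<^sub>C 1)"
      using poly_limit_cong[OF poly_limit_ceval[of a "[:c:]"], of "\<lambda>_. c"] by simp
    show "\<Phi> (\<lambda>z. c * f z) = c *\<^sub>C \<Phi> f"
      using poly_limit_mult[OF c \<Phi>[OF f] _ f] by (intro \<Phi>_eq) (simp add: mult_scaleC_left)
    show "\<Phi> (\<lambda>z. cnj (f z)) = star (\<Phi> f)"
      by (intro \<Phi>_eq poly_limit_star a \<Phi> f)
  next
    show "\<Phi> (\<lambda>z. 1) = 1"
      using poly_limit_ceval[of a "1"] by (intro \<Phi>_eq) (simp add: poly_1[abs_def])
    show "\<Phi> (\<lambda>z. z) = a"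
      using poly_limit_ceval[of a "[:0,1:]"]
      by (intro \<Phi>_eq) (auto elim!: poly_limit_cong)
  qed
qed

section \<open>Properties shared by all homomorphisms representing the calculus\<close>

context
  fixes a :: "'a::unital_cstar_algebra" and \<Phi>
  assumes hom: "cfc_hom a \<Phi>"
begin

lemma hom_cong: "continuous_on (spectrum a) f \<Longrightarrow> (\<And>z. z \<in> spectrum a \<Longrightarrow> f z = g z) \<Longrightarrow> \<Phi> f = \<Phi> g"
  using hom unfolding cfc_hom_def by blast

lemma
  assumes "continuous_on (spectrum a) f" "continuous_on (spectrum a) g"
  shows hom_add: "\<Phi> (\<lambda>z. f z + g z) = \<Phi> f + \<Phi> g"
    and hom_mult: "\<Phi> (\<lambda>z. f z * g z) = \<Phi> f * \<Phi> g"
  using hom assms unfolding cfc_hom_def by blast+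

lemma
  assumes "continuous_on (spectrum a) f"
  shows hom_cmult: "\<Phi> (\<lambda>z. c * f z) = c *\<^sub>C \<Phi> f"
    and hom_star: "\<Phi> (\<lambda>z. cnj (f z)) = star (\<Phi> f)"
  using hom assms unfolding cfc_hom_def by blast+

lemma hom_one: "\<Phi> (\<lambda>z. 1) = 1" and hom_id: "\<Phi> (\<lambda>z. z) = a"
  using hom unfolding cfc_hom_def by blast+

lemma hom_const: "\<Phi> (\<lambda>z. c) = c *\<^sub>C 1"
  using hom_cmult[of "\<lambda>_. 1" c] hom_one by simp

lemma hom_diff:
  assumes "continuous_on (spectrum a) f" "continuous_on (spectrum a) g"
  shows "\<Phi> (\<lambda>z. f z - g z) = \<Phi> f - \<Phi> g"
  using hom_add[OF assms(1) continuous_on_minus[OF assms(2)]] hom_cmult[OF assms(2), of "-1"]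
  by (simp add: scaleC_minus_left)

text \<open>For \<open>z\<close> outside the image, \<open>1 / (z - f w)\<close> is continuous on
  the spectrum, and multiplicativity makes its image an inverse of
  \<open>z - \<Phi> f\<close>.\<close>

lemma spectrum_hom:
  assumes f: "continuous_on (spectrum a) f"
  shows "spectrum (\<Phi> f) \<subseteq> f ` spectrum a"
proof
  fix z assume z: "z \<in> spectrum (\<Phi> f)"
  show "z \<in> f ` spectrum a"
  proof (rule ccontr)
    assume n: "z \<notin> f ` spectrum a"
    let ?g = "\<lambda>w. z - f w" and ?h = "\<lambda>w. 1 / (z - f w)"
    have g: "continuous_on (spectrum a) ?g" by (intro continuous_intros f)
    have h: "continuous_on (spectrum a) ?h" using n by (intro continuous_intros f) auto
    have "\<Phi> ?g * \<Phi> ?h = \<Phi> (\<lambda>w. ?g w * ?h w)" by (rule hom_mult[OF g h, symmetric])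
    also have "\<dots> = \<Phi> (\<lambda>w. 1)" using n by (intro hom_cong continuous_on_mult g h) auto
    finally have 1: "\<Phi> ?g * \<Phi> ?h = 1" by (simp add: hom_one)
    have "\<Phi> ?h * \<Phi> ?g = \<Phi> (\<lambda>w. ?h w * ?g w)" by (rule hom_mult[OF h g, symmetric])
    also have "\<dots> = \<Phi> (\<lambda>w. 1)" using n by (intro hom_cong continuous_on_mult g h) auto
    finally have "unit_elt (\<Phi> ?g)" using 1 by (intro unit_eltI) (auto simp: hom_one)
    moreover have "\<Phi> ?g = z *\<^sub>C 1 - \<Phi> f"
      using hom_diff[OF continuous_on_const f, of z] by (simp add: hom_const)
    ultimately show False using z by (simp add: spectrum_iff)
  qed
qed

text \<open>Contractivity is automatic, although \<open>cfc_hom\<close> asks for no continuity: the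
  C*-identity passes to the self-adjoint image of \<open>|f|^2\<close>, whose spectrum is confined
  by \<open>spectrum_hom\<close>. This is what lets polynomials determine \<Phi>.\<close>

lemma norm_hom_le:
  assumes f: "continuous_on (spectrum a) f" and m: "0 \<le> m" "\<And>z. z \<in> spectrum a \<Longrightarrow> cmod (f z) \<le> m"
  shows "norm (\<Phi> f) \<le> m"
proof -
  let ?g = "\<lambda>z. cnj (f z) * f z"
  have g: "continuous_on (spectrum a) ?g" by (intro continuous_intros f)
  have eq: "\<Phi> ?g = star (\<Phi> f) * \<Phi> f"
    using hom_mult[OF continuous_on_cnj[OF f] f] hom_star[OF f] by simp
  have "norm (\<Phi> ?g) \<le> m\<^sup>2"
  proof (rule norm_le_spectral_radius)
    show "star (\<Phi> ?g) = \<Phi> ?g" unfolding eq by (simp add: star_mult star_star)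
    fix z assume "z \<in> spectrum (\<Phi> ?g)"
    then obtain w where w: "w \<in> spectrum a" "z = ?g w" using spectrum_hom[OF g] by blast
    have "cmod z = (cmod (f w))\<^sup>2" by (simp add: w(2) norm_mult power2_eq_square)
    then show "cmod z \<le> m\<^sup>2" using m(2)[OF w(1)] by (simp add: power_mono)
  qed simp
  then have "(norm (\<Phi> f))\<^sup>2 \<le> m\<^sup>2" by (simp add: eq cstar_identity)
  then show ?thesis using m(1) by (rule power2_le_imp_le)
qed

lemma hom_poly: "\<Phi> (poly p) = ceval p a"
proof (induction p)
  case 0
  then show ?case using hom_const[of 0] by (simp add: poly_0[abs_def])
next
  case (pCons c p)
  have "\<Phi> (poly (pCons c p)) = \<Phi> (\<lambda>z. c + z * poly p z)"
    by (rule arg_cong[of _ _ \<Phi>]) (simp add: fun_eq_iff)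
  also have "\<dots> = \<Phi> (\<lambda>z. c) + \<Phi> (\<lambda>z. z) * \<Phi> (poly p)"
    by (subst hom_add hom_mult, (intro continuous_intros)+)+ simp
  finally show ?case by (simp only: hom_const hom_id pCons.IH ceval_pCons)
qed

end

text \<open>Both homomorphisms agree on polynomials and are contractive, so both values are limits
  of the same sequence. Together with existence this gives the definite description in
  \<open>cfc\<close> its meaning.\<close>

lemma cfc_hom_unique:
  assumes a: "star a = a" and 1: "cfc_hom a \<Phi>" and 2: "cfc_hom a \<Psi>" and f: "continuous_on (spectrum a) f"
  shows "\<Phi> f = \<Psi> f"
proof -
  have "spectrum a \<subseteq> \<real>" using spectrum_self_adjoint_real[OF a] by blast
  with f obtain P where P: "uniform_limit (spectrum a) (\<lambda>n. poly (P n)) f sequentially"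
    using uniform_limit_poly[OF compact_spectrum] by blast
  have lim: "(\<lambda>n. ceval (P n) a) \<longlonglongrightarrow> \<Theta> f" if h: "cfc_hom a \<Theta>" for \<Theta>
  proof (rule tendstoI)
    fix e :: real assume "e > 0"
    then have "\<forall>\<^sub>F n in sequentially. \<forall>z\<in>spectrum a. dist (poly (P n) z) (f z) < e/2"
      using P unfolding uniform_limit_iff by (meson half_gt_zero)
    then show "\<forall>\<^sub>F n in sequentially. dist (ceval (P n) a) (\<Theta> f) < e"
    proof eventually_elim
      case (elim n)
      have "norm (\<Theta> (\<lambda>z. poly (P n) z - f z)) \<le> e/2"
        using elim \<open>e > 0\<close> by (intro norm_hom_le[OF h] continuous_intros f) (auto simp: dist_norm less_imp_le)
      also have "\<Theta> (\<lambda>z. poly (P n) z - f z) = ceval (P n) a - \<Theta> f"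
        using hom_diff[OF h _ f, of "poly (P n)"] hom_poly[OF h] by (simp add: continuous_intros)
      finally show ?case using \<open>e > 0\<close> by (simp add: dist_norm)
    qed
  qed
  from lim[OF 1] lim[OF 2] show ?thesis by (rule LIMSEQ_unique)
qed

lemma cfc_eq:
  assumes a: "star a = a" and h: "cfc_hom a \<Phi>" and f: "continuous_on (spectrum a) f"
  shows "cfc f a = \<Phi> f"
  unfolding cfc_def using h cfc_hom_unique[OF a _ h f] by blast

lemma cfc_hom_cfc:
  assumes a: "star a = a"
  shows "cfc_hom a (\<lambda>f. cfc f a)"
proof -
  obtain \<Phi> where h: "cfc_hom a \<Phi>" using cfc_hom_exists[OF a] by blast
  note eq = cfc_eq[OF a h]
  show ?thesis
    unfolding cfc_hom_def
  proof (intro conjI allI impI)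
    fix f g :: "complex \<Rightarrow> complex"
    assume f: "continuous_on (spectrum a) f" and fg: "\<forall>z\<in>spectrum a. f z = g z"
    have g: "continuous_on (spectrum a) g" using continuous_on_cong[OF refl] f fg by metis
    show "cfc f a = cfc g a" using hom_cong[OF h f] fg by (simp add: eq f g)
  qed (simp_all add: eq continuous_intros hom_add[OF h] hom_mult[OF h] hom_const[OF h]
      mult_scaleC_left hom_star[OF h] hom_one[OF h] hom_id[OF h])
qed

section \<open>Real functional calculus of self-adjoint elements\<close>

text \<open>\<open>K\<close> is any real set whose image contains the spectrum. Continuity and
  pointwise inequalities can then be stated on a convenient interval or half-line instead of on the
  unknown spectrum.\<close>

definition sa_in :: "'a::unital_cstar_algebra \<Rightarrow> real set \<Rightarrow> bool" where
  "sa_in a K \<longleftrightarrow> star a = a \<and> spectrum a \<subseteq> of_real ` K"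

definition rcfc :: "(real \<Rightarrow> real) \<Rightarrow> 'a::unital_cstar_algebra \<Rightarrow> 'a" where
  "rcfc f a = cfc (\<lambda>z. complex_of_real (f (Re z))) a"

lemma sa_in_star: "sa_in a K \<Longrightarrow> star a = a"
  by (simp add: sa_in_def)

lemma sa_inI: "star a = a \<Longrightarrow> (\<And>x. complex_of_real x \<in> spectrum a \<Longrightarrow> x \<in> K) \<Longrightarrow> sa_in a K"
  unfolding sa_in_def using spectrum_self_adjoint_real[of a] by (blast elim!: Reals_cases)

lemma sa_in_spectrum: "sa_in a K \<Longrightarrow> z \<in> spectrum a \<Longrightarrow> Re z \<in> K \<and> z = of_real (Re z)"
  by (auto simp: sa_in_def)

lemma sa_in_mono: "sa_in a K \<Longrightarrow> K \<subseteq> L \<Longrightarrow> sa_in a L"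
  unfolding sa_in_def by blast

lemma sa_in_Int: "sa_in a K \<Longrightarrow> sa_in a L \<Longrightarrow> sa_in a (K \<inter> L)"
  by (intro sa_inI) (auto simp: sa_in_star dest: sa_in_spectrum)

lemma sa_in_norm: "star a = a \<Longrightarrow> sa_in a {- norm a..norm a}"
  using norm_le_of_spectrum[of _ a] by (intro sa_inI) fastforce+

lemma positive_cone_iff: "a \<in> positive_cone \<longleftrightarrow> sa_in a {0..}"
  unfolding positive_cone_def sa_in_def nonneg_Reals_def by auto

lemma sa_in_positive: "a \<in> positive_cone \<Longrightarrow> sa_in a {0..norm a}"
  unfolding positive_cone_iff using sa_in_Int[OF _ sa_in_norm[OF sa_in_star]]
  by (rule sa_in_mono) auto

lemma continuous_on_rcfc:
  assumes "sa_in a K" "continuous_on K f"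
  shows "continuous_on (spectrum a) (\<lambda>z. complex_of_real (f (Re z)))"
  by (intro continuous_on_of_real continuous_on_compose2[OF assms(2)] continuous_on_Re continuous_on_id)
     (use sa_in_spectrum[OF assms(1)] in auto)

context
  fixes a :: "'a::unital_cstar_algebra" and K
  assumes a: "sa_in a K"
begin

lemmas hom_rcfc = cfc_hom_cfc[OF sa_in_star[OF a]]

lemma rcfc_cong:
  assumes "continuous_on K f" "\<And>x. x \<in> K \<Longrightarrow> f x = g x"
  shows "rcfc f a = rcfc g a"
  unfolding rcfc_def
  by (rule hom_cong[OF hom_rcfc continuous_on_rcfc[OF a assms(1)]]) (simp add: assms(2) sa_in_spectrum[OF a])

lemma rcfc_const: "rcfc (\<lambda>x. r) a = r *\<^sub>R 1"
  unfolding rcfc_def using hom_const[OF hom_rcfc, of "of_real r"] by (simp add: scaleC_of_real)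

lemma rcfc_id: "rcfc (\<lambda>x. x) a = a"
proof -
  have "rcfc (\<lambda>x. x) a = cfc (\<lambda>z. z) a"
    unfolding rcfc_def
    by (rule hom_cong[OF hom_rcfc continuous_on_rcfc[OF a]]) (use sa_in_spectrum[OF a] in auto)
  then show ?thesis using hom_id[OF hom_rcfc] by simp
qed

lemma
  assumes f: "continuous_on K f"
  shows rcfc_cmult: "rcfc (\<lambda>x. r * f x) a = r *\<^sub>R rcfc f a"
    and star_rcfc: "star (rcfc f a) = rcfc f a"
  using hom_cmult[OF hom_rcfc continuous_on_rcfc[OF a f], of "of_real r"]
    hom_star[OF hom_rcfc continuous_on_rcfc[OF a f]]
  by (simp_all add: rcfc_def scaleC_of_real)

lemma
  assumes f: "continuous_on K f" and g: "continuous_on K g"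
  shows rcfc_add: "rcfc (\<lambda>x. f x + g x) a = rcfc f a + rcfc g a"
    and rcfc_diff: "rcfc (\<lambda>x. f x - g x) a = rcfc f a - rcfc g a"
    and rcfc_mult: "rcfc (\<lambda>x. f x * g x) a = rcfc f a * rcfc g a"
  using hom_add[OF hom_rcfc continuous_on_rcfc[OF a f] continuous_on_rcfc[OF a g]]
    hom_diff[OF hom_rcfc continuous_on_rcfc[OF a f] continuous_on_rcfc[OF a g]]
    hom_mult[OF hom_rcfc continuous_on_rcfc[OF a f] continuous_on_rcfc[OF a g]]
  by (simp_all add: rcfc_def)

lemma rcfc_minus: "continuous_on K f \<Longrightarrow> rcfc (\<lambda>x. - f x) a = - rcfc f a"
  using rcfc_cmult[of f "-1"] by simp

lemma rcfc_sum:
  assumes "\<And>i. i \<in> I \<Longrightarrow> continuous_on K (f i)"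
  shows "rcfc (\<lambda>x. \<Sum>i\<in>I. f i x) a = (\<Sum>i\<in>I. rcfc (f i) a)"
  using assms
  by (induction I rule: infinite_finite_induct)
     (simp_all add: rcfc_add continuous_on_sum rcfc_const)

lemma rcfc_power: "continuous_on K f \<Longrightarrow> rcfc (\<lambda>x. f x ^ n) a = rcfc f a ^ n"
  by (induction n) (simp_all add: rcfc_const rcfc_mult continuous_on_power)

lemma sa_in_rcfc:
  assumes f: "continuous_on K f"
  shows "sa_in (rcfc f a) (f ` K)"
  unfolding sa_in_def
  using star_rcfc[OF f] spectrum_hom[OF hom_rcfc continuous_on_rcfc[OF a f]] sa_in_spectrum[OF a]
  by (auto simp: rcfc_def)

lemma norm_rcfc_le:
  assumes f: "continuous_on K f" and m: "0 \<le> m" "\<And>x. x \<in> K \<Longrightarrow> \<bar>f x\<bar> \<le> m"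
  shows "norm (rcfc f a) \<le> m"
  unfolding rcfc_def
  by (rule norm_hom_le[OF hom_rcfc continuous_on_rcfc[OF a f] m(1)])
     (use sa_in_spectrum[OF a] m(2) in auto)

lemma rcfc_positive:
  assumes f: "continuous_on K f" and "\<And>x. x \<in> K \<Longrightarrow> 0 \<le> f x"
  shows "rcfc f a \<in> positive_cone"
  unfolding positive_cone_iff by (rule sa_in_mono[OF sa_in_rcfc[OF f]]) (use assms(2) in auto)

text \<open>Approximate \<open>f\<close> by polynomials uniformly on the compact image
  \<open>L\<close> of the spectrum of \<open>a\<close>. Polynomials in \<open>b\<close> are already
  functions of \<open>a\<close>, so both sides are limits of the same elements
  \<open>ceval (P n) b\<close>.\<close>

lemma rcfc_compose:
  assumes h: "continuous_on K h" and f: "continuous_on (h ` K) f"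
  shows "rcfc f (rcfc h a) = rcfc (\<lambda>x. f (h x)) a"
proof -
  define b where "b = rcfc h a"
  define H where "H = (\<lambda>z. complex_of_real (h (Re z)))"
  define F where "F = (\<lambda>z. complex_of_real (f (Re z)))"
  have H: "continuous_on (spectrum a) H" unfolding H_def by (rule continuous_on_rcfc[OF a h])
  define L where "L = H ` spectrum a"
  have L: "compact L" "L \<subseteq> \<real>"
    unfolding L_def using compact_continuous_image[OF H compact_spectrum] by (auto simp: H_def)
  have ReL: "Re ` L \<subseteq> h ` K" using sa_in_spectrum[OF a] by (auto simp: L_def H_def)
  have F: "continuous_on L F" unfolding F_def
    by (intro continuous_on_of_real continuous_on_compose2[OF f _ ReL] continuous_on_Re continuous_on_id)
  obtain P where P: "uniform_limit L (\<lambda>n. poly (P n)) F sequentially"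
    by (rule uniform_limit_poly[OF L F])
  have b: "star b = b" unfolding b_def by (rule star_rcfc[OF h])
  note homb = cfc_hom_cfc[OF b]
  have sb: "spectrum b \<subseteq> L"
    unfolding b_def rcfc_def L_def using spectrum_hom[OF hom_rcfc H] by (simp add: H_def)
  have Fb: "continuous_on (spectrum b) F" by (rule continuous_on_subset[OF F sb])
  have FH: "continuous_on (spectrum a) (\<lambda>z. F (H z))"
    by (rule continuous_on_compose2[OF F H]) (simp add: L_def)
  have pH: "continuous_on (spectrum a) (\<lambda>z. poly p (H z))" for p
    by (intro continuous_intros H)
  have ev: "cfc (\<lambda>z. poly p (H z)) a = ceval p b" for p
  proof (induction p)
    case 0
    then show ?case using hom_const[OF hom_rcfc, of 0] by simp
  next
    case (pCons c p)
    have "cfc (\<lambda>z. poly (pCons c p) (H z)) a = cfc (\<lambda>z. c + H z * poly p (H z)) a" by simp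
    also have "\<dots> = cfc (\<lambda>z. c) a + cfc H a * cfc (\<lambda>z. poly p (H z)) a"
      using hom_add[OF hom_rcfc continuous_on_const continuous_on_mult[OF H pH]] hom_mult[OF hom_rcfc H pH]
      by simp
    also have "cfc H a = b" by (simp add: b_def rcfc_def H_def)
    finally show ?case by (simp only: hom_const[OF hom_rcfc] pCons.IH ceval_pCons)
  qed
  have l1: "(\<lambda>n. ceval (P n) b) \<longlonglongrightarrow> cfc F b"
  proof (rule tendstoI)
    fix e :: real assume "e > 0"
    then have "\<forall>\<^sub>F n in sequentially. \<forall>z\<in>L. dist (poly (P n) z) (F z) < e/2"
      using P unfolding uniform_limit_iff by (meson half_gt_zero)
    then show "\<forall>\<^sub>F n in sequentially. dist (ceval (P n) b) (cfc F b) < e"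
    proof eventually_elim
      case (elim n)
      have "norm (cfc (\<lambda>z. poly (P n) z - F z) b) \<le> e/2"
        using elim \<open>e > 0\<close> sb
        by (intro norm_hom_le[OF homb] continuous_intros Fb) (auto simp: dist_norm less_imp_le subset_iff)
      also have "cfc (\<lambda>z. poly (P n) z - F z) b = ceval (P n) b - cfc F b"
        using hom_diff[OF homb _ Fb, of "poly (P n)"] hom_poly[OF homb] by (simp add: continuous_intros)
      finally show ?case using \<open>e > 0\<close> by (simp add: dist_norm)
    qed
  qed
  have l2: "(\<lambda>n. ceval (P n) b) \<longlonglongrightarrow> cfc (\<lambda>z. F (H z)) a"
  proof (rule tendstoI)
    fix e :: real assume "e > 0"
    then have "\<forall>\<^sub>F n in sequentially. \<forall>z\<in>L. dist (poly (P n) z) (F z) < e/2"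
      using P unfolding uniform_limit_iff by (meson half_gt_zero)
    then show "\<forall>\<^sub>F n in sequentially. dist (ceval (P n) b) (cfc (\<lambda>z. F (H z)) a) < e"
    proof eventually_elim
      case (elim n)
      have "norm (cfc (\<lambda>z. poly (P n) (H z) - F (H z)) a) \<le> e/2"
        using elim \<open>e > 0\<close>
        by (intro norm_hom_le[OF hom_rcfc] continuous_on_diff FH pH) (auto simp: dist_norm less_imp_le L_def)
      also have "cfc (\<lambda>z. poly (P n) (H z) - F (H z)) a = ceval (P n) b - cfc (\<lambda>z. F (H z)) a"
        using hom_diff[OF hom_rcfc pH FH] ev by simp
      finally show ?case using \<open>e > 0\<close> by (simp add: dist_norm)
    qed
  qed
  from LIMSEQ_unique[OF l1 l2] show ?thesis by (simp add: rcfc_def F_def H_def b_def)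
qed

end

lemma rcfc_shift:
  assumes a: "sa_in a K" and f: "continuous_on ((\<lambda>x. x + t) ` K) f"
  shows "rcfc f (a + t *\<^sub>R 1) = rcfc (\<lambda>x. f (x + t)) a"
proof -
  have "rcfc (\<lambda>x. x + t) a = a + t *\<^sub>R 1"
    using rcfc_add[OF a continuous_on_id continuous_on_const] by (simp add: rcfc_id[OF a] rcfc_const[OF a])
  with rcfc_compose[OF a _ f] show ?thesis by (simp add: continuous_intros)
qed

lemma sa_in_shift: "sa_in a K \<Longrightarrow> sa_in (a + t *\<^sub>R 1) ((\<lambda>x. x + t) ` K)"
  using sa_in_rcfc[of a K "\<lambda>x. x + t"] rcfc_add[of a K "\<lambda>x. x" "\<lambda>x. t"]
  by (simp add: continuous_intros rcfc_id rcfc_const)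

section \<open>The positive cone\<close>

lemma positive_star: "a \<in> positive_cone \<Longrightarrow> star a = a"
  by (simp add: positive_cone_def)

text \<open>Sums of noncommuting elements escape the functional calculus; rephrased as a norm
  inequality, positivity becomes stable under addition by the triangle inequality.\<close>

lemma positive_iff_norm:
  assumes a: "star a = a" and c: "norm a \<le> c"
  shows "a \<in> positive_cone \<longleftrightarrow> norm (c *\<^sub>R 1 - a) \<le> c"
proof
  assume "a \<in> positive_cone"
  then have p: "sa_in a {0..norm a}" by (rule sa_in_positive)
  have "norm (rcfc (\<lambda>x. c - x) a) \<le> c"
    using order_trans[OF norm_ge_zero c] c by (intro norm_rcfc_le[OF p] continuous_intros) auto
  then show "norm (c *\<^sub>R 1 - a) \<le> c"
    using rcfc_diff[OF p continuous_on_const continuous_on_id] by (simp add: rcfc_const[OF p] rcfc_id[OF p])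
next
  assume n: "norm (c *\<^sub>R 1 - a) \<le> c"
  show "a \<in> positive_cone"
    unfolding positive_cone_iff
  proof (rule sa_inI[OF a])
    fix x assume "complex_of_real x \<in> spectrum a"
    moreover have "of_real (c - x) *\<^sub>C 1 - (c *\<^sub>R 1 - a) = (- 1) *\<^sub>C (of_real x *\<^sub>C 1 - a)"
      unfolding scaleC_of_real scaleR_left_diff_distrib by (simp add: scaleC_minus_left)
    ultimately have "of_real (c - x) \<in> spectrum (c *\<^sub>R 1 - a)"
      unfolding spectrum_iff using unit_scaleC_iff[of "-1" "of_real x *\<^sub>C 1 - a"] by simp
    then have "\<bar>c - x\<bar> \<le> c" using norm_le_of_spectrum n norm_of_real order_trans by metis
    then show "x \<in> {0..}" by simp
  qed
qed

lemma positive_add: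
  assumes "a \<in> positive_cone" "b \<in> positive_cone"
  shows "a + b \<in> positive_cone"
proof -
  let ?c = "norm a" and ?d = "norm b"
  have a: "norm (?c *\<^sub>R 1 - a) \<le> ?c" and b: "norm (?d *\<^sub>R 1 - b) \<le> ?d"
    using assms positive_iff_norm positive_star by blast+
  have "norm ((?c + ?d) *\<^sub>R 1 - (a + b)) = norm ((?c *\<^sub>R 1 - a) + (?d *\<^sub>R 1 - b))"
    by (simp add: algebra_simps)
  also have "\<dots> \<le> ?c + ?d" using a b by (intro order_trans[OF norm_triangle_ineq] add_mono)
  finally show ?thesis
    using assms by (subst positive_iff_norm[where c = "?c + ?d"])
      (simp_all add: star_add positive_star norm_triangle_ineq)
qed

lemma positive_scaleR:
  assumes "a \<in> positive_cone" "0 \<le> r"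
  shows "r *\<^sub>R a \<in> positive_cone"
proof -
  have p: "sa_in a {0..}" using assms by (simp add: positive_cone_iff)
  have "rcfc (\<lambda>x. r * x) a \<in> positive_cone"
    using assms(2) by (intro rcfc_positive[OF p] continuous_intros) auto
  then show ?thesis using rcfc_cmult[OF p continuous_on_id] by (simp add: rcfc_id[OF p])
qed

lemma positive_one [simp]: "1 \<in> positive_cone"
  unfolding positive_cone_iff
proof (rule sa_inI)
  fix x assume "complex_of_real x \<in> spectrum (1::'a)"
  then have "\<not> unit_elt ((of_real (x - 1)) *\<^sub>C (1::'a))" by (simp add: spectrum_iff scaleC_diff_left)
  then have "x - 1 = 0" using unit_scaleC[OF _ unit_eltI[of 1 "1::'a"]] by (metis mult_1_left of_real_eq_0_iff)
  then show "x \<in> {0..}" by simp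
qed simp

lemma positive_square:
  assumes a: "star a = a"
  shows "a * a \<in> positive_cone"
proof -
  have s: "sa_in a UNIV" using sa_in_norm[OF a] sa_in_mono by blast
  have "rcfc (\<lambda>x. x * x) a \<in> positive_cone" by (intro rcfc_positive[OF s] continuous_intros) auto
  then show ?thesis using rcfc_mult[OF s continuous_on_id continuous_on_id] by (simp add: rcfc_id[OF s])
qed

lemma positive_norm_add_diff:
  assumes a: "star a = a"
  shows "norm a *\<^sub>R 1 + a \<in> positive_cone" "norm a *\<^sub>R 1 - a \<in> positive_cone"
proof -
  note s = sa_in_norm[OF a]
  have "rcfc (\<lambda>x. norm a + x) a \<in> positive_cone" "rcfc (\<lambda>x. norm a - x) a \<in> positive_cone"
    by (intro rcfc_positive[OF s] continuous_intros; simp)+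
  then show "norm a *\<^sub>R 1 + a \<in> positive_cone" "norm a *\<^sub>R 1 - a \<in> positive_cone"
    using rcfc_add[OF s continuous_on_const continuous_on_id] rcfc_diff[OF s continuous_on_const continuous_on_id]
    by (simp_all add: rcfc_const[OF s] rcfc_id[OF s])
qed

definition positive_sqrt :: "'a::unital_cstar_algebra \<Rightarrow> 'a" where
  "positive_sqrt = rcfc sqrt"

lemma
  assumes "a \<in> positive_cone"
  shows star_positive_sqrt: "star (positive_sqrt a) = positive_sqrt a"
    and positive_sqrt_square: "positive_sqrt a * positive_sqrt a = a"
proof -
  have p: "sa_in a {0..}" using assms by (simp add: positive_cone_iff)
  have c: "continuous_on {0..} sqrt" by (intro continuous_intros)
  show "star (positive_sqrt a) = positive_sqrt a"
    unfolding positive_sqrt_def by (rule star_rcfc[OF p c])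
  have "rcfc (\<lambda>x. sqrt x * sqrt x) a = rcfc (\<lambda>x. x) a"
    by (rule rcfc_cong[OF p]) (auto intro!: continuous_intros)
  then show "positive_sqrt a * positive_sqrt a = a"
    unfolding positive_sqrt_def using rcfc_mult[OF p c c] by (simp add: rcfc_id[OF p])
qed

text \<open>The Bernstein form, values at nodes times nonnegative weights with sum 1, is what
  matters: in Klein's inequality the weights become positive elements.\<close>

lemma Bernstein_approx:
  assumes cd: "c < d" and g: "continuous_on {c..d} (g :: real \<Rightarrow> real)" and e: "e > 0"
  shows "\<exists>N. \<forall>n\<ge>N. \<forall>y\<in>{c..d}.
    \<bar>g y - (\<Sum>k\<le>n. g (c + (d - c) * (real k / real n)) * Bernstein n k ((y - c) / (d - c)))\<bar> < e"
proof -
  have "c + (d - c) * u \<in> {c..d}" if "u \<in> {0..1}" for u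
  proof -
    have eq: "c + (d - c) * u = (1 - u) * c + u * d" by (simp add: algebra_simps)
    have "(1 - u) * c + u * d \<le> d" using that cd by (intro convex_bound_le) auto
    moreover have "c \<le> c + (d - c) * u" using that cd by simp
    ultimately show ?thesis using eq by simp
  qed
  then have "continuous_on {0..1} (\<lambda>u. g (c + (d - c) * u))"
    by (intro continuous_on_compose2[OF g] continuous_intros) auto
  from Bernstein_Weierstrass[OF this e] obtain N where
    N: "\<And>n u. N \<le> n \<Longrightarrow> u \<in> {0..1} \<Longrightarrow> \<bar>g (c + (d - c) * u) -
      (\<Sum>k\<le>n. g (c + (d - c) * (real k / real n)) * Bernstein n k u)\<bar> < e" by blast
  show ?thesis
  proof (intro exI[of _ N] allI impI ballI)
    fix n y assume n: "n \<ge> N" and y: "y \<in> {c..d}"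
    have "(y - c) / (d - c) \<in> {0..1}" using y cd by (simp add: divide_simps)
    from N[OF n this] cd
    show "\<bar>g y - (\<Sum>k\<le>n. g (c + (d - c) * (real k / real n)) * Bernstein n k ((y - c) / (d - c)))\<bar> < e"
      by simp
  qed
qed

section \<open>Faithful tracial states\<close>

locale tracial_state =
  fixes \<tau> :: "'a::unital_cstar_algebra \<Rightarrow> complex"
  assumes state: "faithful_tracial_state \<tau>"
begin

lemma trace_add: "\<tau> (x + y) = \<tau> x + \<tau> y"
  and trace_scaleC: "\<tau> (c *\<^sub>C x) = c * \<tau> x"
  and trace_positive: "x \<in> positive_cone \<Longrightarrow> \<tau> x \<in> \<real>\<^sub>\<ge>\<^sub>0"
  and trace_one: "\<tau> 1 = 1"
  and trace_comm: "\<tau> (x * y) = \<tau> (y * x)"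
  and trace_faithful: "\<tau> (star x * x) = 0 \<Longrightarrow> x = 0"
  using state unfolding faithful_tracial_state_def by simp_all

definition T :: "'a \<Rightarrow> real" where "T x = Re (\<tau> x)"

lemma trace_scaleR: "\<tau> (r *\<^sub>R x) = of_real r * \<tau> x"
  using trace_scaleC[of "of_real r" x] by (simp add: scaleC_of_real)

lemma trace_minus: "\<tau> (- x) = - \<tau> x"
  using trace_scaleC[of "-1" x] by (simp add: scaleC_minus_left)

lemma trace_diff: "\<tau> (x - y) = \<tau> x - \<tau> y"
  using trace_add[of x "-y"] by (simp add: trace_minus)

lemma T_add: "T (x + y) = T x + T y"
  and T_diff: "T (x - y) = T x - T y"
  and T_minus: "T (- x) = - T x"
  and T_scaleR: "T (r *\<^sub>R x) = r * T x"
  and T_one: "T 1 = 1"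
  and T_comm: "T (x * y) = T (y * x)"
  using trace_comm[of x y]
  by (simp_all add: T_def trace_add trace_diff trace_minus trace_scaleR trace_one)

lemma T_zero: "T 0 = 0"
  using T_scaleR[of 0 0] by simp

lemma T_sum: "T (\<Sum>i\<in>I. f i) = (\<Sum>i\<in>I. T (f i))"
  by (induction I rule: infinite_finite_induct) (simp_all add: T_zero T_add)

lemma T_positive: "x \<in> positive_cone \<Longrightarrow> 0 \<le> T x"
  using trace_positive[of x] by (auto simp: T_def nonneg_Reals_def)

lemma trace_self_adjoint:
  assumes "star x = x"
  shows "\<tau> x = of_real (T x)"
proof -
  have "\<tau> (norm x *\<^sub>R 1 + x) \<in> \<real>"
    using trace_positive[OF positive_norm_add_diff(1)[OF assms]] nonneg_Reals_subset_Reals by blast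
  then have "of_real (norm x) + \<tau> x \<in> \<real>" by (simp add: trace_add trace_scaleR trace_one)
  then have "\<tau> x \<in> \<real>" by (simp add: complex_is_Real_iff)
  then show ?thesis by (simp add: T_def complex_eq_iff complex_is_Real_iff)
qed

lemma T_star: "T (star x) = T x"
proof -
  let ?h = "x + star x" and ?k = "\<i> *\<^sub>C (x - star x)"
  have "star ?k = ?k" by (simp add: star_scaleC star_diff star_star scaleC_minus_left scaleC_diff_right)
  then have "\<i> * (\<tau> x - \<tau> (star x)) = of_real (T ?k)"
    using trace_self_adjoint[of ?k] by (simp add: trace_scaleC trace_diff)
  then have "Im (\<i> * (\<tau> x - \<tau> (star x))) = 0" by simp
  then show ?thesis by (simp add: T_def)
qed

text \<open>For self-adjoint \<open>h\<close>, the multiple \<open>norm h\<close> of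
  \<open>1\<close> dominates both \<open>h\<close> and \<open>- h\<close>. A general
  \<open>x\<close> is replaced by its self-adjoint part, which has the same \<open>T\<close> and no
  larger norm.\<close>

lemma abs_T_le: "\<bar>T x\<bar> \<le> norm x"
proof -
  let ?h = "(1/2) *\<^sub>R (x + star x)"
  have h: "star ?h = ?h" by (simp add: star_scaleR star_add star_star add.commute)
  have "norm ?h \<le> norm x" using norm_triangle_ineq[of x "star x"] by simp
  moreover have "\<bar>T ?h\<bar> \<le> norm ?h"
    using T_positive[OF positive_norm_add_diff(1)[OF h]] T_positive[OF positive_norm_add_diff(2)[OF h]]
    by (simp only: T_add T_diff T_scaleR T_one)
  moreover have "T ?h = T x" by (simp add: T_scaleR T_add T_star)
  ultimately show ?thesis by simp
qed

text \<open>Positivity of \<open>star x * x\<close> itself is not yet available. The squares of the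
  self-adjoint elements \<open>?u\<close> and \<open>?v\<close> add up to twice
  \<open>star x * x + x * star x\<close>, and the trace does not distinguish the two
  products.\<close>

lemma T_star_mult_nonneg: "0 \<le> T (star x * x)"
proof -
  let ?u = "x + star x" and ?v = "\<i> *\<^sub>C (x - star x)"
  have "star ?u = ?u" by (simp add: star_add star_star add.commute)
  moreover have "star ?v = ?v"
    by (simp add: star_scaleC star_diff star_star scaleC_minus_left scaleC_diff_right)
  ultimately have "0 \<le> T (?u * ?u + ?v * ?v)"
    by (intro T_positive positive_add positive_square)
  also have "?v * ?v = - ((x - star x) * (x - star x))"
    by (simp add: mult_scaleC_left mult_scaleC_right scaleC_scaleC scaleC_minus_left)
  also have "?u * ?u + - ((x - star x) * (x - star x)) = 2 *\<^sub>R (star x * x) + 2 *\<^sub>R (x * star x)"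
    by (simp add: algebra_simps scaleR_2)
  also have "T \<dots> = 4 * T (star x * x)"
    by (simp add: T_add T_scaleR T_comm[of x "star x"])
  finally show ?thesis by simp
qed

text \<open>If \<open>n\<close> is the negative part of \<open>x* x\<close>, then \<open>z = x n\<close> has \<open>z* z = -n\<^sup>3\<close>, of trace both
  nonnegative and nonpositive.\<close>

lemma positive_star_mult:
  fixes x :: 'a
  shows "star x * x \<in> positive_cone"
proof -
  define y where "y = star x * x"
  have y: "star y = y" by (simp add: y_def star_mult star_star)
  have s: "sa_in y UNIV" using sa_in_norm[OF y] sa_in_mono by blast
  define f where "f = (\<lambda>t::real. max 0 (- t))"
  have f: "continuous_on UNIV f" unfolding f_def by (intro continuous_intros)
  define n where "n = rcfc f y"
  have n: "star n = n" unfolding n_def by (rule star_rcfc[OF s f])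
  define z where "z = x * n"
  have "star z * z = n * y * n" by (simp add: z_def star_mult n y_def mult.assoc)
  also have "\<dots> = rcfc (\<lambda>t. f t * t * f t) y"
    unfolding n_def
    by (subst rcfc_mult[OF s _ f], intro continuous_intros f, subst rcfc_mult[OF s f])
       (auto intro!: continuous_intros simp: rcfc_id[OF s])
  also have "\<dots> = rcfc (\<lambda>t. - (f t ^ 3)) y"
    by (intro arg_cong2[of _ _ _ _ rcfc]) (auto simp: f_def max_def fun_eq_iff power3_eq_cube)
  also have "\<dots> = - rcfc (\<lambda>t. f t ^ 3) y" by (intro rcfc_minus[OF s] continuous_intros f)
  finally have zz: "star z * z = - rcfc (\<lambda>t. f t ^ 3) y" .
  have "rcfc (\<lambda>t. f t ^ 3) y \<in> positive_cone"
    by (intro rcfc_positive[OF s] continuous_intros f) (simp add: f_def)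
  from T_positive[OF this] T_star_mult_nonneg[of z] have "T (star z * z) = 0"
    by (simp add: zz T_minus)
  then have "z = 0" using trace_faithful trace_self_adjoint[of "star z * z"] by (simp add: star_mult star_star)
  then have "rcfc (\<lambda>t. f t ^ 3) y = 0" using zz by simp
  then have "n ^ 3 = 0" unfolding n_def by (simp add: rcfc_power[OF s f])
  \<comment> \<open>The exponent is raised to a power of two, where the norm of a self-adjoint power
    is known.\<close>
  then have "n ^ 4 = 0" by (metis mult_zero_right power_Suc numeral_eq_Suc pred_numeral_simps(2) semiring_norm(26,27) pred_numeral_simps(3) mult_zero_left power_Suc2)
  then have "norm n ^ 4 = 0" using norm_self_adjoint_power2[OF n, of 2] by simp
  then have n0: "n = 0" by simp
  have "y = rcfc (\<lambda>t. max 0 t - f t) y"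
    using rcfc_id[OF s] by (subst rcfc_id[OF s, symmetric]) (intro arg_cong2[of _ _ _ _ rcfc], auto simp: f_def max_def fun_eq_iff)
  also have "\<dots> = rcfc (\<lambda>t. max 0 t) y - n"
    unfolding n_def by (intro rcfc_diff[OF s] continuous_intros f)
  finally have "y = rcfc (\<lambda>t. max 0 t) y" using n0 by simp
  moreover have "rcfc (\<lambda>t. max 0 t) y \<in> positive_cone"
    by (intro rcfc_positive[OF s] continuous_intros) auto
  ultimately show ?thesis unfolding y_def by simp
qed

lemma positive_congruence:
  fixes a s :: 'a
  assumes "a \<in> positive_cone"
  shows "star s * a * s \<in> positive_cone"
  using positive_star_mult[of "positive_sqrt a * s"] positive_sqrt_square[OF assms]
  by (simp add: star_mult star_positive_sqrt[OF assms]) (metis mult.assoc)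

text \<open>\<open>a * b\<close> need not be self-adjoint; cyclicity replaces it by the congruence
  of \<open>a\<close> with the square root of \<open>b\<close>.\<close>

lemma T_mult_nonneg:
  assumes "a \<in> positive_cone" "b \<in> positive_cone"
  shows "0 \<le> T (a * b)"
proof -
  let ?s = "positive_sqrt b"
  have "0 \<le> T (star ?s * a * ?s)" by (intro T_positive positive_congruence assms)
  also have "\<dots> = T (a * b)"
    by (metis T_comm assms(2) mult.assoc positive_sqrt_square star_positive_sqrt)
  finally show ?thesis .
qed

lemma T_mult_le:
  assumes x: "star x = x" and y: "star y = y"
  shows "(T (x * y))\<^sup>2 \<le> T (x * x) * T (y * y)"
proof -
  have *: "0 \<le> T (x * x) - 2 * r * T (x * y) + r\<^sup>2 * T (y * y)" for r
  proof -
    have "star (x - r *\<^sub>R y) = x - r *\<^sub>R y" by (simp add: star_diff star_scaleR x y)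
    then have "0 \<le> T ((x - r *\<^sub>R y) * (x - r *\<^sub>R y))" by (intro T_positive positive_square)
    then show ?thesis
      by (simp add: left_diff_distrib right_diff_distrib T_diff T_scaleR T_comm[of y x] power2_eq_square)
  qed
  have nonneg: "0 \<le> T (y * y)" by (intro T_positive positive_square y)
  show ?thesis
  proof (cases "T (y * y) = 0")
    case True
    have "T (x * y) = 0"
    proof (rule ccontr)
      assume n: "T (x * y) \<noteq> 0"
      from *[of "(T (x * x) + 1) / (2 * T (x * y))"] True n show False by simp
    qed
    with True show ?thesis by simp
  next
    case False
    with nonneg have pos: "0 < T (y * y)" by simp
    from *[of "T (x * y) / T (y * y)"] pos show ?thesis
      by (simp add: field_simps power2_eq_square)
  qed
qed

section \<open>Klein's inequality\<close>

text \<open>The elements \<open>rcfc (b k) B\<close> are positive with sum \<open>1\<close>, a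
  substitute for spectral projections of \<open>B\<close>. Distributing over them yields, for each
  node \<open>p k\<close>, the trace of a product of two positive elements.\<close>

lemma rcfc_Bernstein:
  assumes B: "sa_in B {c..d}" and cd: "c < d"
    and n: "n > 0" and fin: "\<And>y. y \<in> {c..d} \<Longrightarrow> P + g y *\<^sub>R A + h y *\<^sub>R 1 \<in> positive_cone"
  defines "b k y \<equiv> Bernstein n k ((y - c) / (d - c))"
  defines "p k \<equiv> c + (d - c) * (real k / real n)"
  shows "0 \<le> T (P + A * rcfc (\<lambda>y. \<Sum>k\<le>n. g (p k) * b k y) B + rcfc (\<lambda>y. \<Sum>k\<le>n. h (p k) * b k y) B)"
proof -
  have cb: "continuous_on {c..d} (b k)" for k
    unfolding b_def Bernstein_def using cd by (intro continuous_intros) auto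
  have sm: "rcfc (\<lambda>y. \<Sum>k\<le>n. q k * b k y) B = (\<Sum>k\<le>n. q k *\<^sub>R rcfc (b k) B)" for q
    by (subst rcfc_sum[OF B]) (auto intro!: continuous_intros cb simp: rcfc_cmult[OF B cb])
  have one: "(\<Sum>k\<le>n. rcfc (b k) B) = 1"
  proof -
    have "(\<Sum>k\<le>n. rcfc (b k) B) = rcfc (\<lambda>y. \<Sum>k\<le>n. b k y) B"
      by (rule rcfc_sum[OF B cb, symmetric])
    then show ?thesis unfolding b_def by (simp add: rcfc_const[OF B])
  qed
  have "P + A * rcfc (\<lambda>y. \<Sum>k\<le>n. g (p k) * b k y) B + rcfc (\<lambda>y. \<Sum>k\<le>n. h (p k) * b k y) B
     = P * (\<Sum>k\<le>n. rcfc (b k) B) + A * (\<Sum>k\<le>n. g (p k) *\<^sub>R rcfc (b k) B) + (\<Sum>k\<le>n. h (p k) *\<^sub>R rcfc (b k) B)"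
    by (simp add: sm one)
  also have "\<dots> = (\<Sum>k\<le>n. (P + g (p k) *\<^sub>R A + h (p k) *\<^sub>R 1) * rcfc (b k) B)"
    by (simp add: sum_distrib_left sum.distrib distrib_right)
  finally have eq: "T (P + A * rcfc (\<lambda>y. \<Sum>k\<le>n. g (p k) * b k y) B + rcfc (\<lambda>y. \<Sum>k\<le>n. h (p k) * b k y) B)
     = (\<Sum>k\<le>n. T ((P + g (p k) *\<^sub>R A + h (p k) *\<^sub>R 1) * rcfc (b k) B))"
    by (simp add: T_sum)
  show ?thesis unfolding eq
  proof (rule sum_nonneg)
    fix k assume k: "k \<in> {..n}"
    have "(d - c) * (real k / real n) \<le> (d - c) * 1"
      using k cd n by (intro mult_left_mono) auto
    moreover have "0 \<le> (d - c) * (real k / real n)" using cd by simp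
    ultimately have "p k \<in> {c..d}" by (simp add: p_def)
    moreover have "rcfc (b k) B \<in> positive_cone"
      using cd by (intro rcfc_positive[OF B cb]) (auto simp: b_def intro!: Bernstein_nonneg)
    ultimately show "0 \<le> T ((P + g (p k) *\<^sub>R A + h (p k) *\<^sub>R 1) * rcfc (b k) B)"
      by (intro T_mult_nonneg fin)
  qed
qed

text \<open>Limit of \<open>rcfc_Bernstein\<close> for growing degree. It carries an inequality from
  scalars \<open>y\<close> to an element \<open>B\<close> that need not commute with
  \<open>A\<close>.\<close>

lemma T_Klein:
  assumes B: "sa_in B {c..d}" and cd: "c < d"
    and g: "continuous_on {c..d} g" and h: "continuous_on {c..d} h"
    and pos: "\<And>y. y \<in> {c..d} \<Longrightarrow> P + g y *\<^sub>R A + h y *\<^sub>R 1 \<in> positive_cone"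
  shows "0 \<le> T (P + A * rcfc g B + rcfc h B)"
proof (rule field_le_epsilon)
  fix e :: real assume e: "e > 0"
  \<comment> \<open>Chosen so that the error \<open>norm A * e'\<close> from \<open>g\<close> and
    the error \<open>e'\<close> from \<open>h\<close> add up to \<open>e\<close>.\<close>
  define e' where "e' = e / (norm A + 1)"
  have e': "e' > 0" using e by (simp add: e'_def add_nonneg_pos)
  define ap where "ap f n y = (\<Sum>k\<le>n. f (c + (d - c) * (real k / real n)) * Bernstein n k ((y - c) / (d - c)))"
    for f :: "real \<Rightarrow> real" and n y
  obtain N1 N2 where N: "\<And>n y. n \<ge> N1 \<Longrightarrow> y \<in> {c..d} \<Longrightarrow> \<bar>g y - ap g n y\<bar> < e'"
    "\<And>n y. n \<ge> N2 \<Longrightarrow> y \<in> {c..d} \<Longrightarrow> \<bar>h y - ap h n y\<bar> < e'"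
    using Bernstein_approx[OF cd g e'] Bernstein_approx[OF cd h e'] unfolding ap_def by blast
  define n where "n = max 1 (max N1 N2)"
  have n: "n > 0" "n \<ge> N1" "n \<ge> N2" by (auto simp: n_def)
  have cap: "continuous_on {c..d} (ap f n)" for f
    unfolding ap_def Bernstein_def using cd by (intro continuous_intros) auto
  have 0: "0 \<le> T (P + A * rcfc (ap g n) B + rcfc (ap h n) B)"
    unfolding ap_def by (rule rcfc_Bernstein[OF B cd n(1) pos])
  have dg: "norm (rcfc (ap g n) B - rcfc g B) \<le> e'"
    unfolding rcfc_diff[OF B cap g, symmetric]
    by (rule norm_rcfc_le[OF B]) (use N(1)[OF n(2)] e' in \<open>auto intro!: continuous_intros cap g simp: abs_minus_commute less_imp_le\<close>)
  have dh: "norm (rcfc (ap h n) B - rcfc h B) \<le> e'"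
    unfolding rcfc_diff[OF B cap h, symmetric]
    by (rule norm_rcfc_le[OF B]) (use N(2)[OF n(3)] e' in \<open>auto intro!: continuous_intros cap h simp: abs_minus_commute less_imp_le\<close>)
  have "T (P + A * rcfc (ap g n) B + rcfc (ap h n) B) - T (P + A * rcfc g B + rcfc h B)
     = T (A * (rcfc (ap g n) B - rcfc g B) + (rcfc (ap h n) B - rcfc h B))"
    by (simp add: T_add T_diff right_diff_distrib)
  also have "\<dots> \<le> norm (A * (rcfc (ap g n) B - rcfc g B) + (rcfc (ap h n) B - rcfc h B))"
    using abs_T_le abs_le_iff by blast
  also have "\<dots> \<le> norm A * e' + e'"
    by (intro order_trans[OF norm_triangle_ineq] add_mono dh order_trans[OF norm_mult_ineq] mult_left_mono dg) simp
  also have "\<dots> = (norm A + 1) * e'" by (simp add: distrib_right)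
  also have "\<dots> = e" unfolding e'_def using norm_ge_zero[of A] by (simp add: add_nonneg_eq_0_iff)
  finally show "0 \<le> T (P + A * rcfc g B + rcfc h B) + e" using 0 by linarith
qed

text \<open>The scalar inequality is regrouped as
  \<open>f x - \<kappa> * x^2 + g y * x + h y \<ge> 0\<close>, the separated form of
  \<open>T_Klein\<close>. The modulus \<kappa> is 0 for \<open>-ln\<close>; for \<open>eta\<close>
  it is positive and yields definiteness.\<close>

lemma T_gradient_inequality:
  assumes A: "sa_in A {a..b}" and B: "sa_in B {c..d}" and cd: "c < d"
    and fA: "continuous_on {a..b} f" and fB: "continuous_on {c..d} f" and f': "continuous_on {c..d} f'"
    and le: "\<And>x y. x \<in> {a..b} \<Longrightarrow> y \<in> {c..d} \<Longrightarrow> f y + f' y * (x - y) + \<kappa> * (x - y)\<^sup>2 \<le> f x"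
  shows "T (rcfc f B) + T (rcfc f' B * (A - B)) + \<kappa> * T ((A - B) * (A - B)) \<le> T (rcfc f A)"
proof -
  define g where "g = (\<lambda>y. 2 * \<kappa> * y - f' y)"
  define h where "h = (\<lambda>y. y * f' y - f y - \<kappa> * (y * y))"
  have g: "continuous_on {c..d} g" and h: "continuous_on {c..d} h"
    unfolding g_def h_def by (intro continuous_intros f' fB)+
  let ?P = "rcfc f A - \<kappa> *\<^sub>R (A * A)"
  have "0 \<le> T (?P + A * rcfc g B + rcfc h B)"
  proof (rule T_Klein[OF B cd g h])
    fix y assume y: "y \<in> {c..d}"
    let ?q = "\<lambda>x. f x - \<kappa> * (x * x) + (g y * x + h y)"
    have "rcfc ?q A \<in> positive_cone"
    proof (rule rcfc_positive[OF A])
      fix x assume "x \<in> {a..b}"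
      from le[OF this y] show "0 \<le> ?q x" by (simp add: g_def h_def power2_eq_square algebra_simps)
    qed (intro continuous_intros fA)
    also have "rcfc ?q A = ?P + (g y *\<^sub>R A + h y *\<^sub>R 1)"
    proof -
      have "rcfc (\<lambda>x. f x - \<kappa> * (x * x)) A = ?P"
        by (subst rcfc_diff[OF A fA], intro continuous_intros, subst rcfc_cmult[OF A], intro continuous_intros,
            subst rcfc_mult[OF A continuous_on_id continuous_on_id]) (simp add: rcfc_id[OF A])
      moreover have "rcfc (\<lambda>x. g y * x + h y) A = g y *\<^sub>R A + h y *\<^sub>R 1"
        by (subst rcfc_add[OF A], (intro continuous_intros)+, subst rcfc_cmult[OF A continuous_on_id])
           (simp add: rcfc_id[OF A] rcfc_const[OF A])
      ultimately show ?thesis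
        by (subst rcfc_add[OF A]) (auto intro!: continuous_intros fA)
    qed
    finally show "?P + g y *\<^sub>R A + h y *\<^sub>R 1 \<in> positive_cone" by (simp add: add.assoc)
  qed
  moreover have "rcfc g B = (2 * \<kappa>) *\<^sub>R B - rcfc f' B"
    unfolding g_def
    by (subst rcfc_diff[OF B _ f'], intro continuous_intros, subst rcfc_cmult[OF B continuous_on_id])
       (simp add: rcfc_id[OF B])
  moreover have "rcfc h B = B * rcfc f' B - rcfc f B - \<kappa> *\<^sub>R (B * B)"
  proof -
    have "rcfc (\<lambda>y. y * f' y) B = B * rcfc f' B" "rcfc (\<lambda>y. \<kappa> * (y * y)) B = \<kappa> *\<^sub>R (B * B)"
      using rcfc_mult[OF B continuous_on_id f'] rcfc_mult[OF B continuous_on_id continuous_on_id]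
        rcfc_cmult[OF B continuous_on_mult[OF continuous_on_id continuous_on_id], of \<kappa>]
      by (simp_all add: rcfc_id[OF B])
    then show ?thesis
      unfolding h_def
      by (subst rcfc_diff[OF B], (intro continuous_intros f' fB)+,
          subst rcfc_diff[OF B], (intro continuous_intros f' fB)+) simp
  qed
  ultimately have "0 \<le> T (?P + A * ((2 * \<kappa>) *\<^sub>R B - rcfc f' B) + (B * rcfc f' B - rcfc f B - \<kappa> *\<^sub>R (B * B)))"
    by simp
  then show ?thesis
    by (simp add: T_add T_diff T_scaleR left_diff_distrib right_diff_distrib T_comm[of B A]
        T_comm[of "rcfc f' B"] algebra_simps)
qed

end

section \<open>Positive invertible elements\<close>

definition pos_inv :: "'a::unital_cstar_algebra \<Rightarrow> bool" where
  "pos_inv a \<longleftrightarrow> sa_in a {0<..}"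

lemma pos_inv_positive: "pos_inv a \<Longrightarrow> a \<in> positive_cone"
  unfolding pos_inv_def positive_cone_iff by (erule sa_in_mono) auto

lemma pos_inv_star: "pos_inv a \<Longrightarrow> star a = a"
  unfolding pos_inv_def by (rule sa_in_star)

text \<open>Compactness gives a positive lower bound of the spectrum. The upper end stays free so
  that the interval can be made nondegenerate, as \<open>T_Klein\<close> demands.\<close>

lemma pos_inv_bounds:
  assumes "pos_inv a"
  obtains c where "c > 0" "\<And>d. d \<ge> norm a \<Longrightarrow> sa_in a {c..d}"
proof -
  note s = assms[unfolded pos_inv_def]
  have "compact (Re ` spectrum a)"
    by (intro compact_continuous_image continuous_intros compact_spectrum)
  moreover have "Re ` spectrum a \<noteq> {}" using spectrum_nonempty[OF sa_in_star[OF s]] by simp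
  ultimately obtain c where c: "c \<in> Re ` spectrum a" "\<And>x. x \<in> Re ` spectrum a \<Longrightarrow> c \<le> x"
    using compact_attains_inf[of "Re ` spectrum a"] by blast
  have "c > 0" using c(1) sa_in_spectrum[OF s] by auto
  moreover have "sa_in a {c..d}" if "d \<ge> norm a" for d
  proof (rule sa_inI[OF sa_in_star[OF s]])
    fix x assume x: "complex_of_real x \<in> spectrum a"
    have "c \<le> x" using c(2)[of x] x by (metis Re_complex_of_real image_eqI)
    moreover have "x \<le> d" using norm_le_of_spectrum[OF x] that by simp
    ultimately show "x \<in> {c..d}" by simp
  qed
  ultimately show ?thesis by (rule that)
qed

lemma pos_invI:
  assumes a: "a \<in> positive_cone" and u: "unit_elt a"
  shows "pos_inv a"
  unfolding pos_inv_def
proof (rule sa_inI[OF positive_star[OF a]])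
  fix x assume x: "complex_of_real x \<in> spectrum a"
  have "x \<ge> 0" using a x unfolding positive_cone_iff by (auto dest: sa_in_spectrum)
  moreover have "x \<noteq> 0"
  proof
    assume "x = 0"
    then have "\<not> unit_elt (- a)" using x by (simp add: spectrum_iff)
    then show False using u unit_scaleC[of "-1" a] by (simp add: scaleC_minus_left)
  qed
  ultimately show "x \<in> {0<..}" by simp
qed

lemma pos_inv_rcfc:
  assumes "sa_in a K" "continuous_on K f" "\<And>x. x \<in> K \<Longrightarrow> 0 < f x"
  shows "pos_inv (rcfc f a)"
  unfolding pos_inv_def using assms(3) by (intro sa_in_mono[OF sa_in_rcfc[OF assms(1,2)]]) auto

lemma
  assumes "pos_inv a"
  shows pos_inv_unit: "unit_elt a" and pos_inv_inv_eq: "inv_elt a = rcfc inverse a"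
    and pos_inv_inv: "pos_inv (inv_elt a)"
proof -
  note s = assms[unfolded pos_inv_def]
  have c: "continuous_on {0<..} (inverse :: real \<Rightarrow> real)" by (intro continuous_intros) auto
  have "rcfc (\<lambda>x. x * inverse x) a = rcfc (\<lambda>x. 1) a"
    by (rule rcfc_cong[OF s]) (auto intro!: continuous_intros)
  then have 1: "a * rcfc inverse a = 1"
    using rcfc_mult[OF s continuous_on_id c] by (simp add: rcfc_id[OF s] rcfc_const[OF s])
  have "rcfc (\<lambda>x. inverse x * x) a = rcfc (\<lambda>x. 1) a"
    by (rule rcfc_cong[OF s]) (auto intro!: continuous_intros)
  then have 2: "rcfc inverse a * a = 1"
    using rcfc_mult[OF s c continuous_on_id] by (simp add: rcfc_id[OF s] rcfc_const[OF s])
  show "unit_elt a" using 1 2 by (rule unit_eltI)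
  show eq: "inv_elt a = rcfc inverse a" using 1 2 by (rule inv_elt_eq)
  show "pos_inv (inv_elt a)" unfolding eq by (intro pos_inv_rcfc[OF s c]) auto
qed

lemma sa_in_shift_pos:
  assumes "a \<in> positive_cone"
  shows "sa_in (a + t *\<^sub>R 1) {t..}"
  using sa_in_shift[OF assms[unfolded positive_cone_iff], of t] by (rule sa_in_mono) auto

text \<open>Invertibility is read off a lower bound: \<open>a\<close> dominates some
  \<open>c > 0\<close>, so \<open>a - c + b\<close> is positive and the spectrum of
  \<open>a + b\<close> lies in \<open>{c..}\<close>.\<close>

lemma pos_inv_add:
  assumes "pos_inv a" "b \<in> positive_cone"
  shows "pos_inv (a + b)"
proof -
  obtain c where c: "c > 0" "sa_in a {c..norm a}" using pos_inv_bounds[OF assms(1)] by blast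
  have "sa_in (a + (- c) *\<^sub>R 1) {0..}"
    using sa_in_shift[OF c(2), of "- c"] by (rule sa_in_mono) auto
  then have "a + (- c) *\<^sub>R 1 + b \<in> positive_cone"
    using positive_add[OF _ assms(2)] by (simp add: positive_cone_iff)
  from sa_in_shift_pos[OF this, of c] have "sa_in (a + b) {c..}" by (simp add: algebra_simps)
  then show ?thesis unfolding pos_inv_def by (rule sa_in_mono) (use c(1) in auto)
qed

lemma pos_inv_scaleR:
  assumes "pos_inv a" "r > 0"
  shows "pos_inv (r *\<^sub>R a)"
proof -
  note s = assms(1)[unfolded pos_inv_def]
  have "pos_inv (rcfc (\<lambda>x. r * x) a)" using assms(2) by (intro pos_inv_rcfc[OF s] continuous_intros) auto
  then show ?thesis using rcfc_cmult[OF s continuous_on_id] by (simp add: rcfc_id[OF s])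
qed

lemma pos_inv_one [simp]: "pos_inv 1"
  by (intro pos_invI positive_one unit_eltI[of 1 1]) auto

lemma pos_inv_shift: "a \<in> positive_cone \<Longrightarrow> t > 0 \<Longrightarrow> pos_inv (a + t *\<^sub>R 1)"
  using pos_inv_add[OF pos_inv_scaleR[OF pos_inv_one]] by (simp add: add.commute)

lemma pos_inv_midpoint:
  assumes "pos_inv a" "pos_inv b"
  shows "pos_inv ((1/2) *\<^sub>R (a + b))"
  using assms by (intro pos_inv_scaleR pos_inv_add pos_inv_positive) auto

section \<open>The logarithmic determinant\<close>

text \<open>Stands in for differentiating \<open>logdet\<close> along a path. Tangent inequalities
  only bound increments from above, but exchanging \<open>s\<close> and \<open>t\<close> makes the
  bound two-sided, and a quadratic bound forces derivative 0.\<close>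

lemma constant_of_quadratic_bound:
  fixes G :: "real \<Rightarrow> real"
  assumes "\<And>s t. s \<in> {0..1} \<Longrightarrow> t \<in> {0..1} \<Longrightarrow> G t - G s \<le> C * (t - s)\<^sup>2"
  shows "G 1 = G 0"
proof -
  have *: "\<bar>G t - G s\<bar> \<le> C * (t - s)\<^sup>2" if "s \<in> {0..1}" "t \<in> {0..1}" for s t
    using assms[OF that] assms[OF that(2,1)] by (simp add: power2_commute abs_le_iff)
  have "(G has_field_derivative 0) (at s within {0..1})" if s: "s \<in> {0..1}" for s
  proof -
    have "((\<lambda>t. (G t - G s) / (t - s)) \<longlongrightarrow> 0) (at s within {0..1})"
    proof (rule Lim_null_comparison)
      have "\<bar>(G t - G s) / (t - s)\<bar> \<le> \<bar>C\<bar> * \<bar>t - s\<bar>" if "t \<in> {0..1}" "t \<noteq> s" for t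
      proof -
        have "\<bar>G t - G s\<bar> \<le> \<bar>C\<bar> * \<bar>t - s\<bar> * \<bar>t - s\<bar>"
          using *[OF s that(1)] mult_right_mono[OF abs_ge_self[of C], of "(t - s)\<^sup>2"]
          by (simp add: power2_eq_square mult.assoc flip: abs_mult)
        then show ?thesis using that by (simp add: abs_divide divide_le_eq)
      qed
      then show "\<forall>\<^sub>F t in at s within {0..1}. norm ((G t - G s) / (t - s)) \<le> \<bar>C\<bar> * \<bar>t - s\<bar>"
        by (simp add: eventually_at_filter)
      have "((\<lambda>t. \<bar>C\<bar> * \<bar>t - s\<bar>) \<longlongrightarrow> \<bar>C\<bar> * \<bar>s - s\<bar>) (at s within {0..1})"
        by (intro tendsto_intros)
      then show "((\<lambda>t. \<bar>C\<bar> * \<bar>t - s\<bar>) \<longlongrightarrow> 0) (at s within {0..1})" by simp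
    qed
    then show ?thesis by (simp add: has_field_derivative_iff)
  qed
  then have "(G has_derivative (\<lambda>h. 0)) (at s within {0..1})" if "s \<in> {0..1}" for s
    using that by (metis has_field_derivative_def lambda_zero mult_zero_left)
  then obtain c where "\<And>s. s \<in> {0..1} \<Longrightarrow> G s = c"
    using has_derivative_zero_constant[of "{0..1::real}" G] by (metis convex_real_interval(5))
  then show ?thesis by simp
qed

lemma continuous_on_ln_pos: "continuous_on {0<..} (ln :: real \<Rightarrow> real)"
  by (intro continuous_intros) auto

context tracial_state
begin

lemma pos_inv_congruence:
  fixes a s :: 'a
  assumes "pos_inv a" "pos_inv s"
  shows "pos_inv (s * a * s)"
  using positive_congruence[of a s] assms
  by (intro pos_invI unit_mult) (auto simp: pos_inv_positive pos_inv_star pos_inv_unit)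

lemma T_rcfc_mono:
  assumes a: "sa_in a K" and f: "continuous_on K f" and g: "continuous_on K g"
    and le: "\<And>x. x \<in> K \<Longrightarrow> f x \<le> g x"
  shows "T (rcfc f a) \<le> T (rcfc g a)"
proof -
  have "rcfc (\<lambda>x. g x - f x) a \<in> positive_cone"
    using le by (intro rcfc_positive[OF a] continuous_intros f g) auto
  then have "0 \<le> T (rcfc g a - rcfc f a)" by (simp add: rcfc_diff[OF a g f] T_positive)
  then show ?thesis by (simp add: T_diff)
qed

definition logdet :: "'a \<Rightarrow> real" where
  "logdet a = T (rcfc ln a)"

text \<open>Concavity of the logarithm under the trace: the gradient inequality for
  \<open>-ln\<close> with modulus 0.\<close>

lemma logdet_le:
  assumes a: "pos_inv a" and b: "pos_inv b"
  shows "logdet a \<le> logdet b + T (inv_elt b * (a - b))"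
proof -
  obtain c1 where c1: "c1 > 0" "\<And>d. d \<ge> norm a \<Longrightarrow> sa_in a {c1..d}" using pos_inv_bounds[OF a] by blast
  obtain c2 where c2: "c2 > 0" "\<And>d. d \<ge> norm b \<Longrightarrow> sa_in b {c2..d}" using pos_inv_bounds[OF b] by blast
  let ?d = "norm b + c2 + 1"
  have A: "sa_in a {c1..norm a}" and B: "sa_in b {c2..?d}" using c1 c2 by auto
  have cd: "c2 < ?d" using norm_ge_zero[of b] by linarith
  have cl: "continuous_on {c..d} (\<lambda>x::real. ln x)" if "c > 0" for c d
    using that by (intro continuous_intros) auto
  have ci: "continuous_on {c2..?d} (\<lambda>x::real. inverse x)" using c2(1) by (intro continuous_intros) auto
  have "T (rcfc (\<lambda>x. - ln x) b) + T (rcfc (\<lambda>x. - inverse x) b * (a - b)) + 0 * T ((a - b) * (a - b))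
    \<le> T (rcfc (\<lambda>x. - ln x) a)"
  proof (rule T_gradient_inequality[OF A B cd])
    fix x y assume "x \<in> {c1..norm a}" "y \<in> {c2..?d}"
    then have xy: "x > 0" "y > 0" using c1(1) c2(1) by auto
    then have "ln (x / y) \<le> x / y - 1" by (intro ln_le_minus_one) simp
    then have "ln x - ln y \<le> inverse y * (x - y)" using xy by (simp add: ln_div field_simps)
    then show "- ln y + - inverse y * (x - y) + 0 * (x - y)\<^sup>2 \<le> - ln x" by simp
  qed (intro continuous_intros cl ci c1(1) c2(1))+
  then show ?thesis
    unfolding logdet_def rcfc_minus[OF A cl[OF c1(1)]] rcfc_minus[OF B cl[OF c2(1)]]
      rcfc_minus[OF B ci] pos_inv_inv_eq[OF b]
    by (simp add: T_minus)
qed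

text \<open>These are the first-order terms of \<open>logdet (S * A * S)\<close> when
  \<open>S\<close> moves in direction \<open>K\<close>. Cyclicity cancels \<open>A\<close>, leaving
  in each case the first-order term of \<open>logdet\<close> at \<open>S\<close>.\<close>

lemma T_congruence_derivative:
  assumes S: "unit_elt S" and A: "unit_elt A"
  shows "T (inv_elt (S * A * S) * (K * A * S)) = T (inv_elt S * K)"
    and "T (inv_elt (S * A * S) * (S * A * K)) = T (inv_elt S * K)"
proof -
  have i: "inv_elt (S * A * S) = inv_elt S * (inv_elt A * inv_elt S)"
    using S A by (simp add: inv_elt_mult unit_mult)
  have "T (inv_elt (S * A * S) * (K * A * S)) = T (S * (inv_elt S * (inv_elt A * (inv_elt S * (K * A)))))"
    unfolding i using T_comm[of "inv_elt S * (inv_elt A * (inv_elt S * (K * A)))" S] by (simp add: mult.assoc)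
  also have "\<dots> = T ((inv_elt A * (inv_elt S * K)) * A)" using S by (simp add: inv_elt_cancel1 mult.assoc)
  also have "\<dots> = T (A * (inv_elt A * (inv_elt S * K)))" by (rule T_comm)
  finally show "T (inv_elt (S * A * S) * (K * A * S)) = T (inv_elt S * K)"
    using A by (simp add: inv_elt_cancel1)
  show "T (inv_elt (S * A * S) * (S * A * K)) = T (inv_elt S * K)"
    unfolding i using S A by (simp add: mult.assoc inv_elt_cancel2)
qed

text \<open>Along the segment \<open>S\<^sub>s = 1 + s (S - 1)\<close>, the function \<open>logdet (S\<^sub>s A S\<^sub>s) - 2 logdet S\<^sub>s\<close>
  has derivative \<open>0\<close>, because the gradient of \<open>logdet\<close> at \<open>A\<close> is \<open>A\<^sup>-\<^sup>1\<close>.\<close>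

lemma logdet_congruence:
  assumes A: "pos_inv A" and S: "pos_inv S"
  shows "logdet (S * A * S) = logdet A + 2 * logdet S"
proof -
  obtain e where e: "e > 0" "sa_in S {e..norm S}" using pos_inv_bounds[OF S] by blast
  \<comment> \<open>\<open>F s\<close> is a convex combination of \<open>1\<close> and
    \<open>S\<close>, so its spectrum stays above the minimum of \<open>1\<close> and
    \<open>e\<close>; this bounds the inverses uniformly in \<open>s\<close>.\<close>
  define m where "m = min 1 e"
  have m: "m > 0" using e by (simp add: m_def)
  define K where "K = S - 1"
  define F where "F s = 1 + s *\<^sub>R K" for s :: real
  have F: "pos_inv (F s)" "norm (inv_elt (F s)) \<le> 1 / m" if s: "s \<in> {0..1}" for s
  proof -
    have "rcfc (\<lambda>x. 1 + s * (x - 1)) S = F s"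
      by (subst rcfc_add[OF e(2)], (intro continuous_intros)+, subst rcfc_cmult[OF e(2)], (intro continuous_intros)+,
          subst rcfc_diff[OF e(2) continuous_on_id continuous_on_const])
         (simp add: rcfc_id[OF e(2)] rcfc_const[OF e(2)] F_def K_def)
    moreover have "(\<lambda>x. 1 + s * (x - 1)) ` {e..norm S} \<subseteq> {m..}"
    proof clarsimp
      fix x assume "e \<le> x"
      then have "m \<le> x" "m \<le> 1" by (auto simp: m_def)
      then have "(1 - s) * m + s * m \<le> (1 - s) * 1 + s * x"
        using s by (intro add_mono mult_left_mono) auto
      then show "m \<le> 1 + s * (x - 1)" by (simp add: algebra_simps)
    qed
    ultimately have sF: "sa_in (F s) {m..}"
      using sa_in_mono[OF sa_in_rcfc[OF e(2), of "\<lambda>x. 1 + s * (x - 1)"]]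
      by (simp add: continuous_intros)
    show p: "pos_inv (F s)" unfolding pos_inv_def using m by (intro sa_in_mono[OF sF]) auto
    show "norm (inv_elt (F s)) \<le> 1 / m"
      unfolding pos_inv_inv_eq[OF p] using m
      by (intro norm_rcfc_le[OF sF] continuous_intros) (auto simp: divide_simps)
  qed
  define P where "P s = F s * A * F s" for s
  have P: "pos_inv (P s)" if "s \<in> {0..1}" for s
    unfolding P_def by (intro pos_inv_congruence A F that)
  note u = pos_inv_unit[OF F(1)] pos_inv_unit[OF A]
  define a where "a = norm (inv_elt A) * norm K * norm A * norm K"
  \<comment> \<open>The first summand bounds the second-order term \<open>K * A * K\<close> of
    \<open>P t - P s\<close> against the inverse of \<open>P s\<close>, the second the change of the
    gradient of \<open>logdet\<close> between \<open>F s\<close> and \<open>F t\<close>.\<close>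
  define C where "C = a / m\<^sup>2 + 2 * (norm K / m)\<^sup>2"
  define G where "G s = logdet (P s) - 2 * logdet (F s)" for s
  have "G 1 = G 0"
  proof (rule constant_of_quadratic_bound)
    fix s t :: real assume s: "s \<in> {0..1}" and t: "t \<in> {0..1}"
    define h where "h = t - s"
    have Ft: "F t = F s + h *\<^sub>R K" by (simp add: F_def h_def algebra_simps)
    have dP: "P t - P s = h *\<^sub>R (K * A * F s) + h *\<^sub>R (F s * A * K) + h\<^sup>2 *\<^sub>R (K * A * K)"
      unfolding P_def Ft by (simp add: distrib_left distrib_right power2_eq_square scaleR_add_right)
    have "norm (inv_elt (P s) * (K * A * K)) \<le> norm (inv_elt (P s)) * norm (K * A * K)"
      by (rule norm_mult_ineq)
    also have "\<dots> \<le> (1/m * norm (inv_elt A) * (1/m)) * (norm K * norm A * norm K)"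
    proof (rule mult_mono)
      have "inv_elt (P s) = inv_elt (F s) * inv_elt A * inv_elt (F s)"
        unfolding P_def using u(1)[OF s] u(2) by (simp add: inv_elt_mult unit_mult mult.assoc)
      also have "norm \<dots> \<le> norm (inv_elt (F s)) * norm (inv_elt A) * norm (inv_elt (F s))"
        by (meson mult_right_mono norm_ge_zero norm_mult_ineq order_trans)
      also have "\<dots> \<le> 1/m * norm (inv_elt A) * (1/m)"
        using F(2)[OF s] m by (intro mult_mono) auto
      finally show "norm (inv_elt (P s)) \<le> 1/m * norm (inv_elt A) * (1/m)" .
      show "norm (K * A * K) \<le> norm K * norm A * norm K"
        by (meson mult_right_mono norm_ge_zero norm_mult_ineq order_trans)
    qed (use m in auto)
    also have "\<dots> = a / m\<^sup>2" by (simp add: a_def power2_eq_square)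
    finally have b1: "T (inv_elt (P s) * (K * A * K)) \<le> a / m\<^sup>2"
      using abs_T_le[of "inv_elt (P s) * (K * A * K)"] by linarith
    have "logdet (P t) - logdet (P s) \<le> T (inv_elt (P s) * (P t - P s))"
      using logdet_le[OF P[OF t] P[OF s]] by simp
    also have "\<dots> = 2 * h * T (inv_elt (F s) * K) + h\<^sup>2 * T (inv_elt (P s) * (K * A * K))"
      unfolding dP using T_congruence_derivative[OF u(1)[OF s] u(2), of K, folded P_def]
      by (simp add: distrib_left T_add T_scaleR)
    finally have 1: "logdet (P t) - logdet (P s) \<le> 2 * h * T (inv_elt (F s) * K) + h\<^sup>2 * (a / m\<^sup>2)"
      using mult_left_mono[OF b1, of "h\<^sup>2"] by simp
    \<comment> \<open>An upper bound for \<open>- logdet (F t)\<close> requires the tangent at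
      \<open>F t\<close>, not at \<open>F s\<close>; the mismatch with the first-order term in
      \<open>1\<close> is of order \<open>h^2\<close> by the resolvent identity.\<close>
    have 2: "logdet (F s) - logdet (F t) \<le> - h * T (inv_elt (F t) * K)"
      using logdet_le[OF F(1)[OF s] F(1)[OF t]] by (simp add: Ft T_minus T_scaleR)
    have "inv_elt (F s) - inv_elt (F t) = inv_elt (F s) * (F t - F s) * inv_elt (F t)"
      by (rule inv_elt_diff[OF u(1)[OF s] u(1)[OF t]])
    then have "inv_elt (F s) * K - inv_elt (F t) * K = h *\<^sub>R (inv_elt (F s) * K * inv_elt (F t) * K)"
      by (simp add: Ft flip: left_diff_distrib)
    then have eq: "T (inv_elt (F s) * K) - T (inv_elt (F t) * K) = h * T (inv_elt (F s) * K * inv_elt (F t) * K)"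
      by (simp add: T_scaleR flip: T_diff)
    have "norm (inv_elt (F s) * K * inv_elt (F t) * K) \<le> norm (inv_elt (F s)) * norm K * norm (inv_elt (F t)) * norm K"
      by (meson mult_right_mono norm_ge_zero norm_mult_ineq order_trans)
    also have "\<dots> \<le> 1/m * norm K * (1/m) * norm K"
      using F(2)[OF s] F(2)[OF t] m by (intro mult_mono) auto
    also have "\<dots> = (norm K / m)\<^sup>2" by (simp add: power2_eq_square)
    finally have b2: "T (inv_elt (F s) * K * inv_elt (F t) * K) \<le> (norm K / m)\<^sup>2"
      using abs_T_le[of "inv_elt (F s) * K * inv_elt (F t) * K"] by linarith
    have "G t - G s \<le> h\<^sup>2 * (a / m\<^sup>2) + 2 * h * (T (inv_elt (F s) * K) - T (inv_elt (F t) * K))"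
      using 1 2 unfolding G_def by (simp add: right_diff_distrib)
    also have "\<dots> = h\<^sup>2 * (a / m\<^sup>2) + 2 * h\<^sup>2 * T (inv_elt (F s) * K * inv_elt (F t) * K)"
      unfolding eq by (simp add: power2_eq_square)
    also have "\<dots> \<le> h\<^sup>2 * (a / m\<^sup>2) + 2 * h\<^sup>2 * (norm K / m)\<^sup>2"
      using b2 by (intro add_left_mono mult_left_mono) auto
    also have "\<dots> = C * (t - s)\<^sup>2" by (simp add: C_def h_def algebra_simps)
    finally show "G t - G s \<le> C * (t - s)\<^sup>2" .
  qed
  then have "logdet (S * A * S) - 2 * logdet S = logdet A - 2 * logdet 1"
    by (simp add: G_def P_def F_def K_def)
  moreover have "logdet (1 :: 'a) = 0"
  proof -
    have "(0::'a) \<in> positive_cone" using positive_scaleR[OF positive_one, of 0] by simp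
    then have "sa_in (1::'a) {1..}" using sa_in_shift_pos[of "0::'a" 1] by simp
    moreover have "sa_in (1::'a) {-1..1}" using sa_in_norm[of "1::'a"] by simp
    ultimately have 1: "sa_in (1::'a) {1..1}" by (rule sa_in_mono[OF sa_in_Int]) auto
    have "rcfc ln (1::'a) = rcfc (\<lambda>x. 0) 1" by (rule rcfc_cong[OF 1]) auto
    then show ?thesis by (simp add: logdet_def rcfc_const[OF 1] T_zero)
  qed
  ultimately show ?thesis by simp
qed

lemma logdet_one: "logdet 1 = 0"
  using logdet_congruence[OF pos_inv_one pos_inv_one] by simp

lemma logdet_inv:
  assumes "pos_inv a"
  shows "logdet (inv_elt a) = - logdet a"
proof -
  note s = assms[unfolded pos_inv_def]
  have im: "inverse ` {0<..} \<subseteq> {0::real<..}" by auto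
  have "rcfc ln (rcfc inverse a) = rcfc (\<lambda>x. ln (inverse x)) a"
    by (intro rcfc_compose[OF s] continuous_on_subset[OF continuous_on_ln_pos im] continuous_intros) auto
  also have "\<dots> = rcfc (\<lambda>x. - ln x) a"
    by (rule rcfc_cong[OF s]) (auto simp: ln_inverse intro!: continuous_intros)
  also have "\<dots> = - rcfc ln a" by (rule rcfc_minus[OF s continuous_on_ln_pos])
  finally show ?thesis by (simp add: logdet_def pos_inv_inv_eq[OF assms] T_minus)
qed

lemma logdet_scaleR:
  assumes "pos_inv a" "r > 0"
  shows "logdet (r *\<^sub>R a) = ln r + logdet a"
proof -
  note s = assms(1)[unfolded pos_inv_def]
  have im: "(\<lambda>x. r * x) ` {0<..} \<subseteq> {0::real<..}" using assms(2) by auto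
  have "rcfc ln (rcfc (\<lambda>x. r * x) a) = rcfc (\<lambda>x. ln (r * x)) a"
    by (intro rcfc_compose[OF s] continuous_on_subset[OF continuous_on_ln_pos im] continuous_intros)
  also have "\<dots> = rcfc (\<lambda>x. ln r + ln x) a"
    by (rule rcfc_cong[OF s continuous_on_compose2[OF continuous_on_ln_pos _ im]])
       (use assms(2) in \<open>auto simp: ln_mult intro!: continuous_intros\<close>)
  also have "\<dots> = ln r *\<^sub>R 1 + rcfc ln a"
    by (simp add: rcfc_add[OF s continuous_on_const continuous_on_ln_pos] rcfc_const[OF s])
  finally show ?thesis
    using rcfc_cmult[OF s continuous_on_id, of r]
    by (simp add: logdet_def rcfc_id[OF s] T_add T_scaleR T_one)
qed

lemma logdet_le_T: "pos_inv a \<Longrightarrow> logdet a \<le> T a - 1"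
  using logdet_le[of a 1] inv_elt_eq[of 1 "1::'a"] by (simp add: logdet_one T_diff T_one)

end

section \<open>The triangle inequality for the logarithmic determinant\<close>

lemma ln_one_minus_le:
  fixes u :: real
  assumes "0 \<le> u" "u < 1"
  shows "u + u\<^sup>2 / 2 \<le> - ln (1 - u)"
proof -
  have "(\<lambda>v. - ln (1 - v) - v - v\<^sup>2 / 2) 0 \<le> (\<lambda>v. - ln (1 - v) - v - v\<^sup>2 / 2) u"
  proof (rule DERIV_nonneg_imp_nondecreasing[OF assms(1)])
    fix v assume v: "0 \<le> v" "v \<le> u"
    have "((\<lambda>v. - ln (1 - v) - v - v\<^sup>2 / 2) has_real_derivative (1 / (1 - v) - 1 - v)) (at v)"
      using v assms by (auto intro!: derivative_eq_intros simp: divide_simps) (simp add: algebra_simps)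
    moreover have "1 / (1 - v) - 1 - v = v\<^sup>2 / (1 - v)"
      using v assms by (simp add: field_simps power2_eq_square)
    ultimately show "\<exists>y. ((\<lambda>v. - ln (1 - v) - v - v\<^sup>2 / 2) has_real_derivative y) (at v) \<and> 0 \<le> y"
      using v assms by (intro exI[of _ "v\<^sup>2 / (1 - v)"]) auto
  qed
  then show ?thesis by simp
qed

text \<open>\<xi> is the Cayley transform \<open>(x - 1) / (x + 1)\<close>, and
  \<open>1 - \<xi>^2 = 4 * x / (x + 1)^2\<close>, so the right side is
  \<open>- ln (1 - \<xi>^2)\<close>; two terms of its series are kept.\<close>

lemma cayley_ln_bound:
  fixes x :: real
  assumes "x > 0"
  defines "\<xi> \<equiv> 1 - 2 * inverse (x + 1)"
  shows "\<xi>\<^sup>2 + \<xi> ^ 4 / 2 \<le> 2 * ln ((x + 1) / 2) - ln x"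
proof -
  have u: "1 - \<xi>\<^sup>2 = x / ((x + 1) / 2)\<^sup>2"
    using assms(1) unfolding \<xi>_def by (simp add: divide_simps power2_eq_square) (simp add: algebra_simps)
  moreover have "x / ((x + 1) / 2)\<^sup>2 > 0" using assms(1) by simp
  ultimately have "\<xi>\<^sup>2 < 1" by linarith
  then have "\<xi>\<^sup>2 + (\<xi>\<^sup>2)\<^sup>2 / 2 \<le> - ln (1 - \<xi>\<^sup>2)" by (intro ln_one_minus_le) auto
  also have "\<dots> = 2 * ln ((x + 1) / 2) - ln x"
    unfolding u using assms(1) by (simp add: ln_div ln_realpow)
  finally show ?thesis by simp
qed

text \<open>Cauchy-Schwarz for two components weighted 1 and 1/2. For the cross term,
  \<open>p * q\<close> is at most the geometric mean of \<open>x * w\<close> and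
  \<open>z * y\<close>, hence at most their arithmetic mean.\<close>

lemma two_term_cauchy_schwarz:
  fixes p q x y z w :: real
  assumes p: "p\<^sup>2 \<le> x * y" and q: "q\<^sup>2 \<le> z * w"
    and nn: "0 \<le> x" "0 \<le> y" "0 \<le> z" "0 \<le> w"
  shows "(p + q / 2)\<^sup>2 \<le> (x + z / 2) * (y + w / 2)"
proof -
  have "(p * q)\<^sup>2 \<le> (x * y) * (z * w)"
    unfolding power_mult_distrib using p q nn by (intro mult_mono) auto
  also have "\<dots> \<le> ((x * w + z * y) / 2)\<^sup>2"
    using zero_le_power2[of "x * w - z * y"] by (simp add: power2_eq_square field_simps)
  finally have "p * q \<le> (x * w + z * y) / 2"
    by (rule power2_le_imp_le) (use nn in auto)
  then show ?thesis using p q by (simp add: power2_eq_square field_simps)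
qed

context tracial_state
begin

definition logdet_div :: "'a \<Rightarrow> 'a \<Rightarrow> real" where
  "logdet_div a b = logdet ((1/2) *\<^sub>R (a + b)) - (logdet a + logdet b) / 2"

lemma logdet_div_commute: "logdet_div a b = logdet_div b a"
  by (simp add: logdet_div_def add.commute)

lemma logdet_div_nonneg:
  assumes "pos_inv a" "pos_inv b"
  shows "0 \<le> logdet_div a b"
proof -
  let ?m = "(1/2) *\<^sub>R (a + b)"
  have m: "pos_inv ?m" by (rule pos_inv_midpoint[OF assms])
  have "(a - ?m) + (b - ?m) = 0" by (simp add: algebra_simps flip: scaleR_add_left)
  then have "T (inv_elt ?m * (a - ?m)) + T (inv_elt ?m * (b - ?m)) = 0"
    by (simp add: T_zero flip: T_add distrib_left)
  with logdet_le[OF assms(1) m] logdet_le[OF assms(2) m] show ?thesis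
    by (simp add: logdet_div_def)
qed

lemma logdet_div_congruence:
  assumes "pos_inv a" "pos_inv b" "pos_inv s"
  shows "logdet_div (s * a * s) (s * b * s) = logdet_div a b"
proof -
  have eq: "(1/2) *\<^sub>R (s * a * s + s * b * s) = s * ((1/2) *\<^sub>R (a + b)) * s"
    by (simp add: distrib_left distrib_right)
  show ?thesis
    unfolding logdet_div_def eq logdet_congruence[OF pos_inv_midpoint[OF assms(1,2)] assms(3)]
      logdet_congruence[OF assms(1,3)] logdet_congruence[OF assms(2,3)]
    by (simp add: field_simps)
qed

lemma cayley_bound:
  assumes a: "pos_inv a"
  defines "x \<equiv> 1 - 2 *\<^sub>R inv_elt (a + 1)"
  shows "T (x * x) + T (x * x * (x * x)) / 2 \<le> 2 * logdet_div a 1"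
proof -
  obtain c where "c > 0" "sa_in a {c..norm a}" using pos_inv_bounds[OF a] by blast
  define K where "K = {c..norm a}"
  have s: "sa_in a K" and K: "\<And>t. t \<in> K \<Longrightarrow> t > 0" using \<open>c > 0\<close> \<open>sa_in a {c..norm a}\<close> by (auto simp: K_def)
  define \<xi> where "\<xi> = (\<lambda>t::real. 1 - 2 * inverse (t + 1))"
  have ci: "continuous_on K (\<lambda>t. inverse (t + 1))" using K by (intro continuous_intros) fastforce
  have c\<xi>: "continuous_on K \<xi>" unfolding \<xi>_def by (intro continuous_intros ci)
  have a1: "rcfc (\<lambda>t. t + 1) a = a + 1"
    using rcfc_add[OF s continuous_on_id continuous_on_const, of 1] by (simp add: rcfc_id[OF s] rcfc_const[OF s])
  have pa1: "pos_inv (a + 1)" by (intro pos_inv_add a positive_one)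
  have im: "(\<lambda>t. t + 1) ` K \<subseteq> {0<..}" using K by fastforce
  have "rcfc inverse (rcfc (\<lambda>t. t + 1) a) = rcfc (\<lambda>t. inverse (t + 1)) a"
    using im by (intro rcfc_compose[OF s] continuous_intros) auto
  then have "inv_elt (a + 1) = rcfc (\<lambda>t. inverse (t + 1)) a" by (simp add: a1 pos_inv_inv_eq[OF pa1])
  then have x: "x = rcfc \<xi> a"
    unfolding x_def \<xi>_def
    by (subst rcfc_diff[OF s], (intro continuous_intros ci)+, subst rcfc_cmult[OF s ci])
       (simp add: rcfc_const[OF s])
  have cp: "continuous_on K (\<lambda>t. (\<xi> t)\<^sup>2)" "continuous_on K (\<lambda>t. (1/2) * \<xi> t ^ 4)"
    by (intro continuous_intros c\<xi>)+
  have cl: "continuous_on K (\<lambda>t. 2 * ln ((t + 1) / 2))" "continuous_on K (\<lambda>t. ln t)"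
    using K by (intro continuous_intros; fastforce)+
  have "T (x * x) + T (x * x * (x * x)) / 2 = T (rcfc (\<lambda>t. (\<xi> t)\<^sup>2 + (1/2) * \<xi> t ^ 4) a)"
    unfolding x rcfc_add[OF s cp] rcfc_cmult[OF s continuous_on_power[OF c\<xi>]] rcfc_power[OF s c\<xi>]
    by (simp add: T_add T_scaleR power2_eq_square power4_eq_xxxx mult.assoc)
  also have "\<dots> \<le> T (rcfc (\<lambda>t. 2 * ln ((t + 1) / 2) - ln t) a)"
    using cayley_ln_bound K by (intro T_rcfc_mono[OF s] continuous_on_add continuous_on_diff cp cl) (auto simp: \<xi>_def)
  also have "\<dots> = 2 * T (rcfc (\<lambda>t. ln ((t + 1) / 2)) a) - logdet a"
  proof -
    have "continuous_on K (\<lambda>t. ln ((t + 1) / 2))" using K by (intro continuous_intros; fastforce)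
    then show ?thesis
      by (simp add: rcfc_diff[OF s cl] rcfc_cmult[OF s] T_diff T_scaleR logdet_def)
  qed
  also have "rcfc (\<lambda>t. ln ((t + 1) / 2)) a = rcfc ln ((1/2) *\<^sub>R (a + 1))"
  proof -
    have cm: "continuous_on K (\<lambda>t. (1/2) * (t + 1))" by (intro continuous_intros)
    have "(\<lambda>t. (1/2) * (t + 1)) ` K \<subseteq> {0<..}" using K by fastforce
    from rcfc_compose[OF s cm continuous_on_subset[OF continuous_on_ln_pos this]]
    have "rcfc ln (rcfc (\<lambda>t. (1/2) * (t + 1)) a) = rcfc (\<lambda>t. ln ((t + 1) / 2)) a" by simp
    moreover have "rcfc (\<lambda>t. (1/2) * (t + 1)) a = (1/2) *\<^sub>R (a + 1)"
      by (subst rcfc_cmult[OF s]) (auto intro!: continuous_intros simp: a1)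
    ultimately show ?thesis by simp
  qed
  finally show ?thesis by (simp add: logdet_div_def logdet_def[symmetric] logdet_one)
qed

text \<open>The bound \<open>logdet (z* z) \<le> T (z* z) - 1\<close> for \<open>z = 1 + x y\<close> loses only terms of order
  four, which the expansion of \<open>-ln (1 - x\<^sup>2)\<close> absorbs.\<close>

lemma logdet_div_le_one:
  assumes a: "pos_inv a" and b: "pos_inv b"
  shows "sqrt (logdet_div a b) \<le> sqrt (logdet_div a 1) + sqrt (logdet_div b 1)"
proof -
  define u where "u = inv_elt (a + 1)"
  define v where "v = inv_elt (b + 1)"
  define x where "x = 1 - 2 *\<^sub>R u"
  \<comment> \<open>The sign is opposite to that of \<open>x\<close>: it makes
    \<open>1 + x * y\<close> factor as \<open>4 u p v\<close>, and the squares of \<open>y\<close>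
    do not see it.\<close>
  define y where "y = 2 *\<^sub>R v - 1"
  define p where "p = (1/2) *\<^sub>R (a + b)"
  define z where "z = 1 + x * y"
  have pa: "pos_inv (a + 1)" and pb: "pos_inv (b + 1)" by (intro pos_inv_add a b positive_one)+
  have u: "pos_inv u" and v: "pos_inv v" and p: "pos_inv p"
    unfolding u_def v_def p_def by (intro pos_inv_inv pa pb pos_inv_midpoint a b)+
  have star: "star x = x" "star y = y" "star u = u" "star v = v" "star p = p"
    using u v p by (simp_all add: pos_inv_star x_def y_def star_diff star_scaleR)
  have "u * (a + b) * v = u * (a + 1) * v + u * ((b + 1) * v) - 2 *\<^sub>R (u * v)"
    by (simp add: algebra_simps scaleR_2)
  also have "\<dots> = v + u - 2 *\<^sub>R (u * v)"
    unfolding u_def v_def inv_elt_left[OF pos_inv_unit[OF pa]] inv_elt_right[OF pos_inv_unit[OF pb]] by simp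
  finally have uv: "u * (a + b) * v = v + u - 2 *\<^sub>R (u * v)" .
  have "z = 2 *\<^sub>R (v + u - 2 *\<^sub>R (u * v))"
    unfolding z_def x_def y_def by (simp add: algebra_simps scaleR_2)
  also have "\<dots> = 4 *\<^sub>R (u * p * v)" unfolding uv[symmetric] p_def by simp
  finally have z: "z = 4 *\<^sub>R (u * p * v)" .
  \<comment> \<open>The squared modulus of \<open>u * p * v\<close> as nested congruences of
    \<open>1\<close> by \<open>u\<close>, \<open>p\<close> and \<open>v\<close>, so that
    \<open>logdet_congruence\<close> applies three times.\<close>
  define q where "q = v * (p * (u * 1 * u) * p) * v"
  have uu: "pos_inv (u * 1 * u)" and pup: "pos_inv (p * (u * 1 * u) * p)" and q: "pos_inv q"
    unfolding q_def by (intro pos_inv_congruence pos_inv_one u v p)+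
  have zz: "star z * z = 16 *\<^sub>R q"
    unfolding z q_def by (simp add: star_scaleR star_mult star mult.assoc)
  have "logdet (star z * z) = ln 16 + (2 * logdet u + 2 * logdet p + 2 * logdet v)"
    unfolding zz using logdet_congruence[OF pos_inv_one u] logdet_congruence[OF uu p] logdet_congruence[OF pup v]
    by (simp add: logdet_scaleR[OF q] logdet_one) (simp add: q_def)
  moreover have "ln (16::real) = 4 * ln 2" using ln_realpow[of 2 4] by simp
  moreover have "logdet ((1/2) *\<^sub>R (a + 1)) = logdet (a + 1) - ln 2" "logdet ((1/2) *\<^sub>R (b + 1)) = logdet (b + 1) - ln 2"
    by (simp_all add: logdet_scaleR pa pb ln_div)
  moreover have "logdet u = - logdet (a + 1)" "logdet v = - logdet (b + 1)"
    unfolding u_def v_def by (simp_all add: logdet_inv pa pb)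
  ultimately have div_eq: "logdet_div a b = logdet_div a 1 + logdet_div b 1 + logdet (star z * z) / 2"
    unfolding logdet_div_def logdet_one p_def[symmetric] by (simp add: field_simps)
  have "logdet (star z * z) \<le> T (star z * z) - 1"
    unfolding zz by (intro logdet_le_T pos_inv_scaleR q) simp
  moreover have "star z * z = 1 + x * y + y * x + y * (x * x * y)"
    unfolding z_def by (simp add: star_add star_mult star distrib_left distrib_right mult.assoc add.assoc)
  moreover have "T (1 + x * y + y * x + y * (x * x * y)) = 1 + 2 * T (x * y) + T (x * x * (y * y))"
    using T_comm[of y x] T_comm[of y "x * x * y"] by (simp add: T_add T_one mult.assoc)
  ultimately have le: "logdet (star z * z) / 2 \<le> T (x * y) + T (x * x * (y * y)) / 2" by simp
  have nn: "0 \<le> T (w * w)" "0 \<le> T (w * w * (w * w))" if "star w = w" for w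
    using that by (intro T_positive positive_square; simp add: star_mult)+
  have "(T (x * y) + T (x * x * (y * y)) / 2)\<^sup>2
     \<le> (T (x * x) + T (x * x * (x * x)) / 2) * (T (y * y) + T (y * y * (y * y)) / 2)"
    by (intro two_term_cauchy_schwarz T_mult_le nn) (simp_all add: star star_mult)
  also have "\<dots> \<le> (2 * logdet_div a 1) * (2 * logdet_div b 1)"
  proof (rule mult_mono)
    show "T (x * x) + T (x * x * (x * x)) / 2 \<le> 2 * logdet_div a 1"
      using cayley_bound[OF a] by (simp add: x_def u_def)
    have "y * y = (1 - 2 *\<^sub>R inv_elt (b + 1)) * (1 - 2 *\<^sub>R inv_elt (b + 1))"
      unfolding y_def v_def by (simp add: algebra_simps)
    then show "T (y * y) + T (y * y * (y * y)) / 2 \<le> 2 * logdet_div b 1"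
      using cayley_bound[OF b] by simp
    show "0 \<le> 2 * logdet_div a 1" using logdet_div_nonneg[OF a pos_inv_one] by simp
    show "0 \<le> T (y * y) + T (y * y * (y * y)) / 2" using nn[OF star(2)] by simp
  qed
  also have "\<dots> = (2 * (sqrt (logdet_div a 1) * sqrt (logdet_div b 1)))\<^sup>2"
    using logdet_div_nonneg[OF a pos_inv_one] logdet_div_nonneg[OF b pos_inv_one]
    by (simp add: power_mult_distrib)
  finally have "T (x * y) + T (x * x * (y * y)) / 2 \<le> 2 * (sqrt (logdet_div a 1) * sqrt (logdet_div b 1))"
    by (rule power2_le_imp_le)
       (simp add: logdet_div_nonneg a b)
  with le div_eq have "logdet_div a b \<le> logdet_div a 1 + logdet_div b 1 + 2 * (sqrt (logdet_div a 1) * sqrt (logdet_div b 1))"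
    by simp
  also have "\<dots> = (sqrt (logdet_div a 1) + sqrt (logdet_div b 1))\<^sup>2"
    using logdet_div_nonneg[OF a pos_inv_one] logdet_div_nonneg[OF b pos_inv_one]
    by (simp add: power2_sum)
  finally show ?thesis
    by (intro real_le_lsqrt[THEN order_trans] real_sqrt_le_iff[THEN iffD2] order.refl)
       (auto simp: logdet_div_nonneg a b)
qed

lemma logdet_div_triangle:
  assumes a: "pos_inv a" and b: "pos_inv b" and c: "pos_inv c"
  shows "sqrt (logdet_div a b) \<le> sqrt (logdet_div a c) + sqrt (logdet_div c b)"
proof -
  note s = c[unfolded pos_inv_def]
  \<comment> \<open>Congruence by this inverse square root sends \<open>c\<close> to
    \<open>1\<close> and preserves \<open>logdet_div\<close>.\<close>
  define w where "w = rcfc (\<lambda>t. 1 / sqrt t) c"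
  have cw: "continuous_on {0<..} (\<lambda>t::real. 1 / sqrt t)" by (intro continuous_intros) auto
  have w: "pos_inv w" unfolding w_def by (intro pos_inv_rcfc[OF s cw]) auto
  have "w * c * w = rcfc (\<lambda>t. 1 / sqrt t * t * (1 / sqrt t)) c"
    unfolding w_def
    by (subst rcfc_mult[OF s continuous_on_mult[OF cw continuous_on_id] cw], subst rcfc_mult[OF s cw continuous_on_id])
       (simp add: rcfc_id[OF s])
  also have "\<dots> = rcfc (\<lambda>t. 1) c"
    by (intro rcfc_cong[OF s] continuous_on_mult cw continuous_on_id) (auto simp: field_simps)
  finally have wcw: "w * c * w = 1" by (simp add: rcfc_const[OF s])
  have "sqrt (logdet_div (w * a * w) (w * b * w)) \<le> sqrt (logdet_div (w * a * w) (w * c * w)) + sqrt (logdet_div (w * b * w) (w * c * w))"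
    unfolding wcw by (intro logdet_div_le_one pos_inv_congruence a b w)
  then show ?thesis
    by (simp add: logdet_div_congruence a b c w logdet_div_commute[of b c])
qed

end

section \<open>Approximating \<open>x log x\<close> by logarithms and affine functions\<close>

lemma eta_pos: "x > 0 \<Longrightarrow> eta x = x * ln x"
  by (simp add: eta_def)

lemma eta_tangent:
  assumes "0 \<le> x" "0 < y"
  shows "eta y + (1 + ln y) * (x - y) \<le> eta x"
proof (cases "x = 0")
  case False
  with assms have x: "x > 0" by simp
  then have "ln (y / x) \<le> y / x - 1" using assms by (intro ln_le_minus_one) simp
  then have "x * (ln y - ln x) \<le> x * (y / x - 1)" using x assms by (intro mult_left_mono) (simp_all add: ln_div)
  also have "\<dots> = y - x" using x by (simp add: field_simps)
  finally show ?thesis using x assms by (simp add: eta_pos algebra_simps)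
qed (use assms in \<open>simp add: eta_def algebra_simps\<close>)

text \<open>The bound \<open>ln s \<le> s - 1\<close> at \<open>s = sqrt (y / x)\<close> keeps the
  tangent gap above \<open>(sqrt x - sqrt y)^2\<close>. Since \<open>x - y\<close> is this
  difference times \<open>sqrt x + sqrt y\<close>, whose square is at most \<open>4 * M\<close>, the
  modulus \<open>1 / (4 * M)\<close> results.\<close>

lemma eta_tangent_strong:
  assumes x: "0 \<le> x" "x \<le> M" and y: "0 < y" "y \<le> M"
  shows "eta y + (1 + ln y) * (x - y) + 1 / (4 * M) * (x - y)\<^sup>2 \<le> eta x"
proof -
  have M: "M > 0" using y by simp
  have sq: "sqrt x * sqrt x = x" "sqrt y * sqrt y = y" using x y by simp_all
  have 1: "(sqrt x - sqrt y)\<^sup>2 \<le> eta x - eta y - (1 + ln y) * (x - y)"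
  proof (cases "x = 0")
    case True
    then show ?thesis using y by (simp add: eta_def algebra_simps)
  next
    case False
    with x have x0: "x > 0" by simp
    have "ln (sqrt (y / x)) \<le> sqrt (y / x) - 1" using x0 y by (intro ln_le_minus_one) simp
    then have "ln y - ln x \<le> 2 * (sqrt y / sqrt x - 1)"
      using x0 y by (simp add: ln_sqrt ln_div real_sqrt_divide)
    then have "x * (ln y - ln x) \<le> x * (2 * (sqrt y / sqrt x - 1))" using x0 by (intro mult_left_mono) auto
    also have "\<dots> = 2 * sqrt x * sqrt y - 2 * x"
      using x0 by (simp add: field_simps)
    finally show ?thesis using x0 y by (simp add: eta_pos power2_diff algebra_simps)
  qed
  have "(sqrt x - sqrt y) * (sqrt x + sqrt y) = x - y"
    unfolding left_diff_distrib distrib_left sq by (simp add: mult.commute)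
  then have "(x - y)\<^sup>2 = (sqrt x - sqrt y)\<^sup>2 * (sqrt x + sqrt y)\<^sup>2"
    by (simp only: power_mult_distrib[symmetric])
  also have "\<dots> \<le> (sqrt x - sqrt y)\<^sup>2 * (4 * M)"
  proof (intro mult_left_mono)
    have "sqrt x \<le> sqrt M" "sqrt y \<le> sqrt M" using x y by simp_all
    then have "sqrt x + sqrt y \<le> 2 * sqrt M" by linarith
    then have "(sqrt x + sqrt y)\<^sup>2 \<le> (2 * sqrt M)\<^sup>2" using x y by (intro power_mono) auto
    then show "(sqrt x + sqrt y)\<^sup>2 \<le> 4 * M" using M by (simp add: power_mult_distrib)
  qed simp
  finally have "1 / (4 * M) * (x - y)\<^sup>2 \<le> (sqrt x - sqrt y)\<^sup>2" using M by (simp add: field_simps)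
  with 1 show ?thesis by simp
qed

text \<open>Repairs the left end of the lower Riemann sum, which starts at \<open>x + h\<close>
  instead of \<open>x\<close>, and later controls a shift of the midpoint by
  \<open>h\<close>.\<close>

lemma eta_superadditive:
  assumes "0 \<le> x" "0 < h"
  shows "eta x + eta h \<le> eta (x + h)"
proof (cases "x = 0")
  case False
  with assms have x: "x > 0" by simp
  have "x * ln x \<le> x * ln (x + h)" "h * ln h \<le> h * ln (x + h)" using x assms by (auto intro!: mult_left_mono)
  then have "x * ln x + h * ln h \<le> x * ln (x + h) + h * ln (x + h)" by (rule add_mono)
  also have "\<dots> = eta (x + h)" using x assms by (simp add: eta_pos distrib_right)
  finally show ?thesis using x assms by (simp add: eta_pos)
qed (simp add: eta_def)

section \<open>Riemann sums for the derivative \<open>1 + ln\<close> of \<open>eta\<close>\<close>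

lemma eta_riemann_upper:
  assumes "0 \<le> x" "0 < h"
  shows "eta (x + real n * h) - eta x \<le> real n * h + h * (\<Sum>k=1..n. ln (x + real k * h))"
proof (induction n)
  case (Suc n)
  have "eta (x + real (Suc n) * h) + (1 + ln (x + real (Suc n) * h)) * ((x + real n * h) - (x + real (Suc n) * h))
    \<le> eta (x + real n * h)"
    using assms by (intro eta_tangent) (auto intro!: add_nonneg_pos)
  then have "eta (x + real (Suc n) * h) - eta (x + real n * h) \<le> h * (1 + ln (x + real (Suc n) * h))"
    by (simp add: algebra_simps)
  with Suc show ?case by (simp add: algebra_simps)
qed simp

text \<open>The tangents at the nodes are now read to the right, so the increment is displaced by
  one mesh, running from \<open>x + h\<close> to \<open>x + (n + 1) * h\<close>. Nodes start at
  \<open>k = 1\<close>, which keeps the logarithm away from 0 when \<open>x = 0\<close>.\<close>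

lemma eta_riemann_lower:
  assumes "0 \<le> x" "0 < h"
  shows "real n * h + h * (\<Sum>k=1..n. ln (x + real k * h)) \<le> eta (x + real (Suc n) * h) - eta (x + h)"
proof (induction n)
  case (Suc n)
  have "eta (x + real (Suc n) * h) + (1 + ln (x + real (Suc n) * h)) * ((x + real (Suc (Suc n)) * h) - (x + real (Suc n) * h))
    \<le> eta (x + real (Suc (Suc n)) * h)"
    using assms by (intro eta_tangent) (auto intro!: add_nonneg_pos)
  then have "h * (1 + ln (x + real (Suc n) * h)) \<le> eta (x + real (Suc (Suc n)) * h) - eta (x + real (Suc n) * h)"
    by (simp add: algebra_simps)
  with Suc show ?case by (simp add: algebra_simps)
qed simp

text \<open>Writing \<open>ln (x + t)\<close> as \<open>ln t + ln (1 + x / t)\<close> isolates the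
  affine part \<open>(x + t) * ln t + x\<close>; elementary bounds on the second logarithm leave a
  remainder between 0 and \<open>x^2 / t\<close>.\<close>

lemma eta_shift_bounds:
  assumes "0 \<le> x" "0 < t"
  shows "(x + t) * ln t + x \<le> eta (x + t)" "eta (x + t) \<le> (x + t) * ln t + x + x\<^sup>2 / t"
proof -
  have pos: "x + t > 0" using assms by simp
  have "1 + x / t = (x + t) / t" using assms by (simp add: add_divide_distrib)
  then have l: "ln (1 + x / t) = ln (x + t) - ln t" using pos assms by (simp add: ln_div)
  have eq: "eta (x + t) = (x + t) * ln t + (x + t) * ln (1 + x / t)"
    unfolding l eta_pos[OF pos] by (simp add: algebra_simps)
  have "ln (1 + x / t) \<le> x / t" using assms by (intro ln_add_one_self_le_self) simp
  then have "(x + t) * ln (1 + x / t) \<le> (x + t) * (x / t)" using pos by (intro mult_left_mono) auto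
  also have "\<dots> = x + x\<^sup>2 / t" using assms by (simp add: field_simps power2_eq_square)
  finally show "eta (x + t) \<le> (x + t) * ln t + x + x\<^sup>2 / t" unfolding eq by simp
  have "ln (t / (x + t)) \<le> t / (x + t) - 1" using assms by (intro ln_le_minus_one) simp
  moreover have "t / (x + t) - 1 = - (x / (x + t))" using pos by (simp add: field_simps)
  ultimately have "x / (x + t) \<le> ln (1 + x / t)"
    unfolding l using assms pos by (simp add: ln_div)
  then have "(x + t) * (x / (x + t)) \<le> (x + t) * ln (1 + x / t)" using pos by (intro mult_left_mono) auto
  then show "(x + t) * ln t + x \<le> eta (x + t)" unfolding eq using pos by simp
qed

text \<open>Since \<open>d/dt eta (x + t) = 1 + ln (x + t)\<close>, the function \<open>eta\<close> is the integral of
  \<open>-ln (x + t)\<close> over \<open>0 \<le> t \<le> m\<close> up to \<open>eta (x + m)\<close>, which is nearly affine in \<open>x\<close>; this is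
  its Riemann sum with mesh \<open>1/m\<close>.\<close>

definition eta_approx :: "nat \<Rightarrow> real \<Rightarrow> real" where
  "eta_approx m x = (real m * ln m - m) + (ln m + 1) * x
     - (1 / m) * (\<Sum>k=1..m\<^sup>2. ln (x + real k * (1 / m)))"

text \<open>Three losses, uniform for \<open>x\<close> up to \<open>M\<close>:
  \<open>- eta (1/m)\<close> from the left end, the passage from \<open>m\<close> to
  \<open>m + 1/m\<close> at the right end, and the quadratic remainder of
  \<open>eta_shift_bounds\<close>.\<close>

definition eta_error :: "real \<Rightarrow> nat \<Rightarrow> real" where
  "eta_error M m = ln m / m + ((M + (m + 1 / m)) * ln (m + 1 / m) - (M + m) * ln m) + M\<^sup>2 / m"

lemma eta_error_tendsto: "eta_error M \<longlonglongrightarrow> 0"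
  unfolding eta_error_def by real_asymp

lemma eta_approx_bounds:
  assumes m: "m > 0" and x: "0 \<le> x" "x \<le> M"
  shows "eta_approx m x \<le> eta x" "eta x \<le> eta_approx m x + eta_error M m"
proof -
  define h where "h = 1 / real m"
  have h: "h > 0" "real (m\<^sup>2) * h = m" "real (Suc (m\<^sup>2)) * h = m + h"
    using m by (simp_all add: h_def field_simps power2_eq_square)
  define S where "S = h * (\<Sum>k=1..m\<^sup>2. ln (x + real k * h))"
  have approx: "eta_approx m x = (x + m) * ln m + x - m - S"
    by (simp add: eta_approx_def S_def h_def algebra_simps)
  have up: "eta (x + m) - eta x \<le> m + S"
    using eta_riemann_upper[OF x(1) h(1), of "m\<^sup>2"] unfolding h S_def by simp
  have lo: "m + S \<le> eta (x + (m + h)) - eta (x + h)"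
    using eta_riemann_lower[OF x(1) h(1), of "m\<^sup>2"] unfolding h S_def by simp
  show "eta_approx m x \<le> eta x"
    using eta_shift_bounds(1)[OF x(1), of "real m"] up m unfolding approx by simp
  have 1: "eta x + eta h \<le> eta (x + h)" by (rule eta_superadditive[OF x(1) h(1)])
  have 2: "eta (x + (m + h)) \<le> (x + (m + h)) * ln (m + h) + x + x\<^sup>2 / (m + h)"
    using m h(1) by (intro eta_shift_bounds x) simp
  have 3: "x\<^sup>2 / (m + h) \<le> M\<^sup>2 / m" using m h(1) x by (intro frac_le power_mono) auto
  have 4: "(x + (m + h)) * ln (m + h) - (x + m) * ln m \<le> (M + (m + h)) * ln (m + h) - (M + m) * ln m"
  proof -
    have "x * (ln (m + h) - ln m) \<le> M * (ln (m + h) - ln m)"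
      using m h(1) x by (intro mult_right_mono) auto
    then show ?thesis by (simp add: algebra_simps)
  qed
  have 5: "eta h = - (ln m / m)" using m by (simp add: eta_pos h_def ln_div)
  have arith: "ex \<le> R + x - \<mu> - S + (L + \<Delta> + Q)"
    if "ex + eh \<le> exh" "E \<le> P + x + q" "q \<le> Q" "P - R \<le> \<Delta>" "eh = - L" "\<mu> + S \<le> E - exh"
    for ex eh exh E P q Q R \<Delta> L \<mu> S :: real
    using that by linarith
  show "eta x \<le> eta_approx m x + eta_error M m"
    unfolding approx eta_error_def h_def[symmetric] by (rule arith[OF 1 2 3 4 5 lo])
qed

lemma continuous_on_ln_shift: "t > 0 \<Longrightarrow> continuous_on {0..M} (\<lambda>x::real. ln (x + t))"
  by (intro continuous_intros) fastforce

lemma continuous_on_eta_approx: "m > 0 \<Longrightarrow> continuous_on {0..M} (eta_approx m)"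
  unfolding eta_approx_def
  by (intro continuous_on_diff continuous_on_add continuous_on_mult continuous_on_sum
      continuous_on_const continuous_on_id continuous_on_ln_shift) auto

text \<open>A uniform limit of continuous approximants, which settles the delicate point 0 together
  with the rest.\<close>

lemma continuous_on_eta: "continuous_on {0..M} eta"
proof (rule uniform_limit_theorem)
  show "\<forall>\<^sub>F m in sequentially. continuous_on {0..M} (eta_approx m)"
    using eventually_gt_at_top[of 0] by eventually_elim (rule continuous_on_eta_approx)
  show "uniform_limit {0..M} eta_approx eta sequentially"
  proof (rule uniform_limitI)
    fix e :: real assume "e > 0"
    with eta_error_tendsto[of M] have "\<forall>\<^sub>F m in sequentially. eta_error M m < e"
      by (rule order_tendstoD)
    with eventually_gt_at_top[of 0]
    show "\<forall>\<^sub>F m in sequentially. \<forall>x\<in>{0..M}. dist (eta_approx m x) (eta x) < e"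
    proof eventually_elim
      case (elim m)
      show ?case
      proof
        fix x assume "x \<in> {0..M}"
        then show "dist (eta_approx m x) (eta x) < e"
          using eta_approx_bounds[of m x M] elim by (auto simp: dist_real_def abs_less_iff)
      qed
    qed
  qed
qed simp

section \<open>The metric\<close>

lemma positive_midpoint:
  assumes "a \<in> positive_cone" "b \<in> positive_cone"
  shows "(1/2) *\<^sub>R (a + b) \<in> positive_cone"
  using assms by (intro positive_scaleR positive_add) auto

context tracial_state
begin

text \<open>Generic in \<open>f\<close>, since it is taken both at \<open>eta\<close> and at every
  \<open>eta_approx m\<close>.\<close>

definition jdiv :: "(real \<Rightarrow> real) \<Rightarrow> 'a \<Rightarrow> 'a \<Rightarrow> real" where
  "jdiv f a b = (T (rcfc f a) + T (rcfc f b)) / 2 - T (rcfc f ((1/2) *\<^sub>R (a + b)))"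

lemma T_eta_approx:
  assumes a: "a \<in> positive_cone" and m: "m > 0"
  shows "T (rcfc (eta_approx m) a) = (real m * ln m - m) + (ln m + 1) * T a
     - (1 / m) * (\<Sum>k=1..m\<^sup>2. logdet (a + (real k * (1 / m)) *\<^sub>R 1))"
proof -
  note s = sa_in_positive[OF a]
  define t where "t k = real k * (1 / real m)" for k
  have t: "t k > 0" if "k \<in> {1..m\<^sup>2}" for k using that m by (simp add: t_def)
  have cl: "continuous_on {0..norm a} (\<lambda>x. ln (x + t k))" if "k \<in> {1..m\<^sup>2}" for k
    by (rule continuous_on_ln_shift[OF t[OF that]])
  have cs: "continuous_on {0..norm a} (\<lambda>x. \<Sum>k=1..m\<^sup>2. ln (x + t k))" by (intro continuous_on_sum cl)
  have rs: "rcfc (\<lambda>x. \<Sum>k=1..m\<^sup>2. ln (x + t k)) a = (\<Sum>k=1..m\<^sup>2. rcfc (\<lambda>x. ln (x + t k)) a)"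
    by (rule rcfc_sum[OF s]) (rule cl)
  have ca: "continuous_on {0..norm a} (\<lambda>x. (real m * ln m - m) + (ln m + 1) * x)" by (intro continuous_intros)
  have "rcfc (eta_approx m) a = rcfc (\<lambda>x. ((real m * ln m - m) + (ln m + 1) * x) - (1 / m) * (\<Sum>k=1..m\<^sup>2. ln (x + t k))) a"
    by (simp add: eta_approx_def[abs_def] t_def)
  also have "\<dots> = ((real m * ln m - m) *\<^sub>R 1 + (ln m + 1) *\<^sub>R a) - (1 / m) *\<^sub>R (\<Sum>k=1..m\<^sup>2. rcfc (\<lambda>x. ln (x + t k)) a)"
    unfolding rcfc_diff[OF s ca continuous_on_mult[OF continuous_on_const cs]] rcfc_cmult[OF s cs] rs
      rcfc_add[OF s continuous_on_const continuous_on_mult[OF continuous_on_const continuous_on_id]]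
      rcfc_cmult[OF s continuous_on_id] rcfc_const[OF s] rcfc_id[OF s] ..
  also have "(\<Sum>k=1..m\<^sup>2. rcfc (\<lambda>x. ln (x + t k)) a) = (\<Sum>k=1..m\<^sup>2. rcfc ln (a + t k *\<^sub>R 1))"
  proof (rule sum.cong[OF refl])
    fix k assume k: "k \<in> {1..m\<^sup>2}"
    have "(\<lambda>x. x + t k) ` {0..norm a} \<subseteq> {0<..}" using t[OF k] by auto
    from rcfc_shift[OF s continuous_on_subset[OF continuous_on_ln_pos this]]
    show "rcfc (\<lambda>x. ln (x + t k)) a = rcfc ln (a + t k *\<^sub>R 1)" by simp
  qed
  finally show ?thesis by (simp add: T_add T_diff T_scaleR T_sum T_one logdet_def t_def)
qed

text \<open>Affine functions have zero Jensen divergence, so only the logarithms survive, with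
  positive weights \<open>1 / m\<close>.\<close>

lemma jdiv_eta_approx:
  assumes a: "a \<in> positive_cone" and b: "b \<in> positive_cone" and m: "m > 0"
  shows "jdiv (eta_approx m) a b =
    (\<Sum>k=1..m\<^sup>2. (1 / m) * logdet_div (a + (real k * (1 / m)) *\<^sub>R 1) (b + (real k * (1 / m)) *\<^sub>R 1))"
proof -
  define s where "s k = (real k * (1 / real m)) *\<^sub>R (1::'a)" for k
  have mid: "(1/2) *\<^sub>R ((a + s k) + (b + s k)) = (1/2) *\<^sub>R (a + b) + s k" for k
    by (simp add: algebra_simps flip: scaleR_add_left)
  have "(\<Sum>k=1..m\<^sup>2. (1 / m) * logdet_div (a + s k) (b + s k))
    = (1 / m) * ((\<Sum>k=1..m\<^sup>2. logdet ((1/2) *\<^sub>R (a + b) + s k))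
       - ((\<Sum>k=1..m\<^sup>2. logdet (a + s k)) + (\<Sum>k=1..m\<^sup>2. logdet (b + s k))) / 2)"
    unfolding logdet_div_def mid
    by (simp only: sum_distrib_left[symmetric] sum_subtractf sum_divide_distrib[symmetric] sum.distrib)
  moreover have "T ((1/2) *\<^sub>R (a + b)) = (T a + T b) / 2" by (simp add: T_add T_scaleR)
  moreover have "((\<alpha> + \<beta> * ta - w * sa) + (\<alpha> + \<beta> * tb - w * sb)) / 2 - (\<alpha> + \<beta> * ((ta + tb) / 2) - w * sc)
    = w * (sc - (sa + sb) / 2)" for \<alpha> \<beta> w ta tb sa sb sc :: real
    by (simp add: field_simps)
  ultimately show ?thesis
    unfolding jdiv_def T_eta_approx[OF a m] T_eta_approx[OF b m] T_eta_approx[OF positive_midpoint[OF a b] m]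
      s_def[symmetric] by (simp only:)
qed

text \<open>By \<open>jdiv_eta_approx\<close> the square root is the Euclidean norm of the vector
  with entries \<open>d x y k\<close>. Each entry obeys the triangle inequality, and Minkowski's
  inequality for \<open>L2_set\<close> combines them.\<close>

lemma jdiv_eta_approx_triangle:
  assumes "a \<in> positive_cone" "b \<in> positive_cone" "c \<in> positive_cone" "m > 0"
  shows "sqrt (jdiv (eta_approx m) a b) \<le> sqrt (jdiv (eta_approx m) a c) + sqrt (jdiv (eta_approx m) c b)"
proof -
  define p where "p x k = x + (real k * (1 / real m)) *\<^sub>R (1::'a)" for x k
  define d where "d x y k = sqrt ((1 / m) * logdet_div (p x k) (p y k))" for x y k
  have p: "pos_inv (p x k)" if "x \<in> positive_cone" "k \<in> {1..m\<^sup>2}" for x k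
    unfolding p_def using that assms(4) by (intro pos_inv_shift) auto
  have nn: "0 \<le> logdet_div (p x k) (p y k)"
    if "x \<in> positive_cone" "y \<in> positive_cone" "k \<in> {1..m\<^sup>2}" for x y k
    by (intro logdet_div_nonneg p that)
  have J: "sqrt (jdiv (eta_approx m) x y) = L2_set (d x y) {1..m\<^sup>2}"
    if xy: "x \<in> positive_cone" "y \<in> positive_cone" for x y
    unfolding jdiv_eta_approx[OF xy assms(4)] L2_set_def p_def[symmetric]
  proof (intro arg_cong[of _ _ sqrt] sum.cong refl)
    fix k assume "k \<in> {1..m\<^sup>2}"
    with nn[OF xy] show "(1 / m) * logdet_div (p x k) (p y k) = (d x y k)\<^sup>2"
      unfolding d_def by (subst real_sqrt_pow2) simp_all
  qed
  have "L2_set (d a b) {1..m\<^sup>2} \<le> L2_set (\<lambda>k. d a c k + d c b k) {1..m\<^sup>2}"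
  proof (rule L2_set_mono)
    fix k assume k: "k \<in> {1..m\<^sup>2}"
    have "sqrt (1 / m) * sqrt (logdet_div (p a k) (p b k))
      \<le> sqrt (1 / m) * (sqrt (logdet_div (p a k) (p c k)) + sqrt (logdet_div (p c k) (p b k)))"
      by (intro mult_left_mono logdet_div_triangle p assms k) simp
    then show "d a b k \<le> d a c k + d c b k"
      unfolding d_def real_sqrt_mult by (simp only: distrib_left)
    show "0 \<le> d a b k" unfolding d_def using nn[OF assms(1,2) k] by simp
  qed
  also have "\<dots> \<le> L2_set (d a c) {1..m\<^sup>2} + L2_set (d c b) {1..m\<^sup>2}" by (rule L2_set_triangle_ineq)
  finally show ?thesis by (simp add: J assms)
qed

section \<open>Passage to the limit\<close>

lemma T_eta_approx_tendsto:
  assumes "a \<in> positive_cone"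
  shows "(\<lambda>m. T (rcfc (eta_approx m) a)) \<longlonglongrightarrow> T (rcfc eta a)"
proof -
  note s = sa_in_positive[OF assms]
  have bounds: "T (rcfc eta a) - eta_error (norm a) m \<le> T (rcfc (eta_approx m) a) \<and>
    T (rcfc (eta_approx m) a) \<le> T (rcfc eta a)" if m: "m > 0" for m
  proof -
    note c = continuous_on_eta_approx[OF m]
    have "T (rcfc eta a) \<le> T (rcfc (\<lambda>x. eta_approx m x + eta_error (norm a) m) a)"
      by (intro T_rcfc_mono[OF s] continuous_on_eta continuous_on_add c continuous_on_const eta_approx_bounds m) auto
    moreover have "T (rcfc (eta_approx m) a) \<le> T (rcfc eta a)"
      by (intro T_rcfc_mono[OF s] continuous_on_eta c eta_approx_bounds(1)[OF m]) auto
    ultimately show ?thesis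
      by (simp add: rcfc_add[OF s c continuous_on_const] rcfc_const[OF s] T_add T_scaleR T_one)
  qed
  show ?thesis
  proof (rule tendsto_sandwich[OF _ _ _ tendsto_const])
    show "\<forall>\<^sub>F m in sequentially. T (rcfc eta a) - eta_error (norm a) m \<le> T (rcfc (eta_approx m) a)"
      "\<forall>\<^sub>F m in sequentially. T (rcfc (eta_approx m) a) \<le> T (rcfc eta a)"
      using eventually_gt_at_top[of 0] by (eventually_elim, use bounds in blast)+
    show "(\<lambda>m. T (rcfc eta a) - eta_error (norm a) m) \<longlonglongrightarrow> T (rcfc eta a)"
      using tendsto_diff[OF tendsto_const eta_error_tendsto[of "norm a"]] by simp
  qed
qed

lemma jdiv_eta_triangle:
  assumes "a \<in> positive_cone" "b \<in> positive_cone" "c \<in> positive_cone"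
  shows "sqrt (jdiv eta a b) \<le> sqrt (jdiv eta a c) + sqrt (jdiv eta c b)"
proof -
  have lim: "(\<lambda>m. sqrt (jdiv (eta_approx m) x y)) \<longlonglongrightarrow> sqrt (jdiv eta x y)"
    if "x \<in> positive_cone" "y \<in> positive_cone" for x y
    unfolding jdiv_def using that
    by (intro tendsto_intros T_eta_approx_tendsto positive_midpoint) auto
  show ?thesis
    by (rule tendsto_le[OF _ tendsto_add[OF lim lim] lim])
       (auto simp: assms intro!: eventually_mono[OF eventually_gt_at_top[of 0]] jdiv_eta_approx_triangle)
qed

text \<open>The gradient inequality needs the midpoint to be invertible; it is applied to \<open>a + h\<close>, \<open>b + h\<close>,
  and \<open>h\<close> tends to \<open>0\<close>.\<close>

lemma jdiv_eta_lower_bound: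
  assumes a: "a \<in> positive_cone" and b: "b \<in> positive_cone"
  defines "M \<equiv> norm a + norm b + 1"
  shows "T ((a - b) * (a - b)) / (16 * M) \<le> jdiv eta a b"
proof -
  define c where "c = (1/2) *\<^sub>R (a + b)"
  have c: "c \<in> positive_cone" unfolding c_def by (rule positive_midpoint[OF a b])
  have nc: "norm c \<le> norm a + norm b"
    unfolding c_def using norm_triangle_ineq[of a b] norm_ge_zero[of a] norm_ge_zero[of b]
    by (simp del: norm_ge_zero)
  have M: "M \<ge> 1" by (simp add: M_def)
  have s: "sa_in x {0..M - 1}" if "x \<in> {a, b, c}" for x
    using that a b c nc norm_ge_zero[of a] norm_ge_zero[of b]
    by (auto intro!: sa_in_mono[OF sa_in_positive] simp: M_def simp del: norm_ge_zero)
  \<comment> \<open>\<open>M\<close> leaves room for shifts \<open>h < 1\<close>. The extra terms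
    are the price of the shift: \<open>eta h\<close> from superadditivity at the midpoint,
    \<open>- h * (1 + ln M)\<close> from the tangent bound at \<open>a\<close> and
    \<open>b\<close>.\<close>
  have key: "T ((a - b) * (a - b)) / (16 * M) + eta h - h * (1 + ln M) \<le> jdiv eta a b"
    if h: "0 < h" "h < 1" for h
  proof -
    have sh: "sa_in (x + h *\<^sub>R 1) {h..M}" if "x \<in> {a, b, c}" for x
      using h by (intro sa_in_mono[OF sa_in_shift[OF s[OF that], of h]]) auto
    have sh0: "sa_in (x + h *\<^sub>R 1) {0..M}" if "x \<in> {a, b, c}" for x
      using h by (intro sa_in_mono[OF sh[OF that]]) auto
    define f' where "f' = (\<lambda>y::real. 1 + ln y)"
    have f': "continuous_on {h..M} f'" unfolding f'_def using h by (intro continuous_intros) auto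
    have hM: "h < M" using h M by simp
    have grad: "T (rcfc eta (c + h *\<^sub>R 1)) + T (rcfc f' (c + h *\<^sub>R 1) * (x - c))
      + 1 / (4 * M) * T ((x - c) * (x - c)) \<le> T (rcfc eta (x + h *\<^sub>R 1))" if x: "x \<in> {a, b}" for x
    proof -
      have "T (rcfc eta (c + h *\<^sub>R 1)) + T (rcfc f' (c + h *\<^sub>R 1) * ((x + h *\<^sub>R 1) - (c + h *\<^sub>R 1)))
        + 1 / (4 * M) * T (((x + h *\<^sub>R 1) - (c + h *\<^sub>R 1)) * ((x + h *\<^sub>R 1) - (c + h *\<^sub>R 1)))
        \<le> T (rcfc eta (x + h *\<^sub>R 1))"
      proof (rule T_gradient_inequality[OF sh0 sh hM])
        show "continuous_on {h..M} eta" using h by (intro continuous_on_subset[OF continuous_on_eta[of M]]) auto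
        fix u v assume "u \<in> {0..M}" "v \<in> {h..M}"
        then show "eta v + f' v * (u - v) + 1 / (4 * M) * (u - v)\<^sup>2 \<le> eta u"
          unfolding f'_def using h by (intro eta_tangent_strong) auto
      qed (use x in \<open>auto intro: f' continuous_on_eta\<close>)
      then show ?thesis by simp
    qed
    have ac: "a - c = (1/2) *\<^sub>R (a - b)" and bc: "b - c = - ((1/2) *\<^sub>R (a - b))"
      unfolding c_def by (simp_all add: algebra_simps) (simp_all flip: scaleR_add_left)
    \<comment> \<open>The gradient terms cancel because \<open>a - c\<close> and
      \<open>b - c\<close> are opposite. Each quadratic term carries a quarter of
      \<open>T ((a - b) * (a - b))\<close>, so \<open>1 / (4 * M)\<close> becomes
      \<open>1 / (16 * M)\<close> per point.\<close>
    have 1: "2 * T (rcfc eta (c + h *\<^sub>R 1)) + T ((a - b) * (a - b)) / (8 * M)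
      \<le> T (rcfc eta (a + h *\<^sub>R 1)) + T (rcfc eta (b + h *\<^sub>R 1))"
      using grad[of a] grad[of b] unfolding ac bc by (simp add: T_minus T_scaleR)
    have ch: "continuous_on {0..M - 1} (\<lambda>y. eta (y + h))"
      using h by (intro continuous_on_compose2[OF continuous_on_eta[of M]] continuous_intros) auto
    have shift: "rcfc eta (x + h *\<^sub>R 1) = rcfc (\<lambda>y. eta (y + h)) x" if "x \<in> {a, b, c}" for x
      using h by (intro rcfc_shift[OF s[OF that]] continuous_on_subset[OF continuous_on_eta[of M]]) auto
    have up: "T (rcfc eta (x + h *\<^sub>R 1)) \<le> T (rcfc eta x) + h * (1 + ln M)" if x: "x \<in> {a, b}" for x
    proof -
      have sx: "sa_in x {0..M - 1}" using s x by auto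
      have "T (rcfc (\<lambda>y. eta (y + h)) x) \<le> T (rcfc (\<lambda>y. eta y + h * (1 + ln M)) x)"
      proof (intro T_rcfc_mono[OF sx ch] continuous_on_add continuous_on_eta continuous_on_const)
        fix y assume y: "y \<in> {0..M - 1}"
        have "eta (y + h) + (1 + ln (y + h)) * (y - (y + h)) \<le> eta y"
          using h y by (intro eta_tangent) auto
        moreover have "h * ln (y + h) \<le> h * ln M" using h y by (intro mult_left_mono) auto
        ultimately show "eta (y + h) \<le> eta y + h * (1 + ln M)" by (simp add: algebra_simps)
      qed
      moreover have "rcfc eta (x + h *\<^sub>R 1) = rcfc (\<lambda>y. eta (y + h)) x" using x by (intro shift) auto
      ultimately show ?thesis
        by (simp add: rcfc_add[OF sx continuous_on_eta continuous_on_const] rcfc_const[OF sx] T_add T_scaleR T_one)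
    qed
    have sc: "sa_in c {0..M - 1}" using s by auto
    have lo: "T (rcfc eta c) + eta h \<le> T (rcfc eta (c + h *\<^sub>R 1))"
    proof -
      have "T (rcfc (\<lambda>y. eta y + eta h) c) \<le> T (rcfc (\<lambda>y. eta (y + h)) c)"
        using h by (intro T_rcfc_mono[OF sc _ ch] continuous_on_add continuous_on_eta continuous_on_const eta_superadditive) auto
      then show ?thesis
        by (simp add: shift rcfc_add[OF sc continuous_on_eta continuous_on_const] rcfc_const[OF sc] T_add T_scaleR T_one)
    qed
    have 2: "T ((a - b) * (a - b)) / (8 * M) = 2 * (T ((a - b) * (a - b)) / (16 * M))" by simp
    have arith: "q + e - w \<le> (ta + tb) / 2 - tc"
      if "p = 2 * q" "2 * tch + p \<le> tah + tbh" "tah \<le> ta + w" "tbh \<le> tb + w" "tc + e \<le> tch"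
      for q p e w ta tb tc tah tbh tch :: real
      using that by (simp add: field_simps)
    show ?thesis
      unfolding jdiv_def c_def[symmetric]
      by (rule arith[OF 2 1 up[OF insertI1] up[OF insertI2[OF singletonI]] lo])
  qed
  have "((\<lambda>h. T ((a - b) * (a - b)) / (16 * M) + eta h - h * (1 + ln M)) \<longlongrightarrow>
    T ((a - b) * (a - b)) / (16 * M) + 0 - 0 * (1 + ln M)) (at_right 0)"
  proof (intro tendsto_intros)
    have "((\<lambda>h::real. h * ln h) \<longlongrightarrow> 0) (at_right 0)" by real_asymp
    then show "(eta \<longlongrightarrow> 0) (at_right 0)"
      by (rule Lim_transform_eventually) (auto simp: eta_pos eventually_at_right_less intro: eventually_mono[OF eventually_at_right_less])
  qed
  then have "T ((a - b) * (a - b)) / (16 * M) + 0 - 0 * (1 + ln M) \<le> jdiv eta a b"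
  proof (rule tendsto_upperbound)
    show "\<forall>\<^sub>F h in at_right 0. T ((a - b) * (a - b)) / (16 * M) + eta h - h * (1 + ln M) \<le> jdiv eta a b"
      using eventually_at_right_real[of 0 "1::real"] by (auto elim!: eventually_mono intro: key)
  qed simp
  then show ?thesis by simp
qed

section \<open>The metric axioms\<close>

lemma jdiv_eta_nonneg:
  assumes a: "a \<in> positive_cone" and b: "b \<in> positive_cone"
  shows "0 \<le> jdiv eta a b"
proof -
  have "0 \<le> T ((a - b) * (a - b))"
    using a b by (intro T_positive positive_square) (simp add: star_diff positive_star)
  then have "0 \<le> T ((a - b) * (a - b)) / (16 * (norm a + norm b + 1))" by simp
  with jdiv_eta_lower_bound[OF a b] show ?thesis by simp
qed

text \<open>The quantitative lower bound forces the trace of the square of \<open>a - b\<close> to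
  vanish, and faithfulness of the trace finishes.\<close>

lemma jdiv_eta_eq_0:
  assumes a: "a \<in> positive_cone" and b: "b \<in> positive_cone"
  shows "jdiv eta a b = 0 \<longleftrightarrow> a = b"
proof
  assume "jdiv eta a b = 0"
  with jdiv_eta_lower_bound[OF a b] have "T ((a - b) * (a - b)) / (16 * (norm a + norm b + 1)) \<le> 0" by simp
  then have "T ((a - b) * (a - b)) \<le> 0"
    by (simp add: divide_le_0_iff) (smt (verit) norm_ge_zero)
  moreover have st: "star (a - b) = a - b" using a b by (simp add: star_diff positive_star)
  ultimately have "T (star (a - b) * (a - b)) = 0"
    using T_star_mult_nonneg[of "a - b"] by simp
  then have "a - b = 0" using st by (intro trace_faithful) (simp add: trace_self_adjoint star_mult)
  then show "a = b" by simp
next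
  assume "a = b"
  then show "jdiv eta a b = 0" by (simp add: jdiv_def flip: scaleR_2)
qed

lemma jensen_div_eq:
  assumes a: "a \<in> positive_cone" and b: "b \<in> positive_cone"
  shows "jensen_div \<tau> a b = of_real (jdiv eta a b)"
proof -
  have eq: "\<tau> (eta_cfc x) = of_real (T (rcfc eta x))" if "x \<in> positive_cone" for x
    using trace_self_adjoint[OF star_rcfc[OF sa_in_positive[OF that] continuous_on_eta]]
    by (simp add: eta_cfc_def rcfc_def)
  show ?thesis
    unfolding jensen_div_def jdiv_def eq[OF a] eq[OF b] eq[OF positive_midpoint[OF a b]]
    by (simp add: add_divide_distrib)
qed

text \<open>An arbitrary subset of the cone as carrier covers the cone and the density set at
  once.\<close>

lemma Metric_space_jensen_dist:
  assumes "S \<subseteq> positive_cone"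
  shows "Metric_space S (jensen_dist \<tau>)"
proof
  fix x y
  show "0 \<le> jensen_dist \<tau> x y" by (simp add: jensen_dist_def jensen_div_eq jdiv_eta_nonneg)
  show "jensen_dist \<tau> x y = jensen_dist \<tau> y x" by (simp add: jensen_dist_def jensen_div_def add.commute)
next
  fix x y assume "x \<in> S" "y \<in> S"
  then show "jensen_dist \<tau> x y = 0 \<longleftrightarrow> x = y"
    using assms by (auto simp: jensen_dist_def jensen_div_eq jdiv_eta_eq_0)
next
  fix x y z assume "x \<in> S" "y \<in> S" "z \<in> S"
  then have "x \<in> positive_cone" "y \<in> positive_cone" "z \<in> positive_cone" using assms by auto
  then show "jensen_dist \<tau> x z \<le> jensen_dist \<tau> x y + jensen_dist \<tau> y z"
    by (simp add: jensen_dist_def jensen_div_eq jdiv_eta_triangle)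
qed

end

theorem theorem1p7:
  fixes \<tau> :: "'a::unital_cstar_algebra \<Rightarrow> complex"
  assumes "faithful_tracial_state \<tau>"
  shows "(\<forall>A\<in>positive_cone. \<forall>B\<in>positive_cone. jensen_div \<tau> A B \<in> \<real>\<^sub>\<ge>\<^sub>0) \<and>
         Metric_space positive_cone (jensen_dist \<tau>) \<and>
         Metric_space (density_set \<tau>) (jensen_dist \<tau>)"
proof -
  interpret tracial_state \<tau> by unfold_locales (rule assms)
  have "density_set \<tau> \<subseteq> positive_cone" by (auto simp: density_set_def)
  then show ?thesis
    by (auto simp: jensen_div_eq jdiv_eta_nonneg intro!: Metric_space_jensen_dist)
qed

end
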